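(* Let $\Omega\subset\mathbb{R}^2$ be a bounded open set, let $\mu$ be a Radon measure on $\Omega$ with $\mu\in H^{-1}(\Omega)$, and let $h_\mu\in H^1(\Omega)$ be a stationary harmonic function with $\Delta h_\mu=\mu$ in $\Omega$. Let $z_0\in\operatorname{supp}\mu$ be a zero of even order of $\omega_{h_\mu}$, and assume $h_\mu(z_0)=0$. Then there exist a neighborhood $V$ of $z_0$, a harmonic function $H$ in $V$ and a function $\theta:V\to\{\pm1\}$ such that $$h_\mu(z)=\theta(z)H(z)\quad\text{in }V.$$ The function $\theta H$ is continuous and $\nabla H(z_0)=0$. Moreover, the support of $\mu_{\lfloor V}$ is a union of smooth curves included in $\{z\in V:\ H(z)=0\}$ which end at $z_0$.
   Context: $\mathbb{R}^2$ is identified with $\mathbb{C}$. Radon measures may be signed; $\mu_{\lfloor V}$ is the restriction of $\mu$ to $V$; the support of a measure is the complement of the largest open set on which it vanishes. $H^{-1}(\Omega)$ is the dual of $H^1_0(\Omega)$. The equation $\Delta h_\mu=\mu$ is in the sense of distributions. A function $h\in H^1(\Omega)$ is stationary harmonic if $\operatorname{div}T_h=0$ in $\Omega$ in the sense of distributions (row by row), where $$T_h=\begin{pmatrix}\frac12[(\partial_yh)^2-(\partial_xh)^2] & -\partial_xh\,\partial_yh\\ -\partial_xh\,\partial_yh&\frac12[(\partial_xh)^2-(\partial_yh)^2]\end{pmatrix};$$ equivalently, $\omega_h:=(\partial_xh)^2-(\partial_yh)^2-2i\,\partial_xh\,\partial_yh=(\partial_xh-i\partial_yh)^2$ is (a.e.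 equal to) a holomorphic function in $\Omega$, with which it is identified. Such an $h$ is locally Lipschitz and is identified with its continuous representative. "Zero of even order" means a zero whose (finite, positive) multiplicity is even. *)

theory Defs
  imports "HOL-Complex_Analysis.Complex_Analysis"
begin

section \<open>Classical derivatives in the plane\<close>

text \<open>The plane is \<^typ>\<open>complex\<close>; the directions \<open>1\<close> and \<open>\<i>\<close> are the \<open>x\<close> and \<open>y\<close> axes.\<close>

definition partial :: "complex \<Rightarrow> (complex \<Rightarrow> real) \<Rightarrow> complex \<Rightarrow> real" where
  "partial e f z = frechet_derivative f (at z) e"

fun Ck_on :: "nat \<Rightarrow> complex set \<Rightarrow> (complex \<Rightarrow> real) \<Rightarrow> bool" where
  "Ck_on 0 S f \<longleftrightarrow> continuous_on S f"
| "Ck_on (Suc k) S f \<longleftrightarrow>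
     (\<forall>z\<in>S. f differentiable (at z)) \<and> Ck_on k S (partial 1 f) \<and> Ck_on k S (partial \<i> f)"

definition laplacian :: "(complex \<Rightarrow> real) \<Rightarrow> complex \<Rightarrow> real" where
  "laplacian f z = partial 1 (partial 1 f) z + partial \<i> (partial \<i> f) z"

definition harmonic_on :: "(complex \<Rightarrow> real) \<Rightarrow> complex set \<Rightarrow> bool" where
  "harmonic_on H V \<longleftrightarrow> open V \<and> Ck_on 2 V H \<and> (\<forall>z\<in>V. laplacian H z = 0)"

definition test_functions :: "complex set \<Rightarrow> (complex \<Rightarrow> real) set" where
  "test_functions \<Omega> =
     {\<phi>. (\<forall>k. Ck_on k UNIV \<phi>) \<and> compact (closure {z. \<phi> z \<noteq> 0}) \<and> closure {z. \<phi> z \<noteq> 0} \<subseteq> \<Omega>}"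

section \<open>Sobolev spaces\<close>

text \<open>Elements of \<open>L\<^sup>2\<close> and \<open>H\<^sup>1\<close> are functions, not classes modulo null sets.\<close>

definition L2 :: "complex set \<Rightarrow> (complex \<Rightarrow> real) set" where
  "L2 \<Omega> = {u \<in> borel_measurable (lebesgue_on \<Omega>). integrable (lebesgue_on \<Omega>) (\<lambda>z. (u z)\<^sup>2)}"

definition has_weak_partial ::
  "complex set \<Rightarrow> complex \<Rightarrow> (complex \<Rightarrow> real) \<Rightarrow> (complex \<Rightarrow> real) \<Rightarrow> bool" where
  "has_weak_partial \<Omega> e u g \<longleftrightarrow> u \<in> L2 \<Omega> \<and> g \<in> L2 \<Omega> \<and>
     (\<forall>\<phi>\<in>test_functions \<Omega>.
        (LINT z|lebesgue_on \<Omega>. u z * partial e \<phi> z) = - (LINT z|lebesgue_on \<Omega>. g z * \<phi> z))"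

definition H1 :: "complex set \<Rightarrow> (complex \<Rightarrow> real) set" where
  "H1 \<Omega> = {u. (\<exists>g. has_weak_partial \<Omega> 1 u g) \<and> (\<exists>g. has_weak_partial \<Omega> \<i> u g)}"

text \<open>On \<^const>\<open>H1\<close> the choice below is unique up to a null set of \<open>\<Omega>\<close>.\<close>

definition weak_partial :: "complex set \<Rightarrow> complex \<Rightarrow> (complex \<Rightarrow> real) \<Rightarrow> complex \<Rightarrow> real" where
  "weak_partial \<Omega> e u = (SOME g. has_weak_partial \<Omega> e u g)"

definition H1_norm :: "complex set \<Rightarrow> (complex \<Rightarrow> real) \<Rightarrow> real" where
  "H1_norm \<Omega> u = sqrt (LINT z|lebesgue_on \<Omega>.
     (u z)\<^sup>2 + (weak_partial \<Omega> 1 u z)\<^sup>2 + (weak_partial \<Omega> \<i> u z)\<^sup>2)"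

definition H1_0 :: "complex set \<Rightarrow> (complex \<Rightarrow> real) set" where
  "H1_0 \<Omega> = {u \<in> H1 \<Omega>. \<exists>\<phi> :: nat \<Rightarrow> complex \<Rightarrow> real. (\<forall>n. \<phi> n \<in> test_functions \<Omega>) \<and>
     (\<lambda>n. H1_norm \<Omega> (\<lambda>z. u z - \<phi> n z)) \<longlonglongrightarrow> 0}"

text \<open>Boundedness makes such a functional constant on classes of almost everywhere equal functions.\<close>

definition dual_H1_0 :: "complex set \<Rightarrow> ((complex \<Rightarrow> real) \<Rightarrow> real) set" where
  "dual_H1_0 \<Omega> = {L.
     (\<forall>u\<in>H1_0 \<Omega>. \<forall>v\<in>H1_0 \<Omega>. L (\<lambda>z. u z + v z) = L u + L v) \<and>
     (\<forall>c. \<forall>u\<in>H1_0 \<Omega>. L (\<lambda>z. c * u z) = c * L u) \<and>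
     (\<exists>C. \<forall>u\<in>H1_0 \<Omega>. \<bar>L u\<bar> \<le> C * H1_norm \<Omega> u)}"

section \<open>Signed Radon measures\<close>

text \<open>
  A pair \<open>(P, N)\<close> of positive measures stands for the signed measure \<open>P - N\<close>; both parts may
  have infinite mass, so that \<open>P - N\<close> need only be defined on relatively compact sets. The pair
  is not required to be the Jordan decomposition: all notions below depend only on the
  difference. On an open subset of the plane, a Borel measure that is finite on compact sets is
  automatically regular.
\<close>

type_synonym signed_measure = "complex measure \<times> complex measure"

definition positive_radon_measure :: "complex set \<Rightarrow> complex measure \<Rightarrow> bool" where
  "positive_radon_measure \<Omega> P \<longleftrightarrow> sets P = sets (restrict_space borel \<Omega>) \<and>
     (\<forall>K. compact K \<and> K \<subseteq> \<Omega> \<longrightarrow> emeasure P K < \<infinity>)"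

definition radon_measure :: "complex set \<Rightarrow> signed_measure \<Rightarrow> bool" where
  "radon_measure \<Omega> \<mu> \<longleftrightarrow> positive_radon_measure \<Omega> (fst \<mu>) \<and> positive_radon_measure \<Omega> (snd \<mu>)"

definition signed_integral :: "signed_measure \<Rightarrow> (complex \<Rightarrow> real) \<Rightarrow> real" where
  "signed_integral \<mu> f = integral\<^sup>L (fst \<mu>) f - integral\<^sup>L (snd \<mu>) f"

definition signed_restrict :: "signed_measure \<Rightarrow> complex set \<Rightarrow> signed_measure" where
  "signed_restrict \<mu> V = (restrict_space (fst \<mu>) V, restrict_space (snd \<mu>) V)"

definition vanishes_on :: "signed_measure \<Rightarrow> complex set \<Rightarrow> bool" where
  "vanishes_on \<mu> U \<longleftrightarrow> (\<forall>A\<in>sets (fst \<mu>). A \<subseteq> U \<longrightarrow> emeasure (fst \<mu>) A = emeasure (snd \<mu>) A)"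

text \<open>The complement is taken in the open set on which the measure lives.\<close>

definition signed_support :: "signed_measure \<Rightarrow> complex set" where
  "signed_support \<mu> =
     space (fst \<mu>) - \<Union>{U. open U \<and> U \<subseteq> space (fst \<mu>) \<and> vanishes_on \<mu> U}"

definition in_H_minus_1 :: "complex set \<Rightarrow> signed_measure \<Rightarrow> bool" where
  "in_H_minus_1 \<Omega> \<mu> \<longleftrightarrow>
     (\<exists>L\<in>dual_H1_0 \<Omega>. \<forall>\<phi>\<in>test_functions \<Omega>. L \<phi> = signed_integral \<mu> \<phi>)"

definition distributional_laplacian ::
  "complex set \<Rightarrow> (complex \<Rightarrow> real) \<Rightarrow> signed_measure \<Rightarrow> bool" where
  "distributional_laplacian \<Omega> h \<mu> \<longleftrightarrow>
     (\<forall>\<phi>\<in>test_functions \<Omega>. (LINT z|lebesgue_on \<Omega>. h z * laplacian \<phi> z) = signed_integral \<mu> \<phi>)"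

section \<open>Stationary harmonic functions\<close>

definition stress_xx :: "complex set \<Rightarrow> (complex \<Rightarrow> real) \<Rightarrow> complex \<Rightarrow> real" where
  "stress_xx \<Omega> h z = ((weak_partial \<Omega> \<i> h z)\<^sup>2 - (weak_partial \<Omega> 1 h z)\<^sup>2) / 2"

definition stress_xy :: "complex set \<Rightarrow> (complex \<Rightarrow> real) \<Rightarrow> complex \<Rightarrow> real" where
  "stress_xy \<Omega> h z = - (weak_partial \<Omega> 1 h z * weak_partial \<Omega> \<i> h z)"

definition stress_yy :: "complex set \<Rightarrow> (complex \<Rightarrow> real) \<Rightarrow> complex \<Rightarrow> real" where
  "stress_yy \<Omega> h z = ((weak_partial \<Omega> 1 h z)\<^sup>2 - (weak_partial \<Omega> \<i> h z)\<^sup>2) / 2"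

definition distributional_div_zero ::
  "complex set \<Rightarrow> (complex \<Rightarrow> real) \<Rightarrow> (complex \<Rightarrow> real) \<Rightarrow> bool" where
  "distributional_div_zero \<Omega> a b \<longleftrightarrow>
     (\<forall>\<phi>\<in>test_functions \<Omega>. (LINT z|lebesgue_on \<Omega>. a z * partial 1 \<phi> z + b z * partial \<i> \<phi> z) = 0)"

definition stationary_harmonic :: "complex set \<Rightarrow> (complex \<Rightarrow> real) \<Rightarrow> bool" where
  "stationary_harmonic \<Omega> h \<longleftrightarrow> h \<in> H1 \<Omega> \<and>
     distributional_div_zero \<Omega> (stress_xx \<Omega> h) (stress_xy \<Omega> h) \<and>
     distributional_div_zero \<Omega> (stress_xy \<Omega> h) (stress_yy \<Omega> h)"

definition omega :: "complex set \<Rightarrow> (complex \<Rightarrow> real) \<Rightarrow> complex \<Rightarrow> complex" where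
  "omega \<Omega> h z = (of_real (weak_partial \<Omega> 1 h z) - \<i> * of_real (weak_partial \<Omega> \<i> h z))\<^sup>2"

definition zero_of_even_order :: "(complex \<Rightarrow> complex) \<Rightarrow> complex \<Rightarrow> bool" where
  "zero_of_even_order f z \<longleftrightarrow> f z = 0 \<and> isolated_zero f z \<and> even (zorder f z)"

section \<open>Smooth curves\<close>

text \<open>
  A simple regular curve, smooth up to its end point \<open>\<gamma> 0\<close>; \<open>D n\<close> is the \<open>n\<close>-th derivative of
  \<open>\<gamma>\<close>, one-sided at \<open>0\<close>. The other end is left open.
\<close>

definition smooth_curve_ending_at :: "complex \<Rightarrow> (real \<Rightarrow> complex) \<Rightarrow> bool" where
  "smooth_curve_ending_at z0 \<gamma> \<longleftrightarrow> \<gamma> 0 = z0 \<and> inj_on \<gamma> {0..<1} \<and>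
     (\<exists>D :: nat \<Rightarrow> real \<Rightarrow> complex. D 0 = \<gamma> \<and>
        (\<forall>n. \<forall>t\<in>{0..<1}. (D n has_vector_derivative D (Suc n) t) (at t within {0..<1})) \<and>
        (\<forall>t\<in>{0..<1}. D 1 t \<noteq> 0))"

end

theory Submission
  imports Defs
begin

text \<open>
  Near \<open>z0\<close> the function \<open>\<omega>\<close> is the square of a holomorphic function, because the order of its zero
  is even. Let \<open>G\<close> be the primitive of this square root with \<open>G(z0) = 0\<close>, and \<open>H = Re G\<close>. The
  gradient of \<open>H\<close>, written as \<open>\<partial>\<^sub>xH - \<i> \<partial>\<^sub>yH\<close>, is \<open>G'\<close>, and its square is \<open>\<omega>\<close>; so \<open>\<nabla>h = \<plusminus>\<nabla>H\<close>
  almost everywhere, with a measurable sign. The theorem describes where this sign can change.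

  Where \<open>G\<close> is injective, \<open>G = u + \<i>v\<close> is a conformal coordinate in which \<open>h\<close> has gradient \<open>(\<plusminus>1, 0)\<close>:
  it depends on \<open>u\<close> only, with slope \<open>\<plusminus>1\<close> (\<open>chart_vertical\<close>, \<open>chart_horizontal\<close>), and \<open>\<mu>\<close> is the
  derivative of the slope (\<open>chart_measure\<close>). A change of sign on a line \<open>u = const\<close> puts on it a mass
  proportional to its length in the coordinate \<open>G\<close>. In a rectangle this length does not tend to \<open>0\<close> as
  \<open>u \<rightarrow> 0\<close>, whereas the mass of the strip \<open>0 < u < \<delta>\<close> does as \<open>\<delta> \<rightarrow> 0\<close>. So there is no change of sign
  in a thin strip along \<open>u = 0\<close> (\<open>oscillation_bound_ae\<close>, \<open>affine_of_unit_slope\<close>, \<open>sector_affine\<close>), and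
  \<open>h = \<plusminus>H\<close> there because \<open>h(z0) = 0\<close>.

  In a suitable conformal coordinate \<open>\<zeta>\<close> at \<open>z0\<close> the function \<open>G\<close> is \<open>\<zeta>\<^sup>m\<close> with \<open>m \<ge> 2\<close>
  (\<open>conformal_power_normal_form\<close>). The zero set of \<open>H\<close> consists of \<open>2m\<close> rays, and \<open>\<plusminus>G\<close> maps each of
  the \<open>2m\<close> sectors between them onto a half square. As the sectors are finitely many, one size of the
  square works for all of them, and \<open>h = \<plusminus>H\<close> holds on the whole preimage \<open>V\<close> of the square. If the
  signs in the two sectors next to a ray agree, \<open>h\<close> is harmonic there and \<open>\<mu>\<close> vanishes
  (\<open>not_support_where_harmonic\<close>). If they differ, \<open>\<mu>\<close> does not vanish near any point of the ray, for
  otherwise the slope of \<open>h\<close> would be constant across it (\<open>no_jump_where_vanishes\<close>). Hence the support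
  of \<open>\<mu>\<close> in \<open>V\<close> is the union of the rays on which the sign changes (\<open>support_eq_rays\<close>).
\<close>

section \<open>Smooth functions in the plane\<close>

lemma partial_eq:
  assumes "(f has_derivative D) (at z)"
  shows "partial e f z = D e"
  using frechet_derivative_at[OF assms] by (simp add: partial_def)

lemma has_derivative_partials:
  assumes "f differentiable (at z)"
  shows "(f has_derivative (\<lambda>v. Re v * partial 1 f z + Im v * partial \<i> f z)) (at z)"
proof -
  let ?D = "frechet_derivative f (at z)"
  have D: "(f has_derivative ?D) (at z)" using assms frechet_derivative_works by blast
  then interpret D: bounded_linear ?D by (rule has_derivative_bounded_linear)
  have "?D v = Re v * partial 1 f z + Im v * partial \<i> f z" for v
  proof -
    have "?D v = ?D (Re v *\<^sub>R 1 + Im v *\<^sub>R \<i>)"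
      by (rule arg_cong[of _ _ ?D]) (simp add: complex_eq_iff)
    also have "\<dots> = Re v * partial 1 f z + Im v * partial \<i> f z"
      by (simp add: D.add D.scaleR partial_def)
    finally show ?thesis .
  qed
  then have "?D = (\<lambda>v. Re v * partial 1 f z + Im v * partial \<i> f z)" by blast
  with D show ?thesis by metis
qed

lemma Ck_on_cong:
  assumes "open S" "\<And>z. z \<in> S \<Longrightarrow> f z = g z"
  shows "Ck_on k S f \<longleftrightarrow> Ck_on k S g"
  using assms(2)
proof (induction k arbitrary: f g)
  case 0
  then show ?case using continuous_on_cong[of S S f g] by simp
next
  case (Suc k)
  have d: "(f has_derivative D) (at z) \<longleftrightarrow> (g has_derivative D) (at z)" if "z \<in> S" for z D
    using has_derivative_transform_within_open[of f D z UNIV S g]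
      has_derivative_transform_within_open[of g D z UNIV S f] Suc.prems that assms(1) by metis
  then have *: "f differentiable (at z) \<longleftrightarrow> g differentiable (at z)" "partial e f z = partial e g z"
    if "z \<in> S" for z e
    using that by (auto simp: differentiable_def partial_def frechet_derivative_def)
  show ?case using * Suc.IH[of "partial 1 f" "partial 1 g"] Suc.IH[of "partial \<i> f" "partial \<i> g"]
    by auto
qed

text \<open>
  \<^const>\<open>Ck_on\<close> recurs through the functions \<^const>\<open>partial\<close>; with this rule the partial
  derivatives can be any explicit formulas that are correct on the open set.
\<close>

lemma Ck_on_SucI:
  assumes "open S"
    and "\<And>z. z \<in> S \<Longrightarrow> (f has_derivative (\<lambda>v. Re v * p z + Im v * q z)) (at z)"
    and "Ck_on k S p" "Ck_on k S q"
  shows "Ck_on (Suc k) S f"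
proof -
  have "partial 1 f z = p z" "partial \<i> f z = q z" if "z \<in> S" for z
    using partial_eq[OF assms(2)[OF that], of 1] partial_eq[OF assms(2)[OF that], of \<i>] by auto
  then have "Ck_on k S (partial 1 f)" "Ck_on k S (partial \<i> f)"
    using assms(3,4) Ck_on_cong[OF assms(1), of "partial 1 f" p] Ck_on_cong[OF assms(1), of "partial \<i> f" q]
    by auto
  moreover have "\<forall>z\<in>S. f differentiable (at z)" using assms(2) unfolding differentiable_def by blast
  ultimately show ?thesis by simp
qed

lemma Ck_on_SucD: "Ck_on (Suc k) S f \<Longrightarrow> Ck_on k S f"
proof (induction k arbitrary: f)
  case 0
  then have "\<forall>z\<in>S. f differentiable (at z)" by simp
  then have "continuous_on S f"
    by (intro continuous_at_imp_continuous_on ballI differentiable_imp_continuous_within) auto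
  then show ?case by simp
next
  case (Suc k)
  have "Ck_on k S (partial 1 f)" "Ck_on k S (partial \<i> f)" "\<forall>z\<in>S. f differentiable (at z)"
    using Suc.IH[of "partial 1 f"] Suc.IH[of "partial \<i> f"] Suc.prems by (meson Ck_on.simps(2))+
  then show ?case by (simp only: Ck_on.simps simp_thms)
qed

lemma Ck_on_subset: "Ck_on k S f \<Longrightarrow> T \<subseteq> S \<Longrightarrow> Ck_on k T f"
  by (induction k arbitrary: f) (auto intro: continuous_on_subset)

lemma Ck_on_Un:
  assumes "open A" "open B" "Ck_on k A f" "Ck_on k B f"
  shows "Ck_on k (A \<union> B) f"
  using assms(3,4)
  by (induction k arbitrary: f) (auto intro: continuous_on_open_Un[OF assms(1,2)])

lemma Ck_on_const [simp]: "open S \<Longrightarrow> Ck_on k S (\<lambda>z. c)"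
proof (induction k arbitrary: c)
  case 0
  then show ?case by simp
next
  case (Suc k)
  show ?case by (rule Ck_on_SucI[where p = "\<lambda>_. 0" and q = "\<lambda>_. 0"]) (use Suc in auto)
qed

lemma Ck_on_add:
  assumes "open S"
  shows "Ck_on k S f \<Longrightarrow> Ck_on k S g \<Longrightarrow> Ck_on k S (\<lambda>z. f z + g z)"
proof (induction k arbitrary: f g)
  case 0
  then show ?case by (simp add: continuous_on_add)
next
  case (Suc k)
  show ?case
  proof (rule Ck_on_SucI[OF assms])
    fix z assume "z \<in> S"
    then show "((\<lambda>z. f z + g z) has_derivative (\<lambda>v. Re v * (partial 1 f z + partial 1 g z)
        + Im v * (partial \<i> f z + partial \<i> g z))) (at z)"
      using has_derivative_add[OF has_derivative_partials[of f z] has_derivative_partials[of g z]] Suc.prems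
      by (simp add: algebra_simps)
  qed (use Suc in auto)
qed

lemma Ck_on_mult:
  assumes "open S"
  shows "Ck_on k S f \<Longrightarrow> Ck_on k S g \<Longrightarrow> Ck_on k S (\<lambda>z. f z * g z)"
proof (induction k arbitrary: f g)
  case 0
  then show ?case by (simp add: continuous_on_mult)
next
  case (Suc k)
  have *: "Ck_on k S f" "Ck_on k S g" using Suc.prems Ck_on_SucD by blast+
  show ?case
  proof (rule Ck_on_SucI[OF assms])
    fix z assume "z \<in> S"
    then show "((\<lambda>z. f z * g z) has_derivative (\<lambda>v. Re v * (f z * partial 1 g z + partial 1 f z * g z)
        + Im v * (f z * partial \<i> g z + partial \<i> f z * g z))) (at z)"
      using has_derivative_mult[OF has_derivative_partials[of f z] has_derivative_partials[of g z]] Suc.prems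
      by (simp add: algebra_simps)
  qed (use Suc * in \<open>auto intro!: Ck_on_add assms\<close>)
qed

lemma Ck_on_compose_real:
  assumes "open S" and D: "\<And>n x. (D n has_real_derivative D (Suc n) x) (at x)"
  shows "Ck_on k S f \<Longrightarrow> Ck_on k S (\<lambda>z. D n (f z))"
proof (induction k arbitrary: f n)
  case 0
  have "continuous_on UNIV (D n)" by (meson D DERIV_isCont continuous_at_imp_continuous_on)
  then show ?case using 0 by (auto intro: continuous_on_compose2)
next
  case (Suc k)
  show ?case
  proof (rule Ck_on_SucI[OF assms(1)])
    fix z assume "z \<in> S"
    then have "f differentiable (at z)" using Suc.prems by simp
    from has_derivative_compose[OF has_derivative_partials[OF this] D[of n "f z", unfolded has_field_derivative_def]]
    show "((\<lambda>z. D n (f z)) has_derivative (\<lambda>v. Re v * (D (Suc n) (f z) * partial 1 f z)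
        + Im v * (D (Suc n) (f z) * partial \<i> f z))) (at z)"
      by (simp add: algebra_simps)
  qed (use Suc Ck_on_SucD[OF Suc.prems] in \<open>auto intro!: Ck_on_mult assms\<close>)
qed

lemma has_derivative_Re_Im_holomorphic:
  assumes "F holomorphic_on S" "open S" "z \<in> S"
  shows "((\<lambda>z. Re (F z)) has_derivative (\<lambda>v. Re v * Re (deriv F z) + Im v * (- Im (deriv F z)))) (at z)"
    and "((\<lambda>z. Im (F z)) has_derivative (\<lambda>v. Re v * Im (deriv F z) + Im v * Re (deriv F z))) (at z)"
proof -
  have F: "(F has_derivative (\<lambda>v. deriv F z * v)) (at z)"
    using holomorphic_derivI[OF assms(1,2,3)] by (simp add: has_field_derivative_def)
  show "((\<lambda>z. Re (F z)) has_derivative (\<lambda>v. Re v * Re (deriv F z) + Im v * (- Im (deriv F z)))) (at z)"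
    using has_derivative_Re[OF F] by (simp add: algebra_simps)
  show "((\<lambda>z. Im (F z)) has_derivative (\<lambda>v. Re v * Im (deriv F z) + Im v * Re (deriv F z))) (at z)"
    using has_derivative_Im[OF F] by (simp add: algebra_simps)
qed

lemma partial_Re_Im_holomorphic:
  assumes "F holomorphic_on S" "open S" "z \<in> S"
  shows "partial 1 (\<lambda>z. Re (F z)) z = Re (deriv F z)" "partial \<i> (\<lambda>z. Re (F z)) z = - Im (deriv F z)"
    "partial 1 (\<lambda>z. Im (F z)) z = Im (deriv F z)" "partial \<i> (\<lambda>z. Im (F z)) z = Re (deriv F z)"
  using has_derivative_Re_Im_holomorphic[OF assms, THEN partial_eq] by auto

lemma Ck_on_Re_Im_holomorphic:
  assumes "open S"
  shows "F holomorphic_on S \<Longrightarrow> Ck_on k S (\<lambda>z. Re (F z)) \<and> Ck_on k S (\<lambda>z. Im (F z))"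
proof (induction k arbitrary: F)
  case 0
  then have "continuous_on S F" by (rule holomorphic_on_imp_continuous_on)
  then show ?case by (auto intro: continuous_intros)
next
  case (Suc k)
  have F': "deriv F holomorphic_on S" using Suc.prems assms by (rule holomorphic_deriv)
  have "Ck_on k S (\<lambda>z. (-1) * Im (deriv F z))"
    by (rule Ck_on_mult) (use Suc.IH[OF F'] assms in auto)
  then have m: "Ck_on k S (\<lambda>z. - Im (deriv F z))" by simp
  show ?case
    using Ck_on_SucI[OF assms has_derivative_Re_Im_holomorphic(1)[OF Suc.prems assms]]
          Ck_on_SucI[OF assms has_derivative_Re_Im_holomorphic(2)[OF Suc.prems assms]] Suc.IH[OF F'] m
    by blast
qed

lemma harmonic_on_Re_holomorphic:
  assumes "open S" "F holomorphic_on S"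
  shows "harmonic_on (\<lambda>z. Re (F z)) S"
proof -
  let ?H = "\<lambda>z. Re (F z)"
  have F': "deriv F holomorphic_on S" using assms(2,1) by (rule holomorphic_deriv)
  have "laplacian ?H z = 0" if z: "z \<in> S" for z
  proof -
    note D = has_derivative_Re_Im_holomorphic[OF F' assms(1) z]
    have "(partial 1 ?H has_derivative
        (\<lambda>v. Re v * Re (deriv (deriv F) z) + Im v * (- Im (deriv (deriv F) z)))) (at z)"
      by (rule has_derivative_transform_within_open[OF D(1) assms(1) z])
        (simp add: partial_Re_Im_holomorphic[OF assms(2,1)])
    moreover have "(partial \<i> ?H has_derivative
        (\<lambda>v. - (Re v * Im (deriv (deriv F) z) + Im v * Re (deriv (deriv F) z)))) (at z)"
      by (rule has_derivative_transform_within_open[OF has_derivative_minus[OF D(2)] assms(1) z])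
        (simp add: partial_Re_Im_holomorphic[OF assms(2,1)])
    ultimately show ?thesis by (simp add: laplacian_def partial_eq)
  qed
  then show ?thesis using Ck_on_Re_Im_holomorphic[OF assms(1,2)] assms(1) by (simp add: harmonic_on_def)
qed

text \<open>
  All test functions below arise in this way. Both \<open>U\<close> and the complement of \<open>K\<close> are open, they
  cover the plane, and the extension is smooth on each of them.
\<close>

lemma test_function_extend:
  assumes "open U" "U \<subseteq> \<Omega>" and f: "\<And>k. Ck_on k U f"
    and K: "compact K" "K \<subseteq> U" "\<And>z. z \<in> U \<Longrightarrow> z \<notin> K \<Longrightarrow> f z = 0"
  shows "(\<lambda>z. if z \<in> U then f z else 0) \<in> test_functions \<Omega>"
proof -
  let ?g = "\<lambda>z. if z \<in> U then f z else 0"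
  have oK: "open (- K)" using K(1) by (simp add: compact_imp_closed open_Compl)
  have "Ck_on k U ?g" for k using f[of k] Ck_on_cong[OF assms(1), of ?g f] by auto
  moreover have "Ck_on k (-K) ?g" for k
    using Ck_on_cong[OF oK, of ?g "\<lambda>_. 0" k] K oK by auto
  ultimately have "Ck_on k (U \<union> -K) ?g" for k by (intro Ck_on_Un assms(1) oK)
  moreover have "U \<union> -K = UNIV" using K by auto
  ultimately have 1: "\<forall>k. Ck_on k UNIV ?g" by simp
  have "{z. ?g z \<noteq> 0} \<subseteq> K" using K by auto
  then have 2: "closure {z. ?g z \<noteq> 0} \<subseteq> K" using K(1) by (simp add: closure_minimal compact_imp_closed)
  then have "compact (closure {z. ?g z \<noteq> 0})" using K(1)
    by (metis closed_closure compact_Int_closed inf.absorb_iff2)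
  with 1 2 K assms(2) show ?thesis by (auto simp: test_functions_def)
qed

lemma partial_eq_0_off_support:
  assumes "z \<notin> closure {z. \<phi> z \<noteq> 0}"
  shows "\<phi> z = 0" "partial e \<phi> z = 0"
proof -
  have *: "z \<in> - closure {z. \<phi> z \<noteq> 0}" using assms by simp
  have off: "\<phi> w = 0" if "w \<in> - closure {z. \<phi> z \<noteq> 0}" for w
    using that closure_subset[of "{z. \<phi> z \<noteq> 0}"] by auto
  show "\<phi> z = 0" by (rule off[OF *])
  have "(\<phi> has_derivative (\<lambda>_. 0)) (at z)"
    by (rule has_derivative_transform_within_open[OF has_derivative_const[of 0] open_Compl[OF closed_closure] *])
      (simp only: off)
  then show "partial e \<phi> z = 0" by (rule partial_eq)
qed

lemma test_function_partial:
  assumes "\<phi> \<in> test_functions \<Omega>" "e = 1 \<or> e = \<i>"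
  shows "partial e \<phi> \<in> test_functions \<Omega>"
proof -
  let ?C = "closure {z. \<phi> z \<noteq> 0}"
  have C: "compact ?C" "?C \<subseteq> \<Omega>" and k: "\<And>k. Ck_on k UNIV \<phi>"
    using assms(1) by (auto simp: test_functions_def)
  have 1: "Ck_on k UNIV (partial e \<phi>)" for k using k[of "Suc k"] assms(2) by auto
  have "{z. partial e \<phi> z \<noteq> 0} \<subseteq> ?C" using partial_eq_0_off_support(2) by blast
  then have 2: "closure {z. partial e \<phi> z \<noteq> 0} \<subseteq> ?C" by (simp add: closure_minimal)
  then have "compact (closure {z. partial e \<phi> z \<noteq> 0})" using C(1)
    by (metis closed_closure compact_Int_closed inf.absorb_iff2)
  with 1 2 C show ?thesis by (auto simp: test_functions_def)
qed

lemma test_function_continuous: "\<phi> \<in> test_functions \<Omega> \<Longrightarrow> continuous_on S \<phi>"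
  by (auto simp: test_functions_def dest!: spec[of _ 0] intro: continuous_on_subset)

lemma test_function_zero_outside: "\<phi> \<in> test_functions \<Omega> \<Longrightarrow> z \<notin> \<Omega> \<Longrightarrow> \<phi> z = 0"
  using closure_subset[of "{z. \<phi> z \<noteq> 0}"] by (auto simp: test_functions_def)

lemma test_functions_mono: "\<phi> \<in> test_functions U \<Longrightarrow> U \<subseteq> \<Omega> \<Longrightarrow> \<phi> \<in> test_functions \<Omega>"
  by (auto simp: test_functions_def)

lemma test_function_integrable:
  assumes "\<phi> \<in> test_functions \<Omega>"
  shows "integrable lborel \<phi>"
proof -
  let ?C = "closure {z. \<phi> z \<noteq> 0}"
  have "integrable lborel (\<lambda>x. if x \<in> ?C then \<phi> x else 0)"
  proof -
    have "integrable lborel (\<lambda>x. indicator ?C x *\<^sub>R \<phi> x)"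
      using borel_integrable_compact[of ?C \<phi>] assms test_function_continuous[OF assms]
      by (auto simp: test_functions_def)
    moreover have "(\<lambda>x. indicator ?C x *\<^sub>R \<phi> x) = (\<lambda>x. if x \<in> ?C then \<phi> x else 0)"
      by (auto simp: fun_eq_iff)
    ultimately show ?thesis by simp
  qed
  moreover have "(\<lambda>x. if x \<in> ?C then \<phi> x else 0) = \<phi>"
    using closure_subset[of "{z. \<phi> z \<noteq> 0}"] by (auto simp: fun_eq_iff)
  ultimately show ?thesis by simp
qed

lemma test_function_bounded:
  assumes "\<phi> \<in> test_functions \<Omega>"
  obtains C where "0 \<le> C" "\<And>z. \<bar>\<phi> z\<bar> \<le> C"
proof -
  let ?C = "closure {z. \<phi> z \<noteq> 0}"
  have "compact (\<phi> ` ?C)"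
    using assms test_function_continuous[OF assms] by (intro compact_continuous_image) (auto simp: test_functions_def)
  then obtain B where B: "\<And>z. z \<in> ?C \<Longrightarrow> \<bar>\<phi> z\<bar> \<le> B"
    unfolding compact_eq_bounded_closed bounded_iff by fastforce
  have "\<bar>\<phi> z\<bar> \<le> max B 0" for z
    using B[of z] closure_subset[of "{z. \<phi> z \<noteq> 0}"] by (cases "\<phi> z = 0") (auto simp: le_max_iff_disj)
  then show ?thesis using that[of "max B 0"] by auto
qed

lemma test_function_lipschitz:
  assumes "\<phi> \<in> test_functions \<Omega>"
  obtains C where "0 \<le> C" "\<And>z w. \<bar>\<phi> z - \<phi> w\<bar> \<le> C * norm (z - w)"
proof -
  obtain A where A: "0 \<le> A" "\<And>z. \<bar>partial 1 \<phi> z\<bar> \<le> A"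
    using test_function_bounded[OF test_function_partial[OF assms, of 1]] by auto
  obtain B where B: "0 \<le> B" "\<And>z. \<bar>partial \<i> \<phi> z\<bar> \<le> B"
    using test_function_bounded[OF test_function_partial[OF assms, of \<i>]] by auto
  have d: "\<phi> differentiable (at z)" for z
    using assms by (auto simp: test_functions_def dest!: spec[of _ "Suc 0"])
  have "\<bar>\<phi> z - \<phi> w\<bar> \<le> (A + B) * norm (z - w)" for z w
  proof -
    have "norm (\<phi> z - \<phi> w) \<le> (A + B) * norm (z - w)"
    proof (rule differentiable_bound)
      fix x
      show "(\<phi> has_derivative (\<lambda>v. Re v * partial 1 \<phi> x + Im v * partial \<i> \<phi> x)) (at x within UNIV)"
        using has_derivative_partials[OF d] .
      show "onorm (\<lambda>v. Re v * partial 1 \<phi> x + Im v * partial \<i> \<phi> x) \<le> A + B"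
      proof (rule onorm_le)
        fix v
        have "\<bar>Re v * partial 1 \<phi> x\<bar> \<le> norm v * A" "\<bar>Im v * partial \<i> \<phi> x\<bar> \<le> norm v * B"
          unfolding abs_mult using abs_Re_le_cmod[of v] abs_Im_le_cmod[of v] A(2)[of x] B(2)[of x]
          by (auto intro!: mult_mono)
        then show "norm (Re v * partial 1 \<phi> x + Im v * partial \<i> \<phi> x) \<le> (A + B) * norm v"
          by (auto simp: algebra_simps)
      qed
    qed auto
    then show ?thesis by simp
  qed
  with A B show ?thesis using that[of "A + B"] by simp
qed

lemma integral_lborel_translation:
  fixes f :: "complex \<Rightarrow> real"
  assumes "f \<in> borel_measurable borel"
  shows "integral\<^sup>L lborel (\<lambda>z. f (c + z)) = integral\<^sup>L lborel f"
proof -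
  have "integral\<^sup>L lborel f = integral\<^sup>L (distr lborel borel ((+) c)) f" by (simp add: lborel_distr_plus)
  also have "\<dots> = integral\<^sup>L lborel (\<lambda>z. f (c + z))" by (rule integral_distr) (use assms in auto)
  finally show ?thesis by simp
qed

text \<open>
  The difference quotients have integral \<open>0\<close> because Lebesgue measure is invariant under
  translations, and they converge dominatedly because a test function is Lipschitz with bounded
  support. Every integration by parts below comes from this or from the definition of a weak
  derivative.
\<close>

lemma integral_partial_test_function:
  assumes \<phi>: "\<phi> \<in> test_functions \<Omega>" and e: "e = 1 \<or> e = \<i>"
  shows "integral\<^sup>L lborel (partial e \<phi>) = 0"
proof -
  have "bounded {z. \<phi> z \<noteq> 0}" using \<phi> by (auto simp: test_functions_def)
  then obtain R where R: "\<And>z. \<phi> z \<noteq> 0 \<Longrightarrow> norm z \<le> R" by (auto simp: bounded_iff)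
  obtain C where C: "0 \<le> C" "\<And>z w. \<bar>\<phi> z - \<phi> w\<bar> \<le> C * norm (z - w)"
    using test_function_lipschitz[OF \<phi>] by blast
  have ne: "norm e = 1" using e by auto
  define t where "t n = inverse (real (Suc n))" for n
  have t: "0 < t n" "t n \<le> 1" for n by (auto simp: t_def field_simps)
  have t0: "t \<longlonglongrightarrow> 0" unfolding t_def by (rule LIMSEQ_inverse_real_of_nat)
  define q where "q n z = (\<phi> (t n *\<^sub>R e + z) - \<phi> z) / t n" for n z
  have cont: "continuous_on S \<phi>" for S using test_function_continuous[OF \<phi>] .
  have meas [measurable]: "\<phi> \<in> borel_measurable borel"
    using cont by (rule borel_measurable_continuous_onI)
  have int: "integrable lborel \<phi>" by (rule test_function_integrable[OF \<phi>])
  have intt: "integrable lborel (\<lambda>z. \<phi> (c + z))" for c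
  proof -
    have "integrable (distr lborel borel ((+) c)) \<phi>" using int by (simp add: lborel_distr_plus)
    then show ?thesis by (rule integrable_distr[rotated]) simp
  qed
  have q0: "integral\<^sup>L lborel (q n) = 0" for n
    unfolding q_def using int intt integral_lborel_translation[OF meas] by simp
  have "(\<lambda>n. integral\<^sup>L lborel (q n)) \<longlonglongrightarrow> integral\<^sup>L lborel (partial e \<phi>)"
  proof (rule integral_dominated_convergence[where w = "\<lambda>z. C * indicator (cball 0 (R + 1)) z"])
    show "partial e \<phi> \<in> borel_measurable lborel"
      using borel_measurable_integrable[OF test_function_integrable[OF test_function_partial[OF \<phi> e]]] .
    show "q n \<in> borel_measurable lborel" for n unfolding q_def by measurable
    show "integrable lborel (\<lambda>z::complex. C * indicator (cball 0 (R + 1)) z :: real)"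
      by (intro integrable_mult_right integrable_real_indicator) (use emeasure_bounded_finite[OF bounded_cball[of "0::complex" "R + 1"]] in auto)
    show "AE z in lborel. norm (q n z) \<le> C * indicator (cball 0 (R + 1)) z" for n
    proof (rule AE_I2)
      fix z
      show "norm (q n z) \<le> C * indicator (cball 0 (R + 1)) z"
      proof (cases "norm z \<le> R + 1")
        case True
        have "\<bar>\<phi> (t n *\<^sub>R e + z) - \<phi> z\<bar> \<le> C * t n" using C(2)[of "t n *\<^sub>R e + z" z] t[of n] ne by simp
        then show ?thesis using True t[of n] by (simp add: q_def field_simps)
      next
        case False
        have "norm z \<le> norm (t n *\<^sub>R e + z) + norm (t n *\<^sub>R e)"
          using norm_triangle_ineq4[of "t n *\<^sub>R e + z" "t n *\<^sub>R e"] by simp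
        then have "R < norm (t n *\<^sub>R e + z)" "R < norm z" using False t[of n] ne by auto
        then have "\<phi> (t n *\<^sub>R e + z) = 0" "\<phi> z = 0" using R by force+
        then show ?thesis using False by (simp add: q_def)
      qed
    qed
    show "AE z in lborel. (\<lambda>n. q n z) \<longlonglongrightarrow> partial e \<phi> z"
    proof (rule AE_I2)
      fix z
      have "\<phi> differentiable (at z)" using \<phi> by (auto simp: test_functions_def dest!: spec[of _ "Suc 0"])
      from has_derivative_partials[OF this] have
        "(\<phi> has_derivative (\<lambda>v. Re v * partial 1 \<phi> z + Im v * partial \<i> \<phi> z)) (at (z + 0 *\<^sub>R e))" by simp
      moreover have "((\<lambda>s. z + s *\<^sub>R e) has_derivative (\<lambda>s. s *\<^sub>R e)) (at 0)"
        by (auto intro!: derivative_eq_intros)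
      ultimately have "((\<lambda>s. \<phi> (z + s *\<^sub>R e)) has_derivative
          (\<lambda>s. Re (s *\<^sub>R e) * partial 1 \<phi> z + Im (s *\<^sub>R e) * partial \<i> \<phi> z)) (at 0)"
        by (rule has_derivative_compose[rotated])
      moreover have "(\<lambda>s. Re (s *\<^sub>R e) * partial 1 \<phi> z + Im (s *\<^sub>R e) * partial \<i> \<phi> z) = (*) (partial e \<phi> z)"
        using e by auto
      ultimately have "((\<lambda>s. \<phi> (z + s *\<^sub>R e)) has_field_derivative partial e \<phi> z) (at 0)"
        by (simp add: has_field_derivative_def)
      then have "((\<lambda>s. (\<phi> (z + s *\<^sub>R e) - \<phi> z) / s) \<longlongrightarrow> partial e \<phi> z) (at 0)"
        by (simp add: DERIV_def)
      moreover have "filterlim t (at 0) sequentially"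
        unfolding filterlim_at using t0 t(1) by (auto simp: less_imp_neq[THEN not_sym])
      ultimately have "(\<lambda>n. (\<phi> (z + t n *\<^sub>R e) - \<phi> z) / t n) \<longlonglongrightarrow> partial e \<phi> z"
        by (rule filterlim_compose)
      then show "(\<lambda>n. q n z) \<longlonglongrightarrow> partial e \<phi> z" by (simp add: q_def add.commute)
    qed
  qed
  with q0 show ?thesis by (simp add: LIMSEQ_const_iff)
qed

section \<open>Bump functions on the line\<close>

definition smooth_real :: "(real \<Rightarrow> real) \<Rightarrow> bool" where
  "smooth_real f \<longleftrightarrow> (\<exists>D. D 0 = f \<and> (\<forall>n x. (D n has_real_derivative D (Suc n) x) (at x)))"

lemma smooth_real_derivE:
  assumes "smooth_real f"
  shows "smooth_real (deriv f)" "(f has_real_derivative deriv f x) (at x)"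
proof -
  obtain D where D: "D 0 = f" "\<And>n x. (D n has_real_derivative D (Suc n) x) (at x)"
    using assms by (auto simp: smooth_real_def)
  have f: "(f has_real_derivative D (Suc 0) x) (at x)" for x using D by metis
  then have e: "deriv f = D (Suc 0)" by (auto simp: fun_eq_iff DERIV_imp_deriv)
  show "smooth_real (deriv f)"
    unfolding smooth_real_def by (rule exI[of _ "\<lambda>n. D (Suc n)"]) (use D e in auto)
  show "(f has_real_derivative deriv f x) (at x)" using f e by simp
qed

text \<open>
  A class of functions that contains a derivative of each of its members consists of smooth
  functions. This avoids formulas for derivatives of higher order.
\<close>

lemma smooth_real_coinduct:
  assumes "P f" "\<And>f. P f \<Longrightarrow> \<exists>f'. P f' \<and> (\<forall>x. (f has_real_derivative f' x) (at x))"
  shows "smooth_real f"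
proof -
  from assms(2) obtain d where d: "\<And>f. P f \<Longrightarrow> P (d f) \<and> (\<forall>x. (f has_real_derivative d f x) (at x))"
    by metis
  have P: "P ((d ^^ n) f)" for n by (induction n) (use assms(1) d in auto)
  show ?thesis unfolding smooth_real_def
    by (rule exI[of _ "\<lambda>n. (d ^^ n) f"]) (use P d in auto)
qed

lemma smooth_real_antideriv:
  assumes "smooth_real f" "\<And>x. (F has_real_derivative f x) (at x)"
  shows "smooth_real F"
proof -
  obtain D where D: "D 0 = f" "\<And>n x. (D n has_real_derivative D (Suc n) x) (at x)"
    using assms(1) by (auto simp: smooth_real_def)
  show ?thesis unfolding smooth_real_def
    by (rule exI[of _ "case_nat F D"]) (use D assms(2) in \<open>auto split: nat.split\<close>)
qed

lemma smooth_real_continuous: "smooth_real f \<Longrightarrow> continuous_on S f"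
  by (meson smooth_real_derivE(2) DERIV_isCont continuous_at_imp_continuous_on)

text \<open>
  Products alone are not closed under differentiation; by the Leibniz rule their sums are.
\<close>

inductive sum_of_products :: "(real \<Rightarrow> real) \<Rightarrow> bool" where
  prod: "smooth_real f \<Longrightarrow> smooth_real g \<Longrightarrow> sum_of_products (\<lambda>x. f x * g x)"
| add: "sum_of_products f \<Longrightarrow> sum_of_products g \<Longrightarrow> sum_of_products (\<lambda>x. f x + g x)"

lemma smooth_real_sum_of_products: "sum_of_products f \<Longrightarrow> smooth_real f"
proof (rule smooth_real_coinduct[of sum_of_products])
  fix f assume "sum_of_products f"
  then show "\<exists>f'. sum_of_products f' \<and> (\<forall>x. (f has_real_derivative f' x) (at x))"
  proof induction
    case (prod f g)
    have "sum_of_products (\<lambda>x. f x * deriv g x + deriv f x * g x)"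
      by (intro sum_of_products.intros prod smooth_real_derivE(1))
    moreover have "((\<lambda>x. f x * g x) has_real_derivative f x * deriv g x + deriv f x * g x) (at x)" for x
      using smooth_real_derivE(2)[OF prod(1)] smooth_real_derivE(2)[OF prod(2)]
      by (auto intro!: derivative_eq_intros)
    ultimately show ?case by blast
  next
    case (add f g)
    then obtain f' g' where "sum_of_products f'" "\<forall>x. (f has_real_derivative f' x) (at x)"
      "sum_of_products g'" "\<forall>x. (g has_real_derivative g' x) (at x)" by blast
    then show ?case
      by (intro exI[of _ "\<lambda>x. f' x + g' x"]) (auto intro!: sum_of_products.add DERIV_add)
  qed
qed

lemma smooth_real_mult: "smooth_real f \<Longrightarrow> smooth_real g \<Longrightarrow> smooth_real (\<lambda>x. f x * g x)"
  by (rule smooth_real_sum_of_products[OF sum_of_products.prod])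

lemma smooth_real_const: "smooth_real (\<lambda>x. c)"
  by (rule smooth_real_coinduct[of "\<lambda>f. \<exists>c. f = (\<lambda>x. c)"]) (auto intro!: exI[of _ "\<lambda>x. 0"])

lemma smooth_real_diff:
  assumes "smooth_real f" "smooth_real g" shows "smooth_real (\<lambda>x. f x - g x)"
proof -
  have "sum_of_products (\<lambda>x. f x * 1 + g x * (-1))"
    by (intro sum_of_products.intros smooth_real_const assms)
  then show ?thesis using smooth_real_sum_of_products by fastforce
qed

lemma smooth_real_affine:
  assumes "smooth_real f" shows "smooth_real (\<lambda>x. f (c * x + d))"
proof -
  obtain D where D: "D 0 = f" "\<And>n x. (D n has_real_derivative D (Suc n) x) (at x)"
    using assms by (auto simp: smooth_real_def)
  have "((\<lambda>x. c ^ n * D n (c * x + d)) has_real_derivative c ^ Suc n * D (Suc n) (c * x + d)) (at x)" for n x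
    by (auto intro!: derivative_eq_intros DERIV_chain2[OF D(2)])
  then show ?thesis unfolding smooth_real_def
    by (intro exI[of _ "\<lambda>n x. c ^ n * D n (c * x + d)"]) (use D(1) in auto)
qed

definition flat :: "real \<Rightarrow> real" where
  "flat x = (if x > 0 then exp (- inverse x) else 0)"

lemma poly_mult_exp_minus_tendsto_0:
  "((\<lambda>y::real. poly p y * exp (- y)) \<longlongrightarrow> 0) at_top"
proof -
  have "((\<lambda>y. \<Sum>i\<le>degree p. coeff p i * (y ^ i / exp y)) \<longlongrightarrow> (\<Sum>i\<le>degree p. coeff p i * 0)) at_top"
    by (intro tendsto_sum tendsto_mult tendsto_const tendsto_power_div_exp_0)
  moreover have "(\<Sum>i\<le>degree p. coeff p i * (y ^ i / exp y)) = poly p y * exp (- y)" for y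
    by (simp add: poly_altdef sum_distrib_right exp_minus divide_inverse mult.assoc)
  ultimately show ?thesis by simp
qed

text \<open>
  All derivatives have the form \<open>p(1/x) exp(-1/x)\<close> with a polynomial \<open>p\<close>, extended by \<open>0\<close> to
  \<open>x \<le> 0\<close>, and this class is closed under differentiation.
\<close>

lemma smooth_real_flat: "smooth_real flat"
proof -
  define e :: "real poly \<Rightarrow> real \<Rightarrow> real"
    where "e p x = (if x > 0 then poly p (inverse x) * exp (- inverse x) else 0)" for p x
  have D: "(e p has_real_derivative e (pCons 0 (pCons 0 (p - pderiv p))) x) (at x)" for p x
  proof -
    consider "x < 0" | "x = 0" | "x > 0" by linarith
    then show ?thesis
    proof cases
      case 1
      have "((\<lambda>x. 0) has_real_derivative 0) (at x)" by simp
      then have "(e p has_real_derivative 0) (at x)"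
        by (rule has_field_derivative_transform_within_open[where S = "{..<0}"]) (use 1 in \<open>auto simp: e_def\<close>)
      then show ?thesis using 1 by (simp add: e_def)
    next
      case 3
      have "((\<lambda>x. poly p (inverse x) * exp (- inverse x)) has_real_derivative
          e (pCons 0 (pCons 0 (p - pderiv p))) x) (at x)"
        using 3 by (auto intro!: derivative_eq_intros DERIV_chain2[OF poly_DERIV] simp: e_def)
          (simp add: algebra_simps power2_eq_square)
      then show ?thesis
        by (rule has_field_derivative_transform_within_open[where S = "{0<..}"]) (use 3 in \<open>auto simp: e_def\<close>)
    next
      case 2
      have "((\<lambda>h. (e p (0 + h) - e p 0) / h) \<longlongrightarrow> 0) (at 0)"
      proof (rule filterlim_split_at)
        show "((\<lambda>h. (e p (0 + h) - e p 0) / h) \<longlongrightarrow> 0) (at_left 0)"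
          by (rule tendsto_eventually) (auto simp: e_def eventually_at_filter)
        have "((\<lambda>h. poly (pCons 0 p) (inverse h) * exp (- inverse h)) \<longlongrightarrow> 0) (at_right (0::real))"
          by (rule filterlim_compose[OF poly_mult_exp_minus_tendsto_0 filterlim_inverse_at_top_right])
        then show "((\<lambda>h. (e p (0 + h) - e p 0) / h) \<longlongrightarrow> 0) (at_right 0)"
          by (rule Lim_transform_eventually) (auto simp: e_def eventually_at_filter field_simps)
      qed
      then show ?thesis using 2 by (simp add: DERIV_def e_def)
    qed
  qed
  have "smooth_real (e 1)"
    by (rule smooth_real_coinduct[of "\<lambda>f. \<exists>p. f = e p"]) (use D in blast)+
  moreover have "e 1 = flat" by (auto simp: e_def flat_def fun_eq_iff)
  ultimately show ?thesis by simp
qed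

lemma flat_bounds: "0 \<le> flat x" "flat x \<le> 1" by (auto simp: flat_def)

lemma flat_eq_0 [simp]: "x \<le> 0 \<Longrightarrow> flat x = 0" by (simp add: flat_def)

lemma flat_tendsto_1:
  assumes "x > 0" shows "(\<lambda>n. flat (real (Suc n) * x)) \<longlonglongrightarrow> 1"
proof -
  have "(\<lambda>n. exp (- (inverse (real (Suc n)) * inverse x))) \<longlonglongrightarrow> exp (- (0 * inverse x))"
    by (intro tendsto_intros LIMSEQ_inverse_real_of_nat)
  moreover have "flat (real (Suc n) * x) = exp (- (inverse (real (Suc n)) * inverse x))" for n
    using assms by (simp add: flat_def)
  ultimately show ?thesis by simp
qed

text \<open>
  Smooth approximations from below of the indicator of \<open>(p, q)\<close>: dilating \<^const>\<open>flat\<close> makes it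
  tend to \<open>1\<close> at every positive point, while it stays \<open>0\<close> on the negative axis.
\<close>

definition cutoff :: "real \<Rightarrow> real \<Rightarrow> nat \<Rightarrow> real \<Rightarrow> real" where
  "cutoff p q n x = flat (real (Suc n) * (x - p)) * flat (real (Suc n) * (q - x))"

lemma smooth_real_cutoff: "smooth_real (cutoff p q n)"
proof -
  have "smooth_real (\<lambda>x. flat (real (Suc n) * x + (- real (Suc n) * p)) * flat ((- real (Suc n)) * x + real (Suc n) * q))"
    by (intro smooth_real_mult smooth_real_affine smooth_real_flat)
  moreover have "(\<lambda>x. flat (real (Suc n) * x + (- real (Suc n) * p)) * flat ((- real (Suc n)) * x + real (Suc n) * q))
      = cutoff p q n"
    unfolding cutoff_def by (simp add: fun_eq_iff algebra_simps)
  ultimately show ?thesis by simp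
qed

lemma cutoff_bounds: "0 \<le> cutoff p q n x" "cutoff p q n x \<le> 1"
  unfolding cutoff_def using flat_bounds by (auto intro!: mult_le_one)

lemma cutoff_eq_0: "x \<notin> {p<..<q} \<Longrightarrow> cutoff p q n x = 0"
  by (auto simp: cutoff_def not_less mult_nonneg_nonpos)

lemma cutoff_tendsto: "(\<lambda>n. cutoff p q n x) \<longlonglongrightarrow> indicator {p<..<q} x"
proof (cases "x \<in> {p<..<q}")
  case True
  then have "(\<lambda>n. cutoff p q n x) \<longlonglongrightarrow> 1 * 1"
    unfolding cutoff_def by (intro tendsto_mult flat_tendsto_1) auto
  then show ?thesis using True by simp
qed (simp add: cutoff_eq_0)

lemma cutoff_translate: "cutoff (p + t) (q + t) n x = cutoff p q n (x - t)"
  by (simp add: cutoff_def algebra_simps)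

lemma cutoff_pos: "x \<in> {p<..<q} \<Longrightarrow> 0 < cutoff p q n x"
  by (auto simp: cutoff_def flat_def)

text \<open>
  The test functions of the interval \<open>(l, r)\<close>.
\<close>

definition bump :: "real \<Rightarrow> real \<Rightarrow> (real \<Rightarrow> real) \<Rightarrow> bool" where
  "bump l r a \<longleftrightarrow> smooth_real a \<and> (\<exists>p q. l < p \<and> p < q \<and> q < r \<and> (\<forall>x. x \<notin> {p..q} \<longrightarrow> a x = 0))"

lemma bump_smooth: "bump l r a \<Longrightarrow> smooth_real a" by (simp add: bump_def)

lemma bump_cutoff: "l < p \<Longrightarrow> p < q \<Longrightarrow> q < r \<Longrightarrow> bump l r (cutoff p q n)"
  unfolding bump_def using smooth_real_cutoff cutoff_eq_0 by (metis atLeastAtMost_iff greaterThanLessThan_iff less_imp_le)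

lemma bump_deriv:
  assumes "bump l r a" shows "bump l r (deriv a)"
proof -
  obtain p q where pq: "l < p" "p < q" "q < r" "\<And>x. x \<notin> {p..q} \<Longrightarrow> a x = 0" "smooth_real a"
    using assms by (auto simp: bump_def)
  have "deriv a x = 0" if "x \<notin> {p..q}" for x
  proof -
    have "((\<lambda>_. 0) has_real_derivative 0) (at x)" by simp
    then have "(a has_real_derivative 0) (at x)"
      by (rule has_field_derivative_transform_within_open[where S = "- {p..q}"])
        (use that pq(4) in \<open>auto simp: open_Compl\<close>)
    then show ?thesis by (rule DERIV_imp_deriv)
  qed
  with pq show ?thesis unfolding bump_def using smooth_real_derivE(1) by blast
qed

lemma bump_diff:
  assumes "bump l r a" "bump l r b" shows "bump l r (\<lambda>x. a x - b x)"
proof -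
  obtain p q where a: "l < p" "p < q" "q < r" "\<And>x. x \<notin> {p..q} \<Longrightarrow> a x = 0" "smooth_real a"
    using assms by (auto simp: bump_def)
  obtain p' q' where b: "l < p'" "p' < q'" "q' < r" "\<And>x. x \<notin> {p'..q'} \<Longrightarrow> b x = 0" "smooth_real b"
    using assms by (auto simp: bump_def)
  have "a x - b x = 0" if "x \<notin> {min p p'..max q q'}" for x
    using that a(4)[of x] b(4)[of x] by (auto simp: min_def max_def split: if_splits)
  then show ?thesis unfolding bump_def
    by (intro conjI smooth_real_diff a b exI[of _ "min p p'"] exI[of _ "max q q'"]) (use a b in auto)
qed

lemma bump_cmult: "bump l r a \<Longrightarrow> bump l r (\<lambda>x. c * a x)"
  unfolding bump_def using smooth_real_mult[OF smooth_real_const] by (metis mult_zero_right)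

lemma bump_bounded:
  assumes "bump l r a" obtains C where "0 < C" "\<And>x. \<bar>a x\<bar> \<le> C"
proof -
  obtain p q where a: "p < q" "\<And>x. x \<notin> {p..q} \<Longrightarrow> a x = 0" "smooth_real a"
    using assms by (auto simp: bump_def)
  have "compact (a ` {p..q})" by (intro compact_continuous_image smooth_real_continuous a compact_Icc)
  then obtain B where B: "\<And>x. x \<in> {p..q} \<Longrightarrow> \<bar>a x\<bar> \<le> B"
    unfolding compact_eq_bounded_closed bounded_iff by fastforce
  have "\<bar>a x\<bar> \<le> max B 1" for x using B[of x] a(2)[of x] by (cases "x \<in> {p..q}") (auto simp: le_max_iff_disj)
  then show ?thesis using that[of "max B 1"] by auto
qed

lemma bump_integrable:
  assumes "bump l r a" "S = UNIV \<or> (\<exists>u v. S = {u..v})"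
  shows "a integrable_on S"
proof -
  obtain p q where a: "\<And>x. x \<notin> {p..q} \<Longrightarrow> a x = 0" "smooth_real a"
    using assms by (auto simp: bump_def)
  have "a integrable_on {p..q}" by (intro integrable_continuous_real smooth_real_continuous a)
  then have "(\<lambda>x. if x \<in> {p..q} then a x else 0) integrable_on UNIV" by (simp only: integrable_restrict_UNIV)
  moreover have "(\<lambda>x. if x \<in> {p..q} then a x else 0) = a" using a by auto
  ultimately have "a integrable_on UNIV" by simp
  moreover have "a integrable_on {u..v}" for u v by (intro integrable_continuous_real smooth_real_continuous a)
  ultimately show ?thesis using assms(2) by blast
qed

lemma bump_integral_translate:
  assumes "bump l r a" shows "integral UNIV (\<lambda>x. a (x - t)) = integral UNIV a"
proof -
  have i: "integral UNIV f = integral\<^sup>L lborel f" if bf: "bump l r f" for f l r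
  proof -
    obtain p q where a: "\<And>x. x \<notin> {p..q} \<Longrightarrow> f x = 0" "smooth_real f"
      using bf unfolding bump_def by blast
    have "integrable lborel (\<lambda>x. indicator {p..q} x *\<^sub>R f x)"
      by (rule borel_integrable_compact) (auto intro: smooth_real_continuous a)
    moreover have "(\<lambda>x. indicator {p..q} x *\<^sub>R f x) = f" using a by (auto simp: indicator_def fun_eq_iff)
    ultimately have "integrable lborel f" by simp
    then show ?thesis by (rule integral_lborel)
  qed
  have "bump (l + t) (r + t) (\<lambda>x. a (x - t))"
  proof -
    obtain p q where a: "l < p" "p < q" "q < r" "\<And>x. x \<notin> {p..q} \<Longrightarrow> a x = 0" "smooth_real a"
      using assms by (auto simp: bump_def)
    have "smooth_real (\<lambda>x. a (x - t))" using smooth_real_affine[OF a(5), of 1 "-t"] by simp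
    then show ?thesis unfolding bump_def
      by (intro conjI exI[of _ "p + t"] exI[of _ "q + t"]) (use a in auto)
  qed
  then have "integral UNIV (\<lambda>x. a (x - t)) = integral\<^sup>L lborel (\<lambda>x. a (x - t))" by (rule i)
  also have "\<dots> = integral\<^sup>L lborel a"
    using lborel_integral_real_affine[of 1 a "-t"] by simp
  also have "\<dots> = integral UNIV a" using i[OF assms] by simp
  finally show ?thesis .
qed

lemma integral_eq_zeroI: "(\<And>x. x \<in> S \<Longrightarrow> f x = 0) \<Longrightarrow> integral S f = 0"
  using integral_cong[of S f "\<lambda>_. 0"] by simp

lemma bump_antideriv:
  assumes "bump l r a"
  obtains A where "smooth_real A" "\<And>x. (A has_real_derivative a x) (at x)"
    "\<And>x. A x = integral {l..x} a" 
    "\<And>x. r \<le> x \<Longrightarrow> A x = integral UNIV a"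
proof -
  obtain p q where a: "l < p" "p < q" "q < r" "\<And>x. x \<notin> {p..q} \<Longrightarrow> a x = 0" "smooth_real a"
    using assms by (auto simp: bump_def)
  define A where "A x = integral {l..x} a" for x
  have D: "(A has_real_derivative a x) (at x)" for x
  proof (cases "x > l")
    case True
    have "(A has_real_derivative a x) (at x within {l..x+1})"
      unfolding A_def by (rule integral_has_real_derivative) (use True a smooth_real_continuous in auto)
    moreover have "at x within {l..x+1} = at x" using True by (intro at_within_interior) auto
    ultimately show ?thesis by simp
  next
    case False
    have "A y = 0" if "y < p" for y unfolding A_def using a that by (intro integral_eq_zeroI) auto
    then have "(A has_real_derivative 0) (at x)"
      using has_field_derivative_transform_within_open[of "\<lambda>_. 0" 0 x "{..<p}" A] False a(1) by auto
    then show ?thesis using False a by simp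
  qed
  have "A x = integral UNIV a" if "r \<le> x" for x
  proof -
    have "integral UNIV (\<lambda>y. if y \<in> {l..x} then a y else 0) = A x" 
      unfolding A_def by (rule integral_restrict_UNIV)
    moreover have "(\<lambda>y. if y \<in> {l..x} then a y else 0) = a" using a that by (auto simp: fun_eq_iff)
    ultimately show ?thesis by simp
  qed
  with D smooth_real_antideriv[OF a(5) D] show ?thesis using that[of A] A_def by blast
qed

text \<open>
  The antiderivatives of \<open>a\<close> and \<open>b\<close> increase from \<open>0\<close> to the same value, so their difference
  has compact support and is bounded by that value. Through this lemma, hypotheses on integrals
  against derivatives of bumps become comparisons of averages.
\<close>

lemma bump_difference_eq_deriv:
  assumes "bump l r a" "bump l r b" "integral UNIV a = integral UNIV b"
    and "\<And>x. 0 \<le> a x" "\<And>x. 0 \<le> b x"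
  obtains d where "bump l r d" "\<And>x. deriv d x = a x - b x" "\<And>x. \<bar>d x\<bar> \<le> integral UNIV a"
proof -
  obtain A where A: "smooth_real A" "\<And>x. (A has_real_derivative a x) (at x)"
    "\<And>x. A x = integral {l..x} a" "\<And>x. r \<le> x \<Longrightarrow> A x = integral UNIV a" 
    using bump_antideriv[OF assms(1)] by blast
  obtain B where B: "smooth_real B" "\<And>x. (B has_real_derivative b x) (at x)"
    "\<And>x. B x = integral {l..x} b" "\<And>x. r \<le> x \<Longrightarrow> B x = integral UNIV b" 
    using bump_antideriv[OF assms(2)] by blast
  obtain p q where pq: "l < p" "p < q" "q < r" "\<And>x. x \<notin> {p..q} \<Longrightarrow> a x - b x = 0"
    using bump_diff[OF assms(1,2)] by (auto simp: bump_def)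
  define d where "d x = A x - B x" for x
  have D: "(d has_real_derivative a x - b x) (at x)" for x
    unfolding d_def by (intro DERIV_diff A B)
  have "d x = 0" if "x \<notin> {p..q}" for x
  proof (cases "x < p")
    case True
    have "integral {l..x} (\<lambda>y. a y - b y) = 0" using pq True by (intro integral_eq_zeroI) auto
    moreover have "integral {l..x} (\<lambda>y. a y - b y) = integral {l..x} a - integral {l..x} b"
      by (intro integral_diff bump_integrable[OF assms(1)] bump_integrable[OF assms(2)]) auto
    ultimately show ?thesis by (simp add: d_def A B)
  next
    case False
    then have x: "x > q" using that by auto
    have "d x = d (max x r)"
    proof (cases "x < r")
      case True
      obtain z where z: "x < z" "z < r" "d r - d x = (r - x) * (a z - b z)"
        using MVT2[OF True, of d "\<lambda>x. a x - b x"] D by auto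
      then show ?thesis using pq(4)[of z] x True by auto
    qed (auto simp: max_def)
    also have "\<dots> = 0" using assms(3) A B by (simp add: d_def)
    finally show ?thesis .
  qed
  then have "bump l r d" unfolding bump_def using pq smooth_real_diff[OF A(1) B(1)] unfolding d_def[abs_def] by blast
  moreover have "deriv d x = a x - b x" for x using D by (rule DERIV_imp_deriv)
  moreover have "\<bar>d x\<bar> \<le> integral UNIV a" for x
  proof -
    have "0 \<le> A x" "0 \<le> B x" unfolding A B using assms by (auto intro!: integral_nonneg bump_integrable)
    moreover have "A x \<le> integral UNIV a" "B x \<le> integral UNIV b" unfolding A(3) B(3)
      by (intro integral_subset_le bump_integrable[OF assms(1)] bump_integrable[OF assms(2)];
          use assms(4,5) in auto)+
    ultimately show ?thesis using assms(3) by (auto simp: d_def)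
  qed
  ultimately show ?thesis using that by blast
qed

lemma bump_integral_pos:
  assumes "l < p" "p < q" "q < r"
  shows "0 < integral UNIV (cutoff p q n)"
proof -
  have b: "bump l r (cutoff p q n)" using assms by (rule bump_cutoff)
  obtain d where "smooth_real d" "\<And>x. (d has_real_derivative cutoff p q n x) (at x)"
    "\<And>x. d x = integral {l..x} (cutoff p q n)" "\<And>x. r \<le> x \<Longrightarrow> d x = integral UNIV (cutoff p q n)"
    using bump_antideriv[OF b] by blast
  note d = this
  have nn: "d x \<le> d y" if "x \<le> y" for x y
    using DERIV_nonneg_imp_nondecreasing[OF that, of d] d(2) cutoff_bounds(1) by blast
  obtain z where z: "p < z" "z < q" "d q - d p = (q - p) * cutoff p q n z"
    using MVT2[OF assms(2), of d "cutoff p q n"] d(2) by auto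
  have "0 < d q - d p" unfolding z(3) using z(1,2) assms(2) by (intro mult_pos_pos cutoff_pos) auto
  moreover have "d q \<le> d r" "d l \<le> d p" using nn assms by auto
  moreover have "d l = 0" using d(3)[of l] by simp
  ultimately show ?thesis using d(4)[of r] by simp
qed

section \<open>Change of variables under holomorphic maps\<close>

text \<open>
  This serves to identify \<^typ>\<open>complex\<close> with \<^typ>\<open>real^2\<close>, where the change of variables
  formula is expressed by Jacobian matrices. Boxes go to boxes under that identification.
\<close>

lemma has_integral_isometry:
  fixes g :: "'a::euclidean_space \<Rightarrow> 'b::euclidean_space" and f :: "'b \<Rightarrow> real"
  assumes hg: "\<And>x. h (g x) = x" and gh: "\<And>y. g (h y) = y"
    and cont: "\<And>x. continuous (at x) g"
    and norm: "\<And>y. norm (h y) = norm y"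
    and g: "\<And>u v. \<exists>w z. g ` cbox u v = cbox w z" and h: "\<And>u v. \<exists>w z. h ` cbox u v = cbox w z"
    and content: "\<And>u v. measure lborel (g ` cbox u v) = measure lborel (cbox u v)"
    and f: "(f has_integral i) UNIV"
  shows "((\<lambda>x. f (g x)) has_integral i) UNIV"
proof -
  have int: "f integrable_on cbox a b" for a b using f has_integral_alt'[of f i UNIV] by auto
  have tw: "((\<lambda>x. f (g x)) has_integral integral (g ` cbox a b) f) (cbox a b)" for a b
  proof -
    obtain w z where wz: "g ` cbox a b = cbox w z" using g by blast
    have "(f has_integral integral (cbox w z) f) (cbox w z)" using int by (rule integrable_integral)
    then have "((\<lambda>x. f (g x)) has_integral (1 / 1) *\<^sub>R integral (cbox w z) f) (h ` cbox w z)"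
      by (intro has_integral_twiddle[where g = g and h = h]) (use assms in auto)
    moreover have "h ` cbox w z = cbox a b" unfolding wz[symmetric] by (simp add: image_image hg)
    ultimately show ?thesis by (simp add: wz)
  qed
  show ?thesis
  proof (subst has_integral_alt', intro conjI allI impI)
    fix a b show "(\<lambda>x. if x \<in> UNIV then f (g x) else 0) integrable_on cbox a b" using tw by auto
  next
    fix e :: real assume "e > 0"
    then obtain B where B: "B > 0" "\<And>a b. ball 0 B \<subseteq> cbox a b \<Longrightarrow> norm (integral (cbox a b) f - i) < e"
      using f has_integral_alt'[of f i UNIV] by auto
    have "norm (integral (cbox a b) (\<lambda>x. f (g x)) - i) < e" if "ball 0 B \<subseteq> cbox a b" for a b
    proof -
      obtain w z where wz: "g ` cbox a b = cbox w z" using g by blast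
      have "ball 0 B \<subseteq> cbox w z"
      proof
        fix y :: 'b assume "y \<in> ball 0 B"
        then have "h y \<in> cbox a b" using that norm[of y] by auto
        then show "y \<in> cbox w z" unfolding wz[symmetric] using gh[of y] by (metis image_eqI)
      qed
      with B(2) show ?thesis using integral_unique[OF tw[of a b]] by (simp add: wz)
    qed
    with B(1) show "\<exists>B>0. \<forall>a b. ball 0 B \<subseteq> cbox a b \<longrightarrow>
        norm (integral (cbox a b) (\<lambda>x. if x \<in> UNIV then f (g x) else 0) - i) < e" by auto
  qed
qed

definition vec_of :: "complex \<Rightarrow> real^2" where "vec_of z = vector [Re z, Im z]"
definition of_vec :: "real^2 \<Rightarrow> complex" where "of_vec v = Complex (v $ 1) (v $ 2)"

lemma vec_of_nth [simp]: "vec_of z $ 1 = Re z" "vec_of z $ 2 = Im z" by (simp_all add: vec_of_def)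
lemma of_vec_sel [simp]: "Re (of_vec v) = v $ 1" "Im (of_vec v) = v $ 2" by (simp_all add: of_vec_def)
lemma of_vec_vec_of [simp]: "of_vec (vec_of z) = z" "vec_of (of_vec v) = v"
  by (simp_all add: complex_eq_iff vec_eq_iff forall_2)
lemma norm_vec_of [simp]: "norm (vec_of z) = norm z" "norm (of_vec v) = norm v"
  by (simp_all add: cmod_def norm_vec_def L2_set_def sum_2)

lemma bounded_linear_vec_of: "bounded_linear vec_of"
  by (rule bounded_linear_intro[where K = 1]) (auto simp: vec_eq_iff forall_2)
lemma bounded_linear_of_vec: "bounded_linear of_vec"
  by (rule bounded_linear_intro[where K = 1]) (auto simp: complex_eq_iff)

lemma vec_of_cbox: "vec_of ` cbox u v = cbox (vec_of u) (vec_of v)"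
proof -
  have "x \<in> vec_of ` cbox u v" if "x \<in> cbox (vec_of u) (vec_of v)" for x
    by (rule image_eqI[of _ _ "of_vec x"]) (use that in \<open>auto simp: mem_box_cart forall_2 in_cbox_complex_iff\<close>)
  then show ?thesis by (auto simp: mem_box_cart forall_2 in_cbox_complex_iff)
qed

lemma of_vec_cbox: "of_vec ` cbox u v = cbox (of_vec u) (of_vec v)"
  using arg_cong[OF vec_of_cbox[of "of_vec u" "of_vec v"], of "image of_vec"] by (simp add: image_image)

lemma content_vec_of: "measure lborel (vec_of ` cbox u v) = measure lborel (cbox u v)"
proof (cases "Re u \<le> Re v \<and> Im u \<le> Im v")
  case True
  then have "vec_of u \<in> cbox (vec_of u) (vec_of v)" "u \<in> cbox u v"
    by (auto simp: mem_box_cart forall_2 in_cbox_complex_iff)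
  then have "cbox (vec_of u) (vec_of v) \<noteq> {}" "cbox u v \<noteq> {}" by auto
  then show ?thesis
    unfolding vec_of_cbox by (simp add: content_cbox_cart UNIV_2 content_cbox' Basis_complex_def)
next
  case False
  then have "cbox u v = {}" by (auto simp: in_cbox_complex_iff)
  then show ?thesis by simp
qed

lemma has_integral_of_vec:
  fixes f :: "complex \<Rightarrow> real"
  shows "((\<lambda>v. f (of_vec v)) has_integral i) (vec_of ` S) \<longleftrightarrow> (f has_integral i) S"
proof -
  have *: "(if v \<in> vec_of ` S then f (of_vec v) else 0) = (if of_vec v \<in> S then f (of_vec v) else 0)" for v
    by (auto intro: image_eqI[of _ _ "of_vec v"])
  let ?f = "\<lambda>x. if x \<in> S then f x else 0"
  have "(?f has_integral i) UNIV \<longleftrightarrow> ((\<lambda>v. ?f (of_vec v)) has_integral i) UNIV"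
  proof
    assume "(?f has_integral i) UNIV"
    then show "((\<lambda>v. ?f (of_vec v)) has_integral i) UNIV"
      by (rule has_integral_isometry[rotated -1, where h = vec_of])
        (use of_vec_cbox vec_of_cbox content_vec_of[of "of_vec _" "of_vec _"]
          linear_continuous_at[OF bounded_linear_of_vec] in \<open>auto simp: \<close>)
  next
    assume "((\<lambda>v. ?f (of_vec v)) has_integral i) UNIV"
    then have "((\<lambda>x. ?f (of_vec (vec_of x))) has_integral i) UNIV"
      by (rule has_integral_isometry[rotated -1, where h = of_vec])
        (use of_vec_cbox vec_of_cbox content_vec_of
          linear_continuous_at[OF bounded_linear_vec_of] in auto)
    then show "(?f has_integral i) UNIV" by simp
  qed
  then show ?thesis
    using has_integral_restrict_UNIV[of "vec_of ` S" "\<lambda>v. f (of_vec v)" i]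
      has_integral_restrict_UNIV[of S f i] by (simp add: *)
qed

lemma absolutely_integrable_of_vec:
  fixes f :: "complex \<Rightarrow> real"
  shows "(\<lambda>v. f (of_vec v)) absolutely_integrable_on (vec_of ` S) \<longleftrightarrow> f absolutely_integrable_on S"
    and "integral (vec_of ` S) (\<lambda>v. f (of_vec v)) = integral S f"
  using has_integral_of_vec[of f _ S] has_integral_of_vec[of "\<lambda>x. norm (f x)" _ S]
  by (auto simp: absolutely_integrable_on_def integrable_on_def integral_def)

lemma absolutely_integrable_vec1:
  fixes f :: "'a::euclidean_space \<Rightarrow> real"
  shows "(\<lambda>x. vec (f x) :: real^1) absolutely_integrable_on S \<longleftrightarrow> f absolutely_integrable_on S"
    and "f absolutely_integrable_on S \<Longrightarrow> integral S (\<lambda>x. vec (f x) :: real^1) = vec (integral S f)"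
proof -
  have b: "bounded_linear (vec :: real \<Rightarrow> real^1)"
    by (rule bounded_linear_intro[where K = 1]) (auto simp: vec_eq_iff norm_vec_def L2_set_def)
  show "(\<lambda>x. vec (f x) :: real^1) absolutely_integrable_on S \<longleftrightarrow> f absolutely_integrable_on S"
    using absolutely_integrable_linear[OF _ b, where f = f and s = S]
      absolutely_integrable_linear[OF _ bounded_linear_vec_nth[of "1::1"], where f = "\<lambda>x. vec (f x) :: real^1" and s = S]
    by (auto simp: o_def)
  show "integral S (\<lambda>x. vec (f x) :: real^1) = vec (integral S f)" if "f absolutely_integrable_on S"
    using integral_linear[OF _ b, where f = f and S = S] that by (auto simp: o_def absolutely_integrable_on_def)
qed

lemma open_sets_lebesgue: "open (S :: complex set) \<Longrightarrow> S \<in> sets lebesgue"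
  using borel_open sets_completionI_sets[of S lborel] by auto

text \<open>
  By the Cauchy--Riemann equations the Jacobian determinant of \<open>G\<close> is \<open>\<bar>G'\<bar>\<^sup>2\<close>.
\<close>

theorem holomorphic_change_of_variables:
  fixes F :: "complex \<Rightarrow> real"
  assumes U: "open U" and G: "G holomorphic_on U" and inj: "inj_on G U"
  shows "(\<lambda>z. (norm (deriv G z))\<^sup>2 * F (G z)) absolutely_integrable_on U
      \<longleftrightarrow> F absolutely_integrable_on (G ` U)"
    and "F absolutely_integrable_on (G ` U) \<Longrightarrow>
      integral U (\<lambda>z. (norm (deriv G z))\<^sup>2 * F (G z)) = integral (G ` U) F"
proof -
  define g where "g v = vec_of (G (of_vec v))" for v
  define g' where "g' v w = vec_of (deriv G (of_vec v) * of_vec w)" for v w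
  define S where "S = vec_of ` U"
  have gS: "g ` S = vec_of ` (G ` U)" by (simp add: g_def S_def image_image)
  have "open S"
  proof -
    have "S = of_vec -` U" by (auto simp: S_def intro: image_eqI[of _ _ "of_vec _"])
    moreover have "continuous_on UNIV of_vec" by (rule linear_continuous_on[OF bounded_linear_of_vec])
    ultimately show ?thesis using U by (simp add: open_vimage)
  qed
  then have S: "S \<in> sets lebesgue"
    unfolding S_def using borel_open sets_completionI_sets[of "vec_of ` U" lborel] by auto
  have der: "(g has_derivative g' v) (at v within S)" if "v \<in> S" for v
  proof -
    have z: "of_vec v \<in> U" using that by (auto simp: S_def)
    have "(G has_derivative (*) (deriv G (of_vec v))) (at (of_vec v))"
      using holomorphic_derivI[OF G U z] by (simp add: has_field_derivative_def)
    then have "((\<lambda>v. G (of_vec v)) has_derivative (\<lambda>w. deriv G (of_vec v) * of_vec w)) (at v within S)"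
      by (rule has_derivative_compose[rotated])
        (rule bounded_linear_imp_has_derivative[OF bounded_linear_of_vec])
    from bounded_linear.has_derivative[OF bounded_linear_vec_of this]
    show ?thesis by (simp add: g_def[abs_def] g'_def[abs_def])
  qed
  have injS: "inj_on g S"
  proof (rule inj_onI)
    fix v w assume "v \<in> S" "w \<in> S" "g v = g w"
    then have "G (of_vec v) = G (of_vec w)" unfolding g_def by (metis of_vec_vec_of(1))
    moreover have "of_vec v \<in> U" "of_vec w \<in> U" using \<open>v \<in> S\<close> \<open>w \<in> S\<close> by (auto simp: S_def)
    ultimately have "of_vec v = of_vec w" by (rule inj_onD[OF inj])
    then show "v = w" by (metis of_vec_vec_of(2))
  qed
  have det: "\<bar>det (matrix (g' v))\<bar> = (norm (deriv G (of_vec v)))\<^sup>2" for v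
    unfolding cmod_power2 by (simp add: det_2 matrix_def g'_def power2_eq_square axis_def)
  define Fv :: "real^2 \<Rightarrow> real^1" where "Fv v = vec (F (of_vec v))" for v
  note cov = has_absolute_integral_change_of_variables[OF S der injS, of Fv]
  have sc: "c *\<^sub>R (vec x :: real^1) = vec (c * x)" for c x by (simp add: vec_eq_iff)
  have L: "(\<lambda>v. \<bar>det (matrix (g' v))\<bar> *\<^sub>R Fv (g v)) =
      (\<lambda>v. vec ((\<lambda>z. (norm (deriv G z))\<^sup>2 * F (G z)) (of_vec v)))"
    unfolding det Fv_def g_def by (simp add: sc)
  have Li: "(\<lambda>v. \<bar>det (matrix (g' v))\<bar> *\<^sub>R Fv (g v)) absolutely_integrable_on S \<longleftrightarrow>
      (\<lambda>z. (norm (deriv G z))\<^sup>2 * F (G z)) absolutely_integrable_on U"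
    unfolding L absolutely_integrable_vec1(1) S_def by (rule absolutely_integrable_of_vec(1))
  have Ri: "Fv absolutely_integrable_on g ` S \<longleftrightarrow> F absolutely_integrable_on (G ` U)"
    unfolding Fv_def[abs_def] absolutely_integrable_vec1(1) gS by (rule absolutely_integrable_of_vec(1))
  show iff: "(\<lambda>z. (norm (deriv G z))\<^sup>2 * F (G z)) absolutely_integrable_on U
      \<longleftrightarrow> F absolutely_integrable_on (G ` U)"
    using cov Li Ri by blast
  assume F: "F absolutely_integrable_on (G ` U)"
  have "integral S (\<lambda>v. \<bar>det (matrix (g' v))\<bar> *\<^sub>R Fv (g v)) = integral (g ` S) Fv"
    using cov[of "integral (g ` S) Fv"] F Ri by blast
  moreover have "integral S (\<lambda>v. \<bar>det (matrix (g' v))\<bar> *\<^sub>R Fv (g v)) =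
      vec (integral U (\<lambda>z. (norm (deriv G z))\<^sup>2 * F (G z)))"
    unfolding L S_def
    by (subst absolutely_integrable_vec1(2))
      (use F iff absolutely_integrable_of_vec[where f = "\<lambda>z. (norm (deriv G z))\<^sup>2 * F (G z)" and S = U] in auto)
  moreover have "integral (g ` S) Fv = vec (integral (G ` U) F)"
    unfolding Fv_def[abs_def] gS
    by (subst absolutely_integrable_vec1(2)) (use F absolutely_integrable_of_vec[where f = F and S = "G ` U"] in auto)
  ultimately show "integral U (\<lambda>z. (norm (deriv G z))\<^sup>2 * F (G z)) = integral (G ` U) F"
    by (simp add: vec_eq_iff)
qed

section \<open>Functions of unit slope on a rectangle\<close>

lemma Ck_on_smooth_real: "smooth_real a \<Longrightarrow> open S \<Longrightarrow> Ck_on k S f \<Longrightarrow> Ck_on k S (\<lambda>z. a (f z))"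
  unfolding smooth_real_def using Ck_on_compose_real[of S _ k f 0] by metis

text \<open>
  Products of functions of one coordinate suffice as test functions on a rectangle, because the
  indicators of boxes are limits of such products.
\<close>

definition tensor :: "(real \<Rightarrow> real) \<Rightarrow> (real \<Rightarrow> real) \<Rightarrow> complex \<Rightarrow> real" where
  "tensor a b w = a (Re w) * b (Im w)"

lemma tensor_has_derivative:
  assumes "smooth_real a" "smooth_real b" "G holomorphic_on U" "open U" "z \<in> U"
  shows "((\<lambda>z. tensor a b (G z)) has_derivative
    (\<lambda>v. Re v * (tensor (deriv a) b (G z) * Re (deriv G z) + tensor a (deriv b) (G z) * Im (deriv G z))
       + Im v * (- tensor (deriv a) b (G z) * Im (deriv G z) + tensor a (deriv b) (G z) * Re (deriv G z)))) (at z)"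
proof -
  note D = has_derivative_Re_Im_holomorphic[OF assms(3,4,5)]
  note A = has_derivative_compose[OF D(1) smooth_real_derivE(2)[OF assms(1), unfolded has_field_derivative_def]]
  note B = has_derivative_compose[OF D(2) smooth_real_derivE(2)[OF assms(2), unfolded has_field_derivative_def]]
  show ?thesis
    by (rule has_derivative_eq_rhs[OF has_derivative_mult[OF A B, folded tensor_def]])
      (simp add: fun_eq_iff tensor_def algebra_simps)
qed

lemma Ck_on_tensor:
  assumes "smooth_real a" "smooth_real b" "G holomorphic_on U" "open U"
  shows "Ck_on k U (\<lambda>z. tensor a b (G z))"
proof -
  note G = Ck_on_Re_Im_holomorphic[OF assms(4,3), of k]
  have "Ck_on k U (\<lambda>z. a (Re (G z)))" by (rule Ck_on_smooth_real[OF assms(1,4)]) (use G in blast)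
  moreover have "Ck_on k U (\<lambda>z. b (Im (G z)))" by (rule Ck_on_smooth_real[OF assms(2,4)]) (use G in blast)
  ultimately show ?thesis unfolding tensor_def by (rule Ck_on_mult[OF assms(4)])
qed

abbreviation rect :: "real \<Rightarrow> real \<Rightarrow> real \<Rightarrow> real \<Rightarrow> complex set" where
  "rect l r c d \<equiv> box (Complex l c) (Complex r d)"

lemma tensor_support:
  assumes "bump l r a" "bump c d b"
  obtains K where "compact K" "K \<subseteq> rect l r c d" "\<And>w. w \<notin> K \<Longrightarrow> tensor a b w = 0"
proof -
  obtain p q where a: "l < p" "p < q" "q < r" "\<And>x. x \<notin> {p..q} \<Longrightarrow> a x = 0"
    using assms(1) unfolding bump_def by blast
  obtain p' q' where b: "c < p'" "p' < q'" "q' < d" "\<And>x. x \<notin> {p'..q'} \<Longrightarrow> b x = 0"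
    using assms(2) unfolding bump_def by blast
  show ?thesis
  proof (rule that[of "cbox (Complex p p') (Complex q q')"])
    show "tensor a b w = 0" if "w \<notin> cbox (Complex p p') (Complex q q')" for w
      using that a(4)[of "Re w"] b(4)[of "Im w"] by (auto simp: tensor_def in_cbox_complex_iff)
  qed (use a b in \<open>auto simp: in_cbox_complex_iff in_box_complex_iff\<close>)
qed

lemma tensor_eq_0: "bump l r a \<Longrightarrow> bump c d b \<Longrightarrow> w \<notin> rect l r c d \<Longrightarrow> tensor a b w = 0"
  by (erule (1) tensor_support) blast

lemma tensor_test_function:
  assumes "bump l r a" "bump c d b"
  shows "tensor a b \<in> test_functions UNIV"
proof -
  obtain K where K: "compact K" "K \<subseteq> rect l r c d" "\<And>w. w \<notin> K \<Longrightarrow> tensor a b w = 0"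
    using tensor_support[OF assms] by blast
  have "Ck_on k UNIV (tensor a b)" for k
    using Ck_on_tensor[OF bump_smooth[OF assms(1)] bump_smooth[OF assms(2)] holomorphic_on_ident open_UNIV] .
  then have "(\<lambda>z. if z \<in> UNIV then tensor a b z else 0) \<in> test_functions UNIV"
    by (rule test_function_extend[where K = K, rotated 2]) (use K in simp_all)
  then show ?thesis by simp
qed

lemma tensor_continuous: "smooth_real a \<Longrightarrow> smooth_real b \<Longrightarrow> continuous_on S (tensor a b)"
  using Ck_on_tensor[OF _ _ holomorphic_on_ident open_UNIV, of a b 0] continuous_on_subset
  by fastforce

lemma integral_deriv_tensor:
  assumes "bump l r a" "bump c d b"
  shows "integral (rect l r c d) (tensor (deriv a) b) = 0"
    and "integral (rect l r c d) (tensor a (deriv b)) = 0"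
proof -
  note T = tensor_test_function[OF assms]
  have sm: "smooth_real a" "smooth_real b" using assms bump_smooth by auto
  have D: "partial 1 (tensor a b) = tensor (deriv a) b" "partial \<i> (tensor a b) = tensor a (deriv b)"
    using tensor_has_derivative[OF sm holomorphic_on_ident open_UNIV, THEN partial_eq]
    by (auto simp: fun_eq_iff)
  have *: "integral (rect l r c d) (tensor a' b') = integral\<^sup>L lborel (tensor a' b')"
    if "bump l r a'" "bump c d b'" for a' b'
  proof -
    have "(\<lambda>w. if w \<in> rect l r c d then tensor a' b' w else 0) = tensor a' b'"
      using tensor_eq_0[OF that] by auto
    then have "integral (rect l r c d) (tensor a' b') = integral UNIV (tensor a' b')"
      using integral_restrict_UNIV[of "rect l r c d" "tensor a' b'"] by simp
    then show ?thesis
      using integral_lborel[OF test_function_integrable[OF tensor_test_function[OF that]]] by simp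
  qed
  show "integral (rect l r c d) (tensor (deriv a) b) = 0" "integral (rect l r c d) (tensor a (deriv b)) = 0"
    using *[OF bump_deriv[OF assms(1)] assms(2)] *[OF assms(1) bump_deriv[OF assms(2)]]
      integral_partial_test_function[OF T] unfolding D[symmetric] by auto
qed

lemma absolutely_integrable_mult_bounded_continuous:
  fixes g \<phi> :: "complex \<Rightarrow> real"
  assumes "g absolutely_integrable_on S" "S \<in> sets lebesgue" "continuous_on S \<phi>" "bounded (\<phi> ` S)"
  shows "(\<lambda>w. g w * \<phi> w) absolutely_integrable_on S"
proof -
  have "\<phi> \<in> borel_measurable (lebesgue_on S)"
    using assms(2,3) by (rule continuous_imp_measurable_on_sets_lebesgue[rotated])
  from absolutely_integrable_bounded_measurable_product[OF bilinear_times this assms(2,4,1)]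
  show ?thesis by (simp add: mult.commute)
qed

lemma tensor_bounded:
  assumes "bump l r a" "bump c d b" shows "bounded (tensor a b ` S)"
proof -
  obtain A B where A: "0 < A" "\<And>x. \<bar>a x\<bar> \<le> A" and B: "0 < B" "\<And>x. \<bar>b x\<bar> \<le> B"
    using bump_bounded[OF assms(1)] bump_bounded[OF assms(2)] by metis
  have "norm (tensor a b w) \<le> A * B" for w
    using A B by (auto simp: tensor_def abs_mult intro!: mult_mono)
  then show ?thesis by (intro boundedI[of _ "A * B"]) auto
qed

lemma absolutely_integrable_mult_tensor:
  assumes "g absolutely_integrable_on rect l r c d" "bump l' r' a" "bump c' d' b"
  shows "(\<lambda>w. g w * tensor a b w) absolutely_integrable_on rect l r c d"
  by (intro absolutely_integrable_mult_bounded_continuous tensor_bounded[OF assms(2,3)]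
    tensor_continuous bump_smooth[OF assms(2)] bump_smooth[OF assms(3)] assms(1)) auto

lemma integrable_mult_tensor:
  assumes "g absolutely_integrable_on rect l r c d" "bump l' r' a" "bump c' d' b"
  shows "(\<lambda>w. g w * tensor a b w) integrable_on rect l r c d"
  using absolutely_integrable_mult_tensor[OF assms] by (simp add: absolutely_integrable_on_def)

lemma integral_cutoff_le:
  assumes "p < q" shows "integral UNIV (cutoff p q n) \<le> q - p"
proof -
  have "integral UNIV (\<lambda>x. if x \<in> {p..q} then cutoff p q n x else 0) = integral {p..q} (cutoff p q n)"
    by (rule integral_restrict_UNIV)
  moreover have "(\<lambda>x. if x \<in> {p..q} then cutoff p q n x else 0) = cutoff p q n"
    using cutoff_eq_0[of _ p q n] by (auto simp: fun_eq_iff)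
  moreover have "integral {p..q} (cutoff p q n) \<le> integral {p..q} (\<lambda>_. 1)"
    by (rule integral_le)
      (auto intro!: integrable_continuous_real smooth_real_continuous[OF smooth_real_cutoff] cutoff_bounds)
  ultimately show ?thesis using assms by simp
qed

lemma integral_cutoff_tensor_tendsto:
  assumes g: "g absolutely_integrable_on rect l r c d"
    and p: "l < p" "p < q" "q < r" "c < p'" "p' < q'" "q' < d"
  shows "(\<lambda>n. integral (rect l r c d) (\<lambda>w. g w * tensor (cutoff p q n) (cutoff p' q' n) w))
    \<longlonglongrightarrow> integral (cbox (Complex p p') (Complex q q')) g"
proof -
  let ?W = "rect l r c d" and ?C = "rect p q p' q'"
  have sub: "?C \<subseteq> ?W" using p by (auto simp: in_box_complex_iff)
  have "(\<lambda>n. integral ?W (\<lambda>w. g w * tensor (cutoff p q n) (cutoff p' q' n) w))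
      \<longlonglongrightarrow> integral ?W (\<lambda>w. if w \<in> ?C then g w else 0)"
  proof (rule dominated_convergence(2)[where h = "\<lambda>w. norm (g w)"])
    show "(\<lambda>w. g w * tensor (cutoff p q n) (cutoff p' q' n) w) integrable_on ?W" for n
      by (rule integrable_mult_tensor[OF g bump_cutoff[OF p(1-3)] bump_cutoff[OF p(4-6)]])
    show "(\<lambda>w. norm (g w)) integrable_on ?W" using g by (simp add: absolutely_integrable_on_def)
    show "norm (g w * tensor (cutoff p q n) (cutoff p' q' n) w) \<le> norm (g w)" for n w
      using cutoff_bounds[of p q n "Re w"] cutoff_bounds[of p' q' n "Im w"]
      by (auto simp: tensor_def abs_mult intro!: mult_left_le mult_le_one)
    show "(\<lambda>n. g w * tensor (cutoff p q n) (cutoff p' q' n) w) \<longlonglongrightarrow> (if w \<in> ?C then g w else 0)" for w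
    proof -
      have "(\<lambda>n. g w * tensor (cutoff p q n) (cutoff p' q' n) w) \<longlonglongrightarrow>
          g w * (indicator {p<..<q} (Re w) * indicator {p'<..<q'} (Im w))"
        unfolding tensor_def by (intro tendsto_intros cutoff_tendsto)
      moreover have "g w * (indicator {p<..<q} (Re w) * indicator {p'<..<q'} (Im w)) = (if w \<in> ?C then g w else 0)"
        by (auto simp: in_box_complex_iff indicator_def)
      ultimately show ?thesis by simp
    qed
  qed
  moreover have "integral ?W (\<lambda>w. if w \<in> ?C then g w else 0) = integral ?C g"
    using integral_restrict_Int[of ?W ?C g] sub by (simp add: Int_absorb2)
  moreover have "integral ?C g = integral (cbox (Complex p p') (Complex q q')) g"
    by (rule integral_open_interval)
  ultimately show ?thesis by simp
qed

text \<open>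
  The first condition on \<open>g\<close> says that its vertical weak derivative vanishes. Hence its integral
  against \<open>a \<otimes> b\<close>, for however narrow a bump \<open>b\<close>, is the one against \<open>a \<otimes> b0\<close> up to the factor
  \<open>\<integral>b\<close>. Two boxes of equal size can therefore be compared with the second condition, in which only
  the fixed profile \<open>b0\<close> occurs: their averages differ by at most \<open>\<epsilon>\<close>. Almost everywhere the
  averages over shrinking boxes converge to the values of \<open>g\<close>.

  It is essential that \<open>b0\<close> does not shrink. In the application the horizontal derivative of \<open>g\<close> is
  a measure concentrated on vertical lines, which is small on a thin vertical strip but not in
  comparison with the height of a small box.
\<close>

lemma oscillation_bound_ae:
  assumes g: "g absolutely_integrable_on rect l r c d"
    and v: "\<And>a b. bump l r a \<Longrightarrow> bump c d b \<Longrightarrow>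
      integral (rect l r c d) (\<lambda>w. g w * tensor a (deriv b) w) = 0"
    and b0: "bump c d b0" "integral UNIV b0 = 1" "\<And>y. 0 \<le> b0 y"
    and u: "\<And>a M. bump l r a \<Longrightarrow> (\<And>x. \<bar>a x\<bar> \<le> M) \<Longrightarrow>
      \<bar>integral (rect l r c d) (\<lambda>w. g w * tensor (deriv a) b0 w)\<bar> \<le> \<epsilon> * M"
    and \<epsilon>: "0 \<le> \<epsilon>"
  obtains N where "negligible N"
    "\<And>w w'. w \<in> rect l r c d - N \<Longrightarrow> w' \<in> rect l r c d - N \<Longrightarrow> \<bar>g w - g w'\<bar> \<le> \<epsilon>"
proof -
  let ?W = "rect l r c d"
  define I where "I a b = integral ?W (\<lambda>w. g w * tensor a b w)" for a b
  have Idiff: "I (\<lambda>x. a x - a' x) b = I a b - I a' b" "I b' (\<lambda>y. e y - e' y) = I b' e - I b' e'"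
    if "bump l r a" "bump l r a'" "bump c d b" "bump l r b'" "bump c d e" "bump c d e'" for a a' b b' e e'
  proof -
    have "I a b - I a' b = integral ?W (\<lambda>w. g w * tensor a b w - g w * tensor a' b w)"
      unfolding I_def by (rule integral_diff[symmetric]) (rule integrable_mult_tensor[OF g]; use that in blast)+
    then show "I (\<lambda>x. a x - a' x) b = I a b - I a' b" by (simp add: I_def tensor_def algebra_simps)
    have "I b' e - I b' e' = integral ?W (\<lambda>w. g w * tensor b' e w - g w * tensor b' e' w)"
      unfolding I_def by (rule integral_diff[symmetric]) (rule integrable_mult_tensor[OF g]; use that in blast)+
    then show "I b' (\<lambda>y. e y - e' y) = I b' e - I b' e'" by (simp add: I_def tensor_def algebra_simps)
  qed
  \<comment> \<open>the vertical derivative of \<open>g\<close> vanishes, so the profile \<open>b\<close> may be replaced by a multiple of \<open>b0\<close>\<close>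
  have step1: "I a b = integral UNIV b * I a b0" if a: "bump l r a" and b: "bump c d b" "\<And>y. 0 \<le> b y" for a b
  proof -
    let ?J = "integral UNIV b" let ?b = "\<lambda>y. ?J * b0 y"
    have J: "0 \<le> ?J" using b by (intro integral_nonneg bump_integrable) auto
    have bb: "bump c d ?b" by (rule bump_cmult[OF b0(1)])
    obtain e where e: "bump c d e" "\<And>y. deriv e y = b y - ?b y"
    proof (rule bump_difference_eq_deriv[OF b(1) bb])
      show "integral UNIV b = integral UNIV ?b" using b0(2) by simp
    qed (use b b0 J that in auto)
    have "0 = I a (deriv e)" using v[OF a e(1)] by (simp add: I_def)
    also have "deriv e = (\<lambda>y. b y - ?b y)" using e(2) by auto
    also have "I a \<dots> = I a b - I a ?b" by (rule Idiff(2)[OF a a b0(1) a b(1) bb])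
    also have "I a ?b = integral ?W (\<lambda>w. ?J * (g w * tensor a b0 w))"
      unfolding I_def tensor_def by (simp add: algebra_simps)
    also have "\<dots> = ?J * I a b0" unfolding I_def by simp
    finally show ?thesis by simp
  qed
  have box: "\<bar>integral (cbox w (w + h *\<^sub>R One)) g - integral (cbox w' (w' + h *\<^sub>R One)) g\<bar> \<le> \<epsilon> * h\<^sup>2"
    if w: "w \<in> ?W" "w + h *\<^sub>R One \<in> ?W" "w' \<in> ?W" "w' + h *\<^sub>R One \<in> ?W" and h: "h > 0" for w w' h
  proof -
    have One: "(One :: complex) = Complex 1 1" by (simp add: Basis_complex_def complex_eq_iff)
    \<comment> \<open>smooth approximations of the indicators of the sides of the two boxes\<close>
    define al where "al n = cutoff (Re w) (Re w + h) n" for n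
    define al' where "al' n = cutoff (Re w') (Re w' + h) n" for n
    define be where "be n = cutoff (Im w) (Im w + h) n" for n
    define be' where "be' n = cutoff (Im w') (Im w' + h) n" for n
    have corner: "z + h *\<^sub>R One = Complex (Re z + h) (Im z + h)" for z :: complex
      by (simp add: One complex_eq_iff)
    have W: "l < Re w" "Re w + h < r" "c < Im w" "Im w + h < d" "l < Re w'" "Re w' + h < r" "c < Im w'" "Im w' + h < d"
      using w by (auto simp: in_box_complex_iff One)
    have bumps: "bump l r (al n)" "bump l r (al' n)" "bump c d (be n)" "bump c d (be' n)" for n
      unfolding al_def al'_def be_def be'_def by (intro bump_cutoff; use W h in simp)+
    have tr: "integral UNIV (cutoff (x + t) (x + t + h) n) = integral UNIV (cutoff x (x + h) n)" for x t n
    proof -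
      have "bump (x - 1) (x + h + 1) (cutoff x (x + h) n)" by (rule bump_cutoff) (use h in auto)
      from bump_integral_translate[OF this, of t] show ?thesis
        using cutoff_translate[of x t "x + h" n, abs_def] by (simp add: add.commute add.left_commute)
    qed
    define J where "J n = integral UNIV (al n)" for n
    have J: "integral UNIV (al' n) = J n" "integral UNIV (be n) = J n" "integral UNIV (be' n) = J n" for n
      using tr[of "Re w" "Re w' - Re w" n] tr[of "Re w" "Im w - Re w" n] tr[of "Re w" "Im w' - Re w" n]
      by (auto simp: J_def al_def al'_def be_def be'_def)
    have J0: "0 \<le> J n" for n unfolding J_def
      using bumps(1) cutoff_bounds by (intro integral_nonneg bump_integrable) (auto simp: al_def)
    have Jh: "J n \<le> h" for n using integral_cutoff_le[of "Re w" "Re w + h" n] h by (simp add: J_def al_def)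
    have est: "\<bar>I (al n) (be n) - I (al' n) (be' n)\<bar> \<le> \<epsilon> * h\<^sup>2" for n
    proof -
      have nn: "0 \<le> al n x" "0 \<le> al' n x" "0 \<le> be n x" "0 \<le> be' n x" for x
        by (auto simp: al_def al'_def be_def be'_def cutoff_bounds)
      obtain D where D: "bump l r D" "\<And>x. deriv D x = al n x - al' n x" "\<And>x. \<bar>D x\<bar> \<le> J n"
        using bump_difference_eq_deriv[OF bumps(1)[of n] bumps(2)[of n]] nn J unfolding J_def by metis
      have "deriv D = (\<lambda>x. al n x - al' n x)" using D(2) by auto
      then have "I (deriv D) b0 = I (al n) b0 - I (al' n) b0"
        using Idiff(1)[OF bumps(1)[of n] bumps(2)[of n] b0(1) D(1) b0(1) b0(1)] by simp
      then have "\<bar>I (al n) b0 - I (al' n) b0\<bar> \<le> \<epsilon> * J n" using u[OF D(1,3)] by (simp add: I_def)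
      then have "J n * \<bar>I (al n) b0 - I (al' n) b0\<bar> \<le> J n * (\<epsilon> * J n)"
        using J0 by (intro mult_left_mono)
      moreover have "I (al n) (be n) - I (al' n) (be' n) = J n * (I (al n) b0 - I (al' n) b0)"
        using step1[OF bumps(1,3) nn(3)] step1[OF bumps(2,4) nn(4)] J by (simp add: algebra_simps)
      moreover have "J n * (\<epsilon> * J n) \<le> \<epsilon> * h\<^sup>2"
        using mult_left_mono[OF mult_mono[OF Jh Jh], of n \<epsilon> n] J0[of n] h \<epsilon>
        by (simp add: power2_eq_square algebra_simps)
      ultimately show ?thesis using J0[of n] by (simp add: abs_mult)
    qed
    have "(\<lambda>n. I (al n) (be n)) \<longlonglongrightarrow> integral (cbox w (w + h *\<^sub>R One)) g"
      unfolding I_def al_def be_def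
      using integral_cutoff_tensor_tendsto[OF g, of "Re w" "Re w + h" "Im w" "Im w + h"] W h
      by (simp add: corner)
    moreover have "(\<lambda>n. I (al' n) (be' n)) \<longlonglongrightarrow> integral (cbox w' (w' + h *\<^sub>R One)) g"
      unfolding I_def al'_def be'_def
      using integral_cutoff_tensor_tendsto[OF g, of "Re w'" "Re w' + h" "Im w'" "Im w' + h"] W h
      by (simp add: corner)
    ultimately have "(\<lambda>n. \<bar>I (al n) (be n) - I (al' n) (be' n)\<bar>) \<longlonglongrightarrow>
      \<bar>integral (cbox w (w + h *\<^sub>R One)) g - integral (cbox w' (w' + h *\<^sub>R One)) g\<bar>"
      by (intro tendsto_intros)
    then show ?thesis by (rule LIMSEQ_le_const2) (use est in auto)
  qed
  let ?f = "\<lambda>w. if w \<in> ?W then g w else 0"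
  have "?f integrable_on UNIV" using g by (simp only: integrable_restrict_UNIV absolutely_integrable_on_def)
  then have "?f integrable_on cbox a b" for a b by (rule integrable_on_subcbox) auto
  then obtain N where N: "negligible N"
    "\<And>x e. x \<notin> N \<Longrightarrow> 0 < e \<Longrightarrow> \<exists>\<delta>>0. \<forall>h. 0 < h \<and> h < \<delta> \<longrightarrow>
        norm (integral (cbox x (x + h *\<^sub>R One)) ?f /\<^sub>R h ^ DIM(complex) - ?f x) < e"
    using integrable_ccontinuous_explicit[of ?f] by blast
  show ?thesis
  proof (rule that[OF N(1)])
    fix w w' assume w: "w \<in> ?W - N" and w': "w' \<in> ?W - N"
    show "\<bar>g w - g w'\<bar> \<le> \<epsilon>"
    proof (rule field_le_epsilon)
      fix e :: real assume e: "e > 0"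
      have near: "\<exists>\<delta>>0. \<forall>h. 0 < h \<and> h < \<delta> \<longrightarrow> x + h *\<^sub>R One \<in> ?W \<and>
         \<bar>integral (cbox x (x + h *\<^sub>R One)) g / h\<^sup>2 - g x\<bar> < e / 2" if x: "x \<in> ?W - N" for x
      proof -
        obtain \<delta>1 where \<delta>1: "\<delta>1 > 0" "\<And>h. 0 < h \<Longrightarrow> h < \<delta>1 \<Longrightarrow>
            norm (integral (cbox x (x + h *\<^sub>R One)) ?f /\<^sub>R h ^ DIM(complex) - ?f x) < e / 2"
          using N(2)[of x "e / 2"] x e by auto
        have "((\<lambda>h. x + h *\<^sub>R (One::complex)) \<longlongrightarrow> x + 0 *\<^sub>R One) (at 0)" by (intro tendsto_intros)
        then have "\<forall>\<^sub>F h in at 0. x + h *\<^sub>R (One::complex) \<in> ?W"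
          by (rule topological_tendstoD) (use x in auto)
        then obtain \<delta>2 where \<delta>2: "\<delta>2 > 0" "\<And>h. h \<noteq> 0 \<Longrightarrow> \<bar>h\<bar> < \<delta>2 \<Longrightarrow> x + h *\<^sub>R (One::complex) \<in> ?W"
          unfolding eventually_at by (auto simp: dist_real_def)
        have "x + h *\<^sub>R One \<in> ?W \<and> \<bar>integral (cbox x (x + h *\<^sub>R One)) g / h\<^sup>2 - g x\<bar> < e / 2"
          if h: "0 < h" "h < min \<delta>1 \<delta>2" for h
        proof -
          have W: "x + h *\<^sub>R One \<in> ?W" using \<delta>2 h by auto
          have "cbox x (x + h *\<^sub>R One) \<subseteq> ?W"
            using x W by (auto simp: in_box_complex_iff in_cbox_complex_iff)
          then have "integral (cbox x (x + h *\<^sub>R One)) ?f = integral (cbox x (x + h *\<^sub>R One)) g"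
            by (intro integral_cong) auto
          moreover have "norm (integral (cbox x (x + h *\<^sub>R One)) ?f /\<^sub>R h ^ DIM(complex) - ?f x) < e / 2"
            using \<delta>1(2) h by simp
          moreover have "?f x = g x" using x by simp
          ultimately have "\<bar>integral (cbox x (x + h *\<^sub>R One)) g / h\<^sup>2 - g x\<bar> < e / 2"
            by (simp only: DIM_complex real_norm_def real_scaleR_def divide_inverse_commute)
          with W show ?thesis by blast
        qed
        then show ?thesis using \<delta>1 \<delta>2 by (intro exI[of _ "min \<delta>1 \<delta>2"]) auto
      qed
      obtain \<delta> \<delta>' where \<delta>: "\<delta> > 0" "\<forall>h. 0 < h \<and> h < \<delta> \<longrightarrow> w + h *\<^sub>R One \<in> ?W \<and>
            \<bar>integral (cbox w (w + h *\<^sub>R One)) g / h\<^sup>2 - g w\<bar> < e / 2"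
        and \<delta>': "\<delta>' > 0" "\<forall>h. 0 < h \<and> h < \<delta>' \<longrightarrow> w' + h *\<^sub>R One \<in> ?W \<and>
            \<bar>integral (cbox w' (w' + h *\<^sub>R One)) g / h\<^sup>2 - g w'\<bar> < e / 2"
        using near[OF w] near[OF w'] by blast
      define h where "h = min \<delta> \<delta>' / 2"
      have h: "0 < h" "h < \<delta>" "h < \<delta>'" using \<delta>(1) \<delta>'(1) by (auto simp: h_def)
      let ?A = "integral (cbox w (w + h *\<^sub>R One)) g" and ?B = "integral (cbox w' (w' + h *\<^sub>R One)) g"
      have 1: "w + h *\<^sub>R One \<in> ?W" "\<bar>?A / h\<^sup>2 - g w\<bar> < e / 2" using \<delta>(2) h by blast+
      have 2: "w' + h *\<^sub>R One \<in> ?W" "\<bar>?B / h\<^sup>2 - g w'\<bar> < e / 2" using \<delta>'(2) h by blast+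
      have "\<bar>?A - ?B\<bar> \<le> \<epsilon> * h\<^sup>2" using box[of w h w'] 1 2 w w' h by auto
      then have "\<bar>?A - ?B\<bar> / h\<^sup>2 \<le> \<epsilon>" using h by (simp add: divide_le_eq)
      then have "\<bar>?A / h\<^sup>2 - ?B / h\<^sup>2\<bar> \<le> \<epsilon>" using h by (simp add: diff_divide_distrib[symmetric])
      with 1(2) 2(2) show "\<bar>g w - g w'\<bar> \<le> \<epsilon> + e" by linarith
    qed
  qed
qed

lemma absolutely_integrable_rect:
  fixes f :: "complex \<Rightarrow> real"
  assumes "continuous_on UNIV f" shows "f absolutely_integrable_on rect l r c d"
proof -
  have "f absolutely_integrable_on cbox (Complex l c) (Complex r d)"
    using assms by (intro absolutely_integrable_continuous) (rule continuous_on_subset, auto)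
  then show ?thesis by (rule set_integrable_subset) (auto simp: box_subset_cbox)
qed

text \<open>
  Here \<open>s\<close> is the horizontal weak derivative of \<open>f\<close>, and it takes the values \<open>\<plusminus>1\<close>. The last
  integral condition makes its oscillation at most \<open>1\<close>, which is less than the distance of the two
  values; so \<open>s\<close> is almost everywhere a constant \<open>\<sigma>\<close>. Then \<open>f - \<sigma> Re\<close> has vanishing weak gradient,
  and the oscillation bound with \<open>\<epsilon> = 0\<close> shows that it is constant.
\<close>

lemma affine_of_unit_slope:
  assumes f: "continuous_on (rect l r c d) f" "f absolutely_integrable_on rect l r c d"
    and s: "s absolutely_integrable_on rect l r c d" "\<And>w. w \<in> rect l r c d \<Longrightarrow> s w = 1 \<or> s w = -1"
    and i: "\<And>a b. bump l r a \<Longrightarrow> bump c d b \<Longrightarrow>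
      integral (rect l r c d) (\<lambda>w. f w * tensor a (deriv b) w) = 0"
    and ii: "\<And>a b. bump l r a \<Longrightarrow> bump c d b \<Longrightarrow>
      integral (rect l r c d) (\<lambda>w. f w * tensor (deriv a) b w) = - integral (rect l r c d) (\<lambda>w. s w * tensor a b w)"
    and b0: "bump c d b0" "integral UNIV b0 = 1" "\<And>y. 0 \<le> b0 y"
    and iii: "\<And>a M. bump l r a \<Longrightarrow> (\<And>x. \<bar>a x\<bar> \<le> M) \<Longrightarrow>
      \<bar>integral (rect l r c d) (\<lambda>w. s w * tensor (deriv a) b0 w)\<bar> \<le> M"
    and lr: "l < r" "c < d"
  obtains \<sigma> k where "\<sigma> = 1 \<or> \<sigma> = -1" "\<And>w. w \<in> rect l r c d \<Longrightarrow> f w = \<sigma> * Re w + k"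
proof -
  let ?W = "rect l r c d"
  have ne: "open ?W" "?W \<noteq> {}" using lr by (auto simp: box_eq_empty Basis_complex_def)
  have nn: "\<not> negligible ?W" using ne open_not_negligible by blast
  obtain N where N: "negligible N" "\<And>w w'. w \<in> ?W - N \<Longrightarrow> w' \<in> ?W - N \<Longrightarrow> \<bar>s w - s w'\<bar> \<le> 1"
  proof (rule oscillation_bound_ae[OF s(1) _ b0, where \<epsilon> = 1])
    fix a b assume ab: "bump l r a" "bump c d b"
    have "integral ?W (\<lambda>w. s w * tensor a (deriv b) w) = - integral ?W (\<lambda>w. f w * tensor (deriv a) (deriv b) w)"
      using ii[OF ab(1) bump_deriv[OF ab(2)]] by simp
    also have "\<dots> = 0" using i[OF bump_deriv[OF ab(1)] ab(2)] by simp
    finally show "integral ?W (\<lambda>w. s w * tensor a (deriv b) w) = 0" .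
  qed (use iii that in auto)
  have "\<not> ?W \<subseteq> N" using N(1) nn negligible_subset by blast
  then obtain w0 where w0: "w0 \<in> ?W - N" by blast
  define \<sigma> where "\<sigma> = s w0"
  have \<sigma>: "\<sigma> = 1 \<or> \<sigma> = -1" using s(2)[of w0] w0 by (auto simp: \<sigma>_def)
  have s\<sigma>: "s w = \<sigma>" if "w \<in> ?W - N" for w
    using N(2)[OF that w0] s(2)[of w] s(2)[of w0] that w0 by (auto simp: \<sigma>_def)
  define F where "F w = f w - \<sigma> * Re w" for w
  have Reint: "(\<lambda>w. Re w) absolutely_integrable_on ?W" and cint: "(\<lambda>w. 1 :: real) absolutely_integrable_on ?W"
    by (intro absolutely_integrable_rect continuous_intros)+
  have Fint: "F absolutely_integrable_on ?W"
    unfolding F_def[abs_def] by (intro set_integral_diff f(2) set_integrable_mult_right Reint)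
  have Fcont: "continuous_on ?W F" unfolding F_def[abs_def] by (intro continuous_intros f(1))
  \<comment> \<open>to integrate \<open>Re w * a'(Re w)\<close> by parts\<close>
  have xbump: "bump l r (\<lambda>x. x * a x)" "deriv (\<lambda>x. x * a x) = (\<lambda>x. a x + x * deriv a x)" if "bump l r a" for a
  proof -
    have sm: "smooth_real (\<lambda>x. x)"
      by (rule smooth_real_antideriv[OF smooth_real_const[of 1]]) simp
    show "bump l r (\<lambda>x. x * a x)" using that smooth_real_mult[OF sm bump_smooth[OF that]] by (auto simp: bump_def)
    have "((\<lambda>x. x * a x) has_real_derivative a x + x * deriv a x) (at x)" for x
      using smooth_real_derivE(2)[OF bump_smooth[OF that], of x] by (auto intro!: derivative_eq_intros)
    then show "deriv (\<lambda>x. x * a x) = (\<lambda>x. a x + x * deriv a x)" by (auto intro!: DERIV_imp_deriv)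
  qed
  have split: "integral ?W (\<lambda>w. F w * tensor a b w) =
      integral ?W (\<lambda>w. f w * tensor a b w) - \<sigma> * integral ?W (\<lambda>w. Re w * tensor a b w)"
    if "bump l r a" "bump c d b" for a b
  proof -
    have "integral ?W (\<lambda>w. F w * tensor a b w) =
        integral ?W (\<lambda>w. f w * tensor a b w - \<sigma> * (Re w * tensor a b w))"
      by (simp add: F_def algebra_simps)
    also have "\<dots> = integral ?W (\<lambda>w. f w * tensor a b w) - integral ?W (\<lambda>w. \<sigma> * (Re w * tensor a b w))"
      using integrable_mult_tensor[OF f(2) that] integrable_on_cmult_left[OF integrable_mult_tensor[OF Reint that], of \<sigma>]
      by (intro integral_diff) auto
    finally show ?thesis by simp
  qed
  obtain N' where N': "negligible N'" "\<And>w w'. w \<in> ?W - N' \<Longrightarrow> w' \<in> ?W - N' \<Longrightarrow> \<bar>F w - F w'\<bar> \<le> 0"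
  proof (rule oscillation_bound_ae[OF Fint _ b0, where \<epsilon> = 0])
    fix a b assume ab: "bump l r a" "bump c d b"
    have "integral ?W (\<lambda>w. Re w * tensor a (deriv b) w) = integral ?W (tensor (\<lambda>x. x * a x) (deriv b))"
      by (simp add: tensor_def[abs_def] mult.assoc)
    also have "\<dots> = 0" by (rule integral_deriv_tensor(2)[OF xbump(1)[OF ab(1)] ab(2)])
    finally show "integral ?W (\<lambda>w. F w * tensor a (deriv b) w) = 0"
      using split[OF ab(1) bump_deriv[OF ab(2)]] i[OF ab] by simp
  next
    fix a M assume a: "bump l r a"
    have "0 = integral ?W (tensor (\<lambda>x. a x + x * deriv a x) b0)"
      using integral_deriv_tensor(1)[OF xbump(1)[OF a] b0(1)] xbump(2)[OF a] by simp
    also have "\<dots> = integral ?W (\<lambda>w. tensor a b0 w + Re w * tensor (deriv a) b0 w)"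
      by (simp add: tensor_def[abs_def] algebra_simps)
    also have "\<dots> = integral ?W (tensor a b0) + integral ?W (\<lambda>w. Re w * tensor (deriv a) b0 w)"
    proof (rule integral_add)
      show "tensor a b0 integrable_on ?W"
        using integrable_mult_tensor[OF cint a b0(1)] by simp
      show "(\<lambda>w. Re w * tensor (deriv a) b0 w) integrable_on ?W"
        by (rule integrable_mult_tensor[OF Reint bump_deriv[OF a] b0(1)])
    qed
    finally have 1: "integral ?W (\<lambda>w. Re w * tensor (deriv a) b0 w) = - integral ?W (tensor a b0)" by simp
    have "integral ?W (\<lambda>w. s w * tensor a b0 w) = integral ?W (\<lambda>w. \<sigma> * tensor a b0 w)"
      by (rule integral_spike[OF N(1)]) (use s\<sigma> in auto)
    then have "integral ?W (\<lambda>w. f w * tensor (deriv a) b0 w) = - \<sigma> * integral ?W (tensor a b0)"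
      using ii[OF a b0(1)] by simp
    then have "integral ?W (\<lambda>w. F w * tensor (deriv a) b0 w) = 0"
      using split[OF bump_deriv[OF a] b0(1)] 1 by simp
    then show "\<bar>integral ?W (\<lambda>w. F w * tensor (deriv a) b0 w)\<bar> \<le> 0 * M" by simp
  qed (simp, erule that, blast)
  have "\<not> ?W \<subseteq> N'" using N'(1) nn negligible_subset by blast
  then obtain w1 where w1: "w1 \<in> ?W - N'" by blast
  have "open (?W \<inter> F -` (- {F w1}))"
    by (rule continuous_open_preimage[OF Fcont ne(1)]) auto
  moreover have "?W \<inter> F -` (- {F w1}) \<subseteq> N'" using N'(2)[OF _ w1] by auto
  ultimately have "?W \<inter> F -` (- {F w1}) = {}"
    using open_not_negligible negligible_subset[OF N'(1)] by blast
  then have "F w = F w1" if "w \<in> ?W" for w using that by auto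
  then have "f w = \<sigma> * Re w + F w1" if "w \<in> ?W" for w using that by (auto simp: F_def algebra_simps)
  with \<sigma> show ?thesis using that by blast
qed

section \<open>Conformal coordinates for a stationary harmonic function\<close>

lemma absolutely_integrable_compact_support:
  fixes k :: "complex \<Rightarrow> real"
  assumes "continuous_on U k" "compact K" "K \<subseteq> U" "\<And>z. z \<in> U \<Longrightarrow> z \<notin> K \<Longrightarrow> k z = 0"
  shows "k absolutely_integrable_on U"
proof -
  have "integrable lborel (\<lambda>z. indicator K z *\<^sub>R k z)"
    using borel_integrable_compact[OF assms(2) continuous_on_subset[OF assms(1,3)]] .
  then have "integrable lebesgue (\<lambda>z. indicator K z *\<^sub>R k z)" by (subst integrable_completion) auto
  moreover have "(\<lambda>z. indicator K z *\<^sub>R k z) = (\<lambda>z. indicator U z *\<^sub>R k z)"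
    using assms(3,4) by (auto simp: fun_eq_iff indicator_def)
  ultimately show ?thesis by (simp add: set_integrable_def)
qed

lemma LINT_lebesgue_on_zero_outside:
  fixes k :: "complex \<Rightarrow> real"
  assumes "open U" "open \<Omega>" "U \<subseteq> \<Omega>" "k absolutely_integrable_on U"
    and "\<And>z. z \<in> U \<Longrightarrow> f z = k z" "\<And>z. z \<in> \<Omega> \<Longrightarrow> z \<notin> U \<Longrightarrow> f z = 0"
  shows "(LINT z|lebesgue_on \<Omega>. f z) = integral U k"
proof -
  have "(LINT z|lebesgue_on \<Omega>. f z) = (LINT z|lebesgue. indicator \<Omega> z *\<^sub>R f z)"
    by (rule integral_restrict_space) (use open_sets_lebesgue[OF assms(2)] in auto)
  also have "\<dots> = (LINT z|lebesgue. indicator U z *\<^sub>R k z)"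
    by (rule arg_cong[of _ _ "integral\<^sup>L lebesgue"]) (use assms in \<open>auto simp: fun_eq_iff indicator_def\<close>)
  also have "\<dots> = integral U k"
    using set_lebesgue_integral_eq_integral(2)[OF assms(4)] by (simp add: set_lebesgue_integral_def)
  finally show ?thesis .
qed

definition extend :: "complex set \<Rightarrow> (complex \<Rightarrow> real) \<Rightarrow> complex \<Rightarrow> real" where
  "extend U f z = (if z \<in> U then f z else 0)"

lemma partial_extend:
  assumes "open U" "z \<in> U" "(f has_derivative D) (at z)"
  shows "partial e (extend U f) z = D e"
  by (rule partial_eq, rule has_derivative_transform_within_open[OF assms(3,1,2)]) (simp add: extend_def)

lemma partial_cong_open:
  assumes "open U" "z \<in> U" "\<And>w. w \<in> U \<Longrightarrow> f w = g w"
  shows "partial e f z = partial e g z"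
  unfolding partial_def frechet_derivative_def
  using has_derivative_transform_within_open[of f _ z UNIV U g]
    has_derivative_transform_within_open[of g _ z UNIV U f] assms by metis

locale stationary_harmonic_function =
  fixes \<Omega> :: "complex set" and \<mu> :: signed_measure and h :: "complex \<Rightarrow> real" and \<omega> :: "complex \<Rightarrow> complex"
  assumes open_Omega: "open \<Omega>"
    and radon: "radon_measure \<Omega> \<mu>"
    and stationary: "stationary_harmonic \<Omega> h"
    and h_continuous: "continuous_on \<Omega> h"
    and Laplacian: "distributional_laplacian \<Omega> h \<mu>"
    and omega_eq: "AE z in lebesgue_on \<Omega>. \<omega> z = omega \<Omega> h z"
begin

abbreviation "p \<equiv> weak_partial \<Omega> 1 h"
abbreviation "q \<equiv> weak_partial \<Omega> \<i> h"

lemma weak_partials: "has_weak_partial \<Omega> 1 h p" "has_weak_partial \<Omega> \<i> h q"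
proof -
  have "h \<in> H1 \<Omega>" using stationary by (simp add: stationary_harmonic_def)
  then show "has_weak_partial \<Omega> 1 h p" "has_weak_partial \<Omega> \<i> h q"
    unfolding weak_partial_def H1_def using someI_ex by (metis (mono_tags, lifting) mem_Collect_eq)+
qed

text \<open>
  With \<open>p - \<i>q\<close> for the gradient of \<open>h\<close> and \<open>G'\<close> for the gradient of \<open>Re G\<close>, this is the sign
  \<open>s\<close> in \<open>\<nabla>h = s \<nabla>(Re G)\<close>.
\<close>

definition slope_sign :: "(complex \<Rightarrow> complex) \<Rightarrow> complex \<Rightarrow> real" where
  "slope_sign G z = (if of_real (p z) - \<i> * of_real (q z) = deriv G z then 1 else -1)"

text \<open>
  A conformal coordinate \<open>G = u + \<i>v\<close> with values in a rectangle, in which the gradient of \<open>h\<close> is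
  \<open>(\<plusminus>1, 0)\<close>.
\<close>

definition chart :: "complex set \<Rightarrow> (complex \<Rightarrow> complex) \<Rightarrow> real \<Rightarrow> real \<Rightarrow> real \<Rightarrow> real \<Rightarrow> bool" where
  "chart U G l r c d \<longleftrightarrow> open U \<and> U \<subseteq> \<Omega> \<and> bounded (h ` U) \<and> G holomorphic_on U \<and> inj_on G U \<and>
     G ` U = rect l r c d \<and> (\<forall>z\<in>U. (deriv G z)\<^sup>2 = \<omega> z)"

context
  fixes U G l r c d
  assumes chart: "chart U G l r c d"
begin

lemma chartD: "open U" "U \<subseteq> \<Omega>" "bounded (h ` U)" "G holomorphic_on U" "inj_on G U"
    "G ` U = rect l r c d" "\<And>z. z \<in> U \<Longrightarrow> (deriv G z)\<^sup>2 = \<omega> z"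
  using chart by (auto simp: chart_def)

lemma chart_deriv_holomorphic: "deriv G holomorphic_on U"
  using chartD(4,1) by (rule holomorphic_deriv)

lemma chart_tensor_support:
  assumes "bump l r a" "bump c d b"
  obtains K where "compact K" "K \<subseteq> U" "\<And>z. z \<in> U \<Longrightarrow> z \<notin> K \<Longrightarrow> tensor a b (G z) = 0"
proof -
  obtain K where K: "compact K" "K \<subseteq> rect l r c d" "\<And>w. w \<notin> K \<Longrightarrow> tensor a b w = 0"
    using tensor_support[OF assms] by blast
  obtain \<psi> where \<psi>: "\<psi> holomorphic_on (G ` U)" "\<And>z. z \<in> U \<Longrightarrow> \<psi> (G z) = z"
    using holomorphic_has_inverse[OF chartD(4,1,5)] by metis
  show ?thesis
  proof (rule that[of "\<psi> ` K"])
    have "continuous_on K \<psi>"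
      using holomorphic_on_imp_continuous_on[OF \<psi>(1)] K(2) chartD(6) continuous_on_subset by blast
    then show "compact (\<psi> ` K)" using K(1) by (rule compact_continuous_image)
    show "\<psi> ` K \<subseteq> U" using K(2) \<psi>(2) chartD(6) by force
    show "tensor a b (G z) = 0" if "z \<in> U" "z \<notin> \<psi> ` K" for z
      using that \<psi>(2)[of z] K(3)[of "G z"] by (metis image_eqI)
  qed
qed

lemma slope_sign_values: "slope_sign G z = 1 \<or> slope_sign G z = -1"
  by (simp add: slope_sign_def)

lemma slope_sign_bounded: "bounded (slope_sign G ` S)"
  by (rule boundedI[of _ 1]) (auto simp: slope_sign_def)

lemma slope_sign_measurable: "slope_sign G \<in> borel_measurable (lebesgue_on U)"
proof -
  have "p \<in> borel_measurable (lebesgue_on \<Omega>)" "q \<in> borel_measurable (lebesgue_on \<Omega>)"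
    using weak_partials by (auto simp: has_weak_partial_def L2_def)
  then have [measurable]: "p \<in> borel_measurable (lebesgue_on U)" "q \<in> borel_measurable (lebesgue_on U)"
    using chartD(2) measurable_restrict_mono by blast+
  have [measurable]: "deriv G \<in> borel_measurable (lebesgue_on U)"
    by (rule continuous_imp_measurable_on_sets_lebesgue
        [OF holomorphic_on_imp_continuous_on[OF chart_deriv_holomorphic] open_sets_lebesgue[OF chartD(1)]])
  show ?thesis unfolding slope_sign_def[abs_def] by measurable
qed

lemma slope_sign_AE:
  "AE z in lebesgue_on U. p z = slope_sign G z * Re (deriv G z) \<and> q z = - slope_sign G z * Im (deriv G z)"
proof -
  have "AE z in lebesgue_on U. \<omega> z = omega \<Omega> h z"
  proof -
    have "AE z in lebesgue. z \<in> \<Omega> \<longrightarrow> \<omega> z = omega \<Omega> h z"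
      using omega_eq by (subst (asm) AE_restrict_space_iff) (use open_sets_lebesgue[OF open_Omega] in auto)
    then have "AE z in lebesgue. z \<in> U \<longrightarrow> \<omega> z = omega \<Omega> h z"
      by eventually_elim (use chartD(2) in auto)
    then show ?thesis by (subst AE_restrict_space_iff) (use open_sets_lebesgue[OF chartD(1)] in auto)
  qed
  moreover have "AE z in lebesgue_on U. z \<in> U" by (rule AE_I2) simp
  ultimately show ?thesis
  proof eventually_elim
    case (elim z)
    let ?D = "of_real (p z) - \<i> * of_real (q z) :: complex"
    have "?D\<^sup>2 = (deriv G z)\<^sup>2" using elim chartD(7)[of z] by (simp add: omega_def)
    then have "?D = deriv G z \<or> ?D = - deriv G z" by (simp add: power2_eq_iff)
    then show ?case
    proof
      assume "?D = deriv G z"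
      then show ?thesis by (simp add: slope_sign_def complex_eq_iff)
    next
      assume *: "?D = - deriv G z"
      show ?thesis
      proof (cases "deriv G z = 0")
        case True then show ?thesis using * by (simp add: complex_eq_iff)
      next
        case False
        then have "?D \<noteq> deriv G z" using * by auto
        then have "slope_sign G z = -1" by (simp add: slope_sign_def)
        then show ?thesis using * by (simp add: complex_eq_iff)
      qed
    qed
  qed
qed

text \<open>The two partial derivatives of \<open>tensor a b \<circ> G\<close>.\<close>

abbreviation "dx a b z \<equiv> tensor (deriv a) b (G z) * Re (deriv G z) + tensor a (deriv b) (G z) * Im (deriv G z)"
abbreviation "dy a b z \<equiv> - tensor (deriv a) b (G z) * Im (deriv G z) + tensor a (deriv b) (G z) * Re (deriv G z)"

text \<open>
  The relation \<open>\<nabla>h = s \<nabla>(Re G)\<close> is tested against the vector field with components \<open>Re \<kappa>\<close> and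
  \<open>- Im \<kappa>\<close>, multiplied by the test function \<open>tensor a b \<circ> G\<close>. The field is divergence free by the
  Cauchy--Riemann equations for \<open>\<kappa>\<close>, so only the test function gets differentiated. The choice
  \<open>\<kappa> = G'\<close> gives the field \<open>\<nabla>(Re G)\<close>, and \<open>\<kappa> = - \<i> G'\<close> gives the field \<open>\<nabla>(Im G)\<close>, which is
  tangent to the level lines of \<open>Re G\<close>.
\<close>

lemma chart_weak_identity:
  assumes a: "bump l r a" and b: "bump c d b" and \<kappa>: "\<kappa> holomorphic_on U"
  shows "integral U (\<lambda>z. h z *
      (Re (\<kappa> z) * dx a b z
       - Im (\<kappa> z) * dy a b z))
    = - integral U (\<lambda>z. slope_sign G z *
      ((Re (deriv G z) * Re (\<kappa> z) + Im (deriv G z) * Im (\<kappa> z)) * tensor a b (G z)))"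
proof -
  note U = chartD(1) and G = chartD(4)
  have sm: "smooth_real a" "smooth_real b" using a b bump_smooth by auto
  obtain K where K: "compact K" "K \<subseteq> U" "\<And>z. z \<in> U \<Longrightarrow> z \<notin> K \<Longrightarrow> tensor a b (G z) = 0"
    using chart_tensor_support[OF a b] by blast
  have cont: "continuous_on U \<kappa>" "continuous_on U (deriv G)" "continuous_on U h" "continuous_on U G"
    using \<kappa> G chart_deriv_holomorphic h_continuous chartD(2)
    by (auto intro: holomorphic_on_imp_continuous_on continuous_on_subset)
  have cT: "continuous_on U (\<lambda>z. tensor a b (G z))"
    using Ck_on_tensor[OF sm G U, of 0] by simp
  \<comment> \<open>the contribution of one of the two weak partial derivatives\<close>
  have one: "(\<lambda>z. h z * partial e (extend U f) z) absolutely_integrable_on U \<and>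
      (\<lambda>z. slope_sign G z * (P z * f z)) absolutely_integrable_on U \<and>
      integral U (\<lambda>z. h z * partial e (extend U f) z) = - integral U (\<lambda>z. slope_sign G z * (P z * f z))"
    if e: "e = 1 \<or> e = \<i>" and W: "has_weak_partial \<Omega> e h Q"
      and Q: "AE z in lebesgue_on U. Q z = slope_sign G z * P z" and P: "continuous_on U P"
      and f: "\<And>k. Ck_on k U f" "\<And>z. z \<in> U \<Longrightarrow> z \<notin> K \<Longrightarrow> f z = 0" for e Q P f
  proof -
    have T: "extend U f \<in> test_functions \<Omega>"
      unfolding extend_def[abs_def] by (rule test_function_extend[OF U chartD(2) f(1) K(1,2) f(2)])
    have TU: "extend U f \<in> test_functions U"
      unfolding extend_def[abs_def] by (rule test_function_extend[OF U _ f(1) K(1,2) f(2)]) auto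
    have TU': "partial e (extend U f) \<in> test_functions U" by (rule test_function_partial[OF TU e])
    have k: "continuous_on U (partial e (extend U f))" using test_function_continuous[OF TU'] .
    have i1: "(\<lambda>z. h z * partial e (extend U f) z) absolutely_integrable_on U"
    proof (rule absolutely_integrable_compact_support)
      show "continuous_on U (\<lambda>z. h z * partial e (extend U f) z)" by (intro continuous_intros cont k)
      show "compact (closure {z. partial e (extend U f) z \<noteq> 0})"
        "closure {z. partial e (extend U f) z \<noteq> 0} \<subseteq> U"
        using TU' by (auto simp: test_functions_def)
      show "h z * partial e (extend U f) z = 0" if "z \<notin> closure {z. partial e (extend U f) z \<noteq> 0}" for z
        using that closure_subset[of "{z. partial e (extend U f) z \<noteq> 0}"] by auto
    qed
    have "(\<lambda>z. P z * f z) absolutely_integrable_on U"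
      by (rule absolutely_integrable_compact_support[OF _ K(1,2)])
        (use f(1)[of 0] f(2) P in \<open>auto intro!: continuous_intros\<close>)
    moreover have "bounded (slope_sign G ` U)" by (rule slope_sign_bounded)
    ultimately have i2: "(\<lambda>z. slope_sign G z * (P z * f z)) absolutely_integrable_on U"
      by (intro absolutely_integrable_bounded_measurable_product[OF bilinear_times slope_sign_measurable
            open_sets_lebesgue[OF U]])
    have "(LINT z|lebesgue_on \<Omega>. h z * partial e (extend U f) z) = - (LINT z|lebesgue_on \<Omega>. Q z * extend U f z)"
      using W T by (auto simp: has_weak_partial_def)
    moreover have "(LINT z|lebesgue_on \<Omega>. h z * partial e (extend U f) z)
        = integral U (\<lambda>z. h z * partial e (extend U f) z)"
      by (rule LINT_lebesgue_on_zero_outside[OF U open_Omega chartD(2) i1])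
        (use test_function_zero_outside[OF TU'] in auto)
    moreover have "(LINT z|lebesgue_on \<Omega>. Q z * extend U f z) = integral U (\<lambda>z. slope_sign G z * (P z * f z))"
    proof -
      have "(LINT z|lebesgue_on \<Omega>. Q z * extend U f z) = (LINT z|lebesgue_on \<Omega>. extend U (\<lambda>z. slope_sign G z * (P z * f z)) z)"
      proof (rule integral_cong_AE)
        have Qm: "Q \<in> borel_measurable (lebesgue_on \<Omega>)" using W by (auto simp: has_weak_partial_def L2_def)
        have "extend U f \<in> borel_measurable (lebesgue_on \<Omega>)"
          by (rule continuous_imp_measurable_on_sets_lebesgue[OF test_function_continuous[OF T] open_sets_lebesgue[OF open_Omega]])
        with Qm show "(\<lambda>z. Q z * extend U f z) \<in> borel_measurable (lebesgue_on \<Omega>)" by measurable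
        have "(\<lambda>z. indicator U z *\<^sub>R (slope_sign G z * (P z * f z))) \<in> borel_measurable lebesgue"
          using i2 unfolding set_integrable_def by (rule borel_measurable_integrable)
        moreover have "(\<lambda>z. indicator U z *\<^sub>R (slope_sign G z * (P z * f z))) = extend U (\<lambda>z. slope_sign G z * (P z * f z))"
          by (auto simp: extend_def fun_eq_iff)
        ultimately show "extend U (\<lambda>z. slope_sign G z * (P z * f z)) \<in> borel_measurable (lebesgue_on \<Omega>)"
          by (simp add: measurable_restrict_space1)
        have "AE z in lebesgue. z \<in> U \<longrightarrow> Q z = slope_sign G z * P z"
          using Q by (subst (asm) AE_restrict_space_iff) (use open_sets_lebesgue[OF U] in auto)
        then have "AE z in lebesgue. z \<in> \<Omega> \<longrightarrow> Q z * extend U f z = extend U (\<lambda>z. slope_sign G z * (P z * f z)) z"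
          by eventually_elim (auto simp: extend_def)
        then show "AE z in lebesgue_on \<Omega>. Q z * extend U f z = extend U (\<lambda>z. slope_sign G z * (P z * f z)) z"
          by (subst AE_restrict_space_iff) (use open_sets_lebesgue[OF open_Omega] in auto)
      qed
      also have "\<dots> = integral U (\<lambda>z. slope_sign G z * (P z * f z))"
        by (rule LINT_lebesgue_on_zero_outside[OF U open_Omega chartD(2) i2]) (auto simp: extend_def)
      finally show ?thesis .
    qed
    ultimately show ?thesis using i1 i2 by simp
  qed
  let ?f1 = "\<lambda>z. Re (\<kappa> z) * tensor a b (G z)" and ?f2 = "\<lambda>z. Im (\<kappa> z) * tensor a b (G z)"
  have f: "Ck_on k U ?f1" "Ck_on k U ?f2" for k
    using Ck_on_mult[OF U _ Ck_on_tensor[OF sm G U]] Ck_on_Re_Im_holomorphic[OF U \<kappa>] by blast+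
  have AE1: "AE z in lebesgue_on U. p z = slope_sign G z * Re (deriv G z)"
    and AE2: "AE z in lebesgue_on U. q z = slope_sign G z * (- Im (deriv G z))"
    using slope_sign_AE by auto
  have P: "continuous_on U (\<lambda>z. Re (deriv G z))" "continuous_on U (\<lambda>z. - Im (deriv G z))"
    by (intro continuous_intros cont)+
  note o1 = one[OF _ weak_partials(1) AE1 P(1) f(1)] and o2 = one[OF _ weak_partials(2) AE2 P(2) f(2)]
  have o1: "(\<lambda>z. h z * partial 1 (extend U ?f1) z) absolutely_integrable_on U"
    "(\<lambda>z. slope_sign G z * (Re (deriv G z) * ?f1 z)) absolutely_integrable_on U"
    "integral U (\<lambda>z. h z * partial 1 (extend U ?f1) z) = - integral U (\<lambda>z. slope_sign G z * (Re (deriv G z) * ?f1 z))"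
    using o1 K(3) by auto
  have o2: "(\<lambda>z. h z * partial \<i> (extend U ?f2) z) absolutely_integrable_on U"
    "(\<lambda>z. slope_sign G z * (- Im (deriv G z) * ?f2 z)) absolutely_integrable_on U"
    "integral U (\<lambda>z. h z * partial \<i> (extend U ?f2) z) = - integral U (\<lambda>z. slope_sign G z * (- Im (deriv G z) * ?f2 z))"
    using o2 K(3) by auto
  have "integral U (\<lambda>z. h z * partial 1 (extend U ?f1) z - h z * partial \<i> (extend U ?f2) z)
      = - integral U (\<lambda>z. slope_sign G z * (Re (deriv G z) * ?f1 z) - slope_sign G z * (- Im (deriv G z) * ?f2 z))"
    using o1 o2 by (subst (1 2) integral_diff) (auto simp: absolutely_integrable_on_def)
  moreover have "integral U (\<lambda>z. h z * partial 1 (extend U ?f1) z - h z * partial \<i> (extend U ?f2) z) =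
     integral U (\<lambda>z. h z *
      (Re (\<kappa> z) * dx a b z
       - Im (\<kappa> z) * dy a b z))"
  proof (rule integral_cong)
    fix z assume z: "z \<in> U"
    note DT = tensor_has_derivative[OF sm G U z] and DK = has_derivative_Re_Im_holomorphic[OF \<kappa> U z]
    show "h z * partial 1 (extend U ?f1) z - h z * partial \<i> (extend U ?f2) z = h z *
      (Re (\<kappa> z) * dx a b z
       - Im (\<kappa> z) * dy a b z)"
      unfolding partial_extend[OF U z has_derivative_mult[OF DK(1) DT]]
        partial_extend[OF U z has_derivative_mult[OF DK(2) DT]]
      by (simp add: algebra_simps)
  qed
  moreover have "integral U (\<lambda>z. slope_sign G z * (Re (deriv G z) * ?f1 z) - slope_sign G z * (- Im (deriv G z) * ?f2 z))
     = integral U (\<lambda>z. slope_sign G z *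
      ((Re (deriv G z) * Re (\<kappa> z) + Im (deriv G z) * Im (\<kappa> z)) * tensor a b (G z)))"
    by (rule integral_cong) (simp add: algebra_simps)
  ultimately show ?thesis by simp
qed

definition chart_value :: "complex \<Rightarrow> real" where "chart_value w = h (the_inv_into U G w)"
definition chart_slope :: "complex \<Rightarrow> real" where "chart_slope w = slope_sign G (the_inv_into U G w)"

lemma chart_value_G: "z \<in> U \<Longrightarrow> chart_value (G z) = h z"
  and chart_slope_G: "z \<in> U \<Longrightarrow> chart_slope (G z) = slope_sign G z"
  by (simp_all add: chart_value_def chart_slope_def the_inv_into_f_f[OF chartD(5)])

lemma chart_value_continuous: "continuous_on (rect l r c d) chart_value"
proof -
  obtain \<psi> where \<psi>: "\<psi> holomorphic_on (G ` U)" "\<And>z. z \<in> U \<Longrightarrow> \<psi> (G z) = z"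
    using holomorphic_has_inverse[OF chartD(4,1,5)] by metis
  have "continuous_on (rect l r c d) (\<lambda>w. h (\<psi> w))"
  proof (rule continuous_on_compose2[OF h_continuous])
    show "continuous_on (rect l r c d) \<psi>"
      using holomorphic_on_imp_continuous_on[OF \<psi>(1)] chartD(6) by simp
    show "\<psi> ` rect l r c d \<subseteq> \<Omega>" using \<psi>(2) chartD(2,6) by force
  qed
  moreover have "h (\<psi> w) = chart_value w" if "w \<in> rect l r c d" for w
    using that \<psi>(2) chart_value_G unfolding chartD(6)[symmetric] by auto
  ultimately show ?thesis by (simp cong: continuous_on_cong_simp)
qed

lemma chart_value_absolutely_integrable: "chart_value absolutely_integrable_on rect l r c d"
proof -
  have "chart_value ` rect l r c d \<subseteq> h ` U"
    using chart_value_G unfolding chartD(6)[symmetric] by auto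
  then have "bounded (chart_value ` rect l r c d)" using chartD(3) bounded_subset by blast
  from absolutely_integrable_mult_bounded_continuous[OF absolutely_integrable_rect[OF continuous_on_const[of _ "1::real"]] _ chart_value_continuous this]
  show ?thesis by simp
qed

lemma chart_slope_absolutely_integrable: "chart_slope absolutely_integrable_on rect l r c d"
proof -
  have "(\<lambda>z. (norm (deriv G z))\<^sup>2 * 1) absolutely_integrable_on U"
    using holomorphic_change_of_variables(1)[OF chartD(1,4,5), of "\<lambda>_. 1"] absolutely_integrable_rect[OF continuous_on_const[of _ "1::real"]]
    unfolding chartD(6) by blast
  then have "(\<lambda>z. slope_sign G z * ((norm (deriv G z))\<^sup>2 * 1)) absolutely_integrable_on U"
    by (intro absolutely_integrable_bounded_measurable_product[OF bilinear_times slope_sign_measurable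
            open_sets_lebesgue[OF chartD(1)] slope_sign_bounded])
  then have "(\<lambda>z. (norm (deriv G z))\<^sup>2 * chart_slope (G z)) absolutely_integrable_on U"
    by (rule set_integrable_cong[THEN iffD1, rotated -1]) (auto simp: chart_slope_G)
  then show ?thesis using holomorphic_change_of_variables(1)[OF chartD(1,4,5)] unfolding chartD(6) by blast
qed

lemma chart_integral:
  assumes "F absolutely_integrable_on rect l r c d" "\<And>z. z \<in> U \<Longrightarrow> k z = (norm (deriv G z))\<^sup>2 * F (G z)"
  shows "integral U k = integral (rect l r c d) F" "k absolutely_integrable_on U"
proof -
  have "integral U k = integral U (\<lambda>z. (norm (deriv G z))\<^sup>2 * F (G z))"
    by (rule integral_cong) (rule assms(2))
  then show "integral U k = integral (rect l r c d) F"
    using holomorphic_change_of_variables(2)[OF chartD(1,4,5), of F] assms(1) unfolding chartD(6) by simp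
  have "(\<lambda>z. (norm (deriv G z))\<^sup>2 * F (G z)) absolutely_integrable_on U"
    using holomorphic_change_of_variables(1)[OF chartD(1,4,5)] assms(1) unfolding chartD(6) by blast
  then show "k absolutely_integrable_on U"
    by (rule set_integrable_cong[THEN iffD1, rotated -1]) (auto simp: assms(2))
qed

lemma chart_vertical:
  assumes a: "bump l r a" and b: "bump c d b"
  shows "integral (rect l r c d) (\<lambda>w. chart_value w * tensor a (deriv b) w) = 0"
proof -
  \<comment> \<open>for this choice the integrand with the sign of the slope vanishes identically\<close>
  let ?\<kappa> = "\<lambda>z. - \<i> * deriv G z"
  have "?\<kappa> holomorphic_on U" by (intro holomorphic_intros chart_deriv_holomorphic)
  note W = chart_weak_identity[OF a b this]
  have "integral U (\<lambda>z. h z *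
      (Re (?\<kappa> z) * dx a b z
       - Im (?\<kappa> z) * dy a b z))
     = integral (rect l r c d) (\<lambda>w. chart_value w * tensor a (deriv b) w)"
    by (rule chart_integral(1)[OF absolutely_integrable_mult_tensor[OF chart_value_absolutely_integrable a bump_deriv[OF b]]])
      (simp add: chart_value_G cmod_power2, simp add: algebra_simps power2_eq_square)
  moreover have "integral U (\<lambda>z. slope_sign G z *
      ((Re (deriv G z) * Re (?\<kappa> z) + Im (deriv G z) * Im (?\<kappa> z)) * tensor a b (G z))) = 0"
    by (rule integral_eq_zeroI) simp
  ultimately show ?thesis using W by simp
qed

lemma chart_horizontal:
  assumes a: "bump l r a" and b: "bump c d b"
  shows "integral (rect l r c d) (\<lambda>w. chart_value w * tensor (deriv a) b w)
    = - integral (rect l r c d) (\<lambda>w. chart_slope w * tensor a b w)"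
proof -
  note W = chart_weak_identity[OF a b chart_deriv_holomorphic]
  have "integral U (\<lambda>z. h z *
      (Re (deriv G z) * dx a b z
       - Im (deriv G z) * dy a b z))
     = integral (rect l r c d) (\<lambda>w. chart_value w * tensor (deriv a) b w)"
    by (rule chart_integral(1)[OF absolutely_integrable_mult_tensor[OF chart_value_absolutely_integrable bump_deriv[OF a] b]])
      (simp add: chart_value_G cmod_power2, simp add: algebra_simps power2_eq_square)
  moreover have "integral U (\<lambda>z. slope_sign G z *
      ((Re (deriv G z) * Re (deriv G z) + Im (deriv G z) * Im (deriv G z)) * tensor a b (G z)))
     = integral (rect l r c d) (\<lambda>w. chart_slope w * tensor a b w)"
    by (rule chart_integral(1)[OF absolutely_integrable_mult_tensor[OF chart_slope_absolutely_integrable a b]])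
      (simp add: chart_slope_G cmod_power2, simp add: power2_eq_square)
  ultimately show ?thesis using W by simp
qed

lemma chart_test_function:
  assumes a: "bump l r a" and b: "bump c d b"
  shows "extend U (\<lambda>z. tensor a b (G z)) \<in> test_functions U"
proof -
  obtain K where K: "compact K" "K \<subseteq> U" "\<And>z. z \<in> U \<Longrightarrow> z \<notin> K \<Longrightarrow> tensor a b (G z) = 0"
    using chart_tensor_support[OF a b] by blast
  show ?thesis unfolding extend_def[abs_def]
    by (rule test_function_extend[OF chartD(1) order_refl Ck_on_tensor[OF bump_smooth[OF a] bump_smooth[OF b] chartD(4,1)] K])
qed

text \<open>
  Conformal invariance of the Laplacian.
\<close>

lemma chart_laplacian:
  assumes a: "bump l r a" and b: "bump c d b" and z: "z \<in> U"
  shows "laplacian (extend U (\<lambda>z. tensor a b (G z))) z =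
    (norm (deriv G z))\<^sup>2 * (tensor (deriv (deriv a)) b (G z) + tensor a (deriv (deriv b)) (G z))"
proof -
  note U = chartD(1) and G = chartD(4)
  have sm: "smooth_real a" "smooth_real b" "smooth_real (deriv a)" "smooth_real (deriv b)"
    using a b bump_smooth smooth_real_derivE(1) by auto
  let ?\<phi> = "extend U (\<lambda>z. tensor a b (G z))"
  have 1: "partial 1 ?\<phi> z = tensor (deriv a) b (G z) * Re (deriv G z) + tensor a (deriv b) (G z) * Im (deriv G z)"
    and 2: "partial \<i> ?\<phi> z = tensor a (deriv b) (G z) * Re (deriv G z) - tensor (deriv a) b (G z) * Im (deriv G z)"
    if "z \<in> U" for z
    using partial_extend[OF U that tensor_has_derivative[OF sm(1,2) G U that]] by auto
  note D10 = tensor_has_derivative[OF sm(3,2) G U z] and D01 = tensor_has_derivative[OF sm(1,4) G U z]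
  note DG = has_derivative_Re_Im_holomorphic[OF chart_deriv_holomorphic U z]
  note D1 = has_derivative_add[OF has_derivative_mult[OF D10 DG(1)] has_derivative_mult[OF D01 DG(2)]]
  note D2 = has_derivative_diff[OF has_derivative_mult[OF D01 DG(1)] has_derivative_mult[OF D10 DG(2)]]
  have "partial 1 (partial 1 ?\<phi>) z =
      partial 1 (\<lambda>z. tensor (deriv a) b (G z) * Re (deriv G z) + tensor a (deriv b) (G z) * Im (deriv G z)) z"
    by (rule partial_cong_open[OF U z 1])
  moreover have "partial \<i> (partial \<i> ?\<phi>) z =
      partial \<i> (\<lambda>z. tensor a (deriv b) (G z) * Re (deriv G z) - tensor (deriv a) b (G z) * Im (deriv G z)) z"
    by (rule partial_cong_open[OF U z 2])
  ultimately show ?thesis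
    unfolding laplacian_def partial_eq[OF D1] partial_eq[OF D2] cmod_power2
    by (simp add: algebra_simps power2_eq_square)
qed

text \<open>
  In the chart, \<open>\<Delta>h = \<mu>\<close> says that \<open>\<mu>\<close> is the horizontal derivative of the slope, since
  \<open>h\<close> does not vary in the vertical direction.
\<close>

lemma chart_measure:
  assumes a: "bump l r a" and b: "bump c d b"
  shows "integral (rect l r c d) (\<lambda>w. chart_slope w * tensor (deriv a) b w)
    = - signed_integral \<mu> (extend U (\<lambda>z. tensor a b (G z)))"
proof -
  let ?\<phi> = "extend U (\<lambda>z. tensor a b (G z))"
  note T = chart_test_function[OF a b]
  define F where "F w = chart_value w * tensor (deriv (deriv a)) b w + chart_value w * tensor a (deriv (deriv b)) w" for w
  note i1 = absolutely_integrable_mult_tensor[OF chart_value_absolutely_integrable bump_deriv[OF bump_deriv[OF a]] b]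
  note i2 = absolutely_integrable_mult_tensor[OF chart_value_absolutely_integrable a bump_deriv[OF bump_deriv[OF b]]]
  have F: "F absolutely_integrable_on rect l r c d"
    unfolding F_def[abs_def] by (rule set_integral_add(1)[OF i1 i2])
  have L: "h z * laplacian ?\<phi> z = (norm (deriv G z))\<^sup>2 * F (G z)" if "z \<in> U" for z
    using chart_laplacian[OF a b that] that by (simp add: F_def chart_value_G algebra_simps)
  have "signed_integral \<mu> ?\<phi> = (LINT z|lebesgue_on \<Omega>. h z * laplacian ?\<phi> z)"
    using Laplacian test_functions_mono[OF T chartD(2)] by (simp add: distributional_laplacian_def)
  also have "\<dots> = integral U (\<lambda>z. h z * laplacian ?\<phi> z)"
  proof (rule LINT_lebesgue_on_zero_outside[OF chartD(1) open_Omega chartD(2) chart_integral(2)[OF F L] refl])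
    fix z assume "z \<notin> U"
    then have "partial e (partial e ?\<phi>) z = 0" if "e = 1 \<or> e = \<i>" for e
      using test_function_zero_outside[OF test_function_partial[OF test_function_partial[OF T that] that]] by blast
    then show "h z * laplacian ?\<phi> z = 0" by (simp add: laplacian_def)
  qed
  also have "\<dots> = integral (rect l r c d) F" by (rule chart_integral(1)[OF F L])
  also have "\<dots> = integral (rect l r c d) (\<lambda>w. chart_value w * tensor (deriv (deriv a)) b w)
      + integral (rect l r c d) (\<lambda>w. chart_value w * tensor a (deriv (deriv b)) w)"
    unfolding F_def[abs_def] by (rule integral_add) (use i1 i2 in \<open>auto simp: absolutely_integrable_on_def\<close>)
  also have "\<dots> = - integral (rect l r c d) (\<lambda>w. chart_slope w * tensor (deriv a) b w)"
    using chart_horizontal[OF bump_deriv[OF a] b] chart_vertical[OF a bump_deriv[OF b]] by simp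
  finally show ?thesis by simp
qed

lemma chart_affine:
  assumes b0: "bump c d b0" "integral UNIV b0 = 1" "\<And>y. 0 \<le> b0 y"
    and small: "\<And>a M. bump l r a \<Longrightarrow> (\<And>x. \<bar>a x\<bar> \<le> M) \<Longrightarrow>
      \<bar>signed_integral \<mu> (extend U (\<lambda>z. tensor a b0 (G z)))\<bar> \<le> M"
    and lr: "l < r" "c < d"
  obtains \<sigma> k where "\<sigma> = 1 \<or> \<sigma> = -1" "\<And>z. z \<in> U \<Longrightarrow> h z = \<sigma> * Re (G z) + k"
proof -
  obtain \<sigma> k where s: "\<sigma> = 1 \<or> \<sigma> = -1" "\<And>w. w \<in> rect l r c d \<Longrightarrow> chart_value w = \<sigma> * Re w + k"
  proof (rule affine_of_unit_slope[OF chart_value_continuous chart_value_absolutely_integrable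
        chart_slope_absolutely_integrable _ chart_vertical chart_horizontal b0 _ lr])
    show "chart_slope w = 1 \<or> chart_slope w = -1" for w
      unfolding chart_slope_def by (rule slope_sign_values)
    show "\<bar>integral (rect l r c d) (\<lambda>w. chart_slope w * tensor (deriv a) b0 w)\<bar> \<le> M"
      if "bump l r a" "\<And>x. \<bar>a x\<bar> \<le> M" for a M
      using small[OF that] chart_measure[OF that(1) b0(1)] by simp
  qed (assumption+, erule that, blast)
  show ?thesis
  proof (rule that[OF s(1)])
    fix z assume "z \<in> U"
    then show "h z = \<sigma> * Re (G z) + k" using s(2)[of "G z"] chartD(6) chart_value_G by force
  qed
qed

end

end

section \<open>Sign changes and the mass of the measure\<close>

lemma integral_abs_le_measure:
  fixes \<phi> :: "'a \<Rightarrow> real"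
  assumes "T \<in> sets M" "emeasure M T < \<infinity>" "0 \<le> C" "\<And>z. \<bar>\<phi> z\<bar> \<le> C" "\<And>z. z \<notin> T \<Longrightarrow> \<phi> z = 0"
  shows "\<bar>integral\<^sup>L M \<phi>\<bar> \<le> C * measure M T"
proof (cases "integrable M \<phi>")
  case True
  have i: "integrable M (\<lambda>z. C * indicator T z)"
    by (intro integrable_mult_right integrable_real_indicator assms)
  have "\<bar>integral\<^sup>L M \<phi>\<bar> \<le> (LINT z|M. \<bar>\<phi> z\<bar>)" by (rule integral_abs_bound)
  also have "\<dots> \<le> (LINT z|M. C * indicator T z)"
    by (rule integral_mono) (use True i assms in \<open>auto simp: indicator_def\<close>)
  also have "\<dots> = C * measure M T" using assms by simp
  finally show ?thesis .
next
  case False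
  then show ?thesis using assms by (simp add: not_integrable_integral_eq)
qed

lemma vanishes_on_mono: "vanishes_on \<mu> U \<Longrightarrow> U' \<subseteq> U \<Longrightarrow> vanishes_on \<mu> U'"
  by (auto simp: vanishes_on_def)

lemma finite_borel_measure_eqI:
  fixes M N :: "complex measure"
  assumes "sets M = sets borel" "sets N = sets borel" "emeasure M UNIV < \<infinity>"
    and "\<And>a b. emeasure M (box a b) = emeasure N (box a b)"
  shows "M = N"
proof (rule measure_eqI_generator_eq)
  let ?E = "range (\<lambda>(a, b). box a b :: complex set)"
  show "Int_stable ?E" by (auto simp: Int_stable_def box_Int_box)
  show "?E \<subseteq> Pow UNIV" "sets M = sigma_sets UNIV ?E" "sets N = sigma_sets UNIV ?E"
    using assms(1,2) by (simp_all add: borel_eq_box)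
  let ?A = "\<lambda>n::nat. box (- (real n *\<^sub>R One)) (real n *\<^sub>R One) :: complex set"
  show "range ?A \<subseteq> ?E" "(\<Union>i. ?A i) = UNIV"
    unfolding UN_box_eq_UNIV by auto
  show "emeasure M (?A i) \<noteq> \<infinity>" for i
    using emeasure_mono[of "?A i" UNIV M] assms(1,3) by (auto simp: top_unique)
  show "emeasure M X = emeasure N X" if "X \<in> ?E" for X using that assms(4) by auto
qed

context stationary_harmonic_function
begin

abbreviation "P \<equiv> fst \<mu>"
abbreviation "N \<equiv> snd \<mu>"

lemma radon_sets: "sets P = sets (restrict_space borel \<Omega>)" "sets N = sets (restrict_space borel \<Omega>)"
  using radon by (auto simp: radon_measure_def positive_radon_measure_def)

lemma radon_space: "space P = \<Omega>" "space N = \<Omega>"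
  using sets_eq_imp_space_eq[OF radon_sets(1)] sets_eq_imp_space_eq[OF radon_sets(2)]
  by (simp_all add: space_restrict_space)

lemma borel_in_radon_sets:
  assumes "A \<in> sets borel" "A \<subseteq> \<Omega>" shows "A \<in> sets P" "A \<in> sets N"
  using assms open_Omega by (auto simp: radon_sets sets_restrict_space_iff borel_open)

lemma radon_compact:
  assumes "compact K" "K \<subseteq> \<Omega>" shows "emeasure P K < \<infinity>" "emeasure N K < \<infinity>"
  using assms radon by (auto simp: radon_measure_def positive_radon_measure_def)

lemma signed_integral_abs_le:
  assumes T: "T \<in> sets borel" "T \<subseteq> K" and K: "compact K" "K \<subseteq> \<Omega>"
    and C: "0 \<le> C" "\<And>z. \<bar>\<phi> z\<bar> \<le> C" "\<And>z. z \<notin> T \<Longrightarrow> \<phi> z = 0"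
  shows "\<bar>signed_integral \<mu> \<phi>\<bar> \<le> C * (measure P T + measure N T)"
proof -
  have KK: "K \<in> sets P" "K \<in> sets N" using borel_in_radon_sets K borel_compact by blast+
  have "emeasure P T < \<infinity>" "emeasure N T < \<infinity>"
    using emeasure_mono[OF T(2) KK(1)] emeasure_mono[OF T(2) KK(2)] radon_compact[OF K] by (auto intro: le_less_trans)
  moreover have "T \<in> sets P" "T \<in> sets N" using borel_in_radon_sets[OF T(1)] T(2) K(2) by auto
  ultimately show ?thesis
    using integral_abs_le_measure[of T P C \<phi>] integral_abs_le_measure[of T N C \<phi>] C
    by (auto simp: signed_integral_def algebra_simps)
qed

lemma signed_integral_vanishes:
  assumes U: "open U" "U \<subseteq> \<Omega>" and v: "vanishes_on \<mu> U" and \<phi>: "\<And>z. z \<notin> U \<Longrightarrow> \<phi> z = 0"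
  shows "signed_integral \<mu> \<phi> = 0"
proof -
  have UU: "U \<in> sets P" "U \<in> sets N" using borel_in_radon_sets U borel_open by blast+
  have "restrict_space P U = restrict_space N U"
  proof (rule measure_eqI)
    show "sets (restrict_space P U) = sets (restrict_space N U)"
      by (simp add: sets_restrict_space radon_sets)
    fix A assume "A \<in> sets (restrict_space P U)"
    then have A: "A \<in> sets P" "A \<subseteq> U" using UU radon_space U by (auto simp: sets_restrict_space_iff)
    then have "A \<in> sets N" by (simp add: radon_sets)
    with A v UU radon_space U show "emeasure (restrict_space P U) A = emeasure (restrict_space N U) A"
      by (simp add: emeasure_restrict_space vanishes_on_def Int_absorb1 Int_absorb2)
  qed
  then have "integral\<^sup>L (restrict_space P U) \<phi> = integral\<^sup>L (restrict_space N U) \<phi>" by simp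
  then have "(LINT z|P. indicator U z *\<^sub>R \<phi> z) = (LINT z|N. indicator U z *\<^sub>R \<phi> z)"
    using UU radon_space U by (simp add: integral_restrict_space Int_absorb1 Int_absorb2)
  moreover have "(\<lambda>z. indicator U z *\<^sub>R \<phi> z) = \<phi>" using \<phi> by (auto simp: fun_eq_iff indicator_def)
  ultimately show ?thesis by (simp add: signed_integral_def)
qed

text \<open>
  Green's identity \<open>\<integral> H \<Delta>\<phi> = \<integral> \<phi> \<Delta>H = 0\<close> for the harmonic function \<open>H = Re F\<close>.
\<close>

lemma signed_integral_zero_of_harmonic:
  assumes U: "open U" "U \<subseteq> \<Omega>" and F: "F holomorphic_on U" and h: "\<And>z. z \<in> U \<Longrightarrow> h z = \<sigma> * Re (F z)"
    and \<phi>: "\<phi> \<in> test_functions U"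
  shows "signed_integral \<mu> \<phi> = 0"
proof -
  have F': "deriv F holomorphic_on U" using F U(1) by (rule holomorphic_deriv)
  note T1 = test_function_partial[OF \<phi>, of 1, simplified] and Ti = test_function_partial[OF \<phi>, of \<i>, simplified]
  let ?C = "closure {z. \<phi> z \<noteq> 0}"
  have C: "compact ?C" "?C \<subseteq> U" using \<phi> by (auto simp: test_functions_def)
  note zero = partial_eq_0_off_support[of _ \<phi>]
  have CkU: "Ck_on k U f" if "f \<in> test_functions U" for k f
    using that Ck_on_subset[of k UNIV f U] by (auto simp: test_functions_def)
  \<comment> \<open>Green's identity: the flux fields of \<open>H \<nabla>\<phi> - \<phi> \<nabla>H\<close>\<close>
  define A where "A = extend U (\<lambda>z. Re (F z) * partial 1 \<phi> z + (- 1) * (Re (deriv F z) * \<phi> z))"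
  define B where "B = extend U (\<lambda>z. Re (F z) * partial \<i> \<phi> z + Im (deriv F z) * \<phi> z)"
  note RF = Ck_on_Re_Im_holomorphic[OF U(1) F] and RF' = Ck_on_Re_Im_holomorphic[OF U(1) F']
  have TA: "A \<in> test_functions U" unfolding A_def extend_def[abs_def]
  proof (rule test_function_extend[OF U(1) order_refl _ C])
    show "Ck_on k U (\<lambda>z. Re (F z) * partial 1 \<phi> z + (- 1) * (Re (deriv F z) * \<phi> z))" for k
      by (rule Ck_on_add[OF U(1) Ck_on_mult[OF U(1)] Ck_on_mult[OF U(1) Ck_on_const Ck_on_mult]])
        (use RF RF' CkU[OF T1] CkU[OF \<phi>] U in blast)+
    show "Re (F z) * partial 1 \<phi> z + (- 1) * (Re (deriv F z) * \<phi> z) = 0" if "z \<notin> ?C" for z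
      unfolding zero[OF that] by simp
  qed
  have TB: "B \<in> test_functions U" unfolding B_def extend_def[abs_def]
  proof (rule test_function_extend[OF U(1) order_refl _ C])
    show "Ck_on k U (\<lambda>z. Re (F z) * partial \<i> \<phi> z + Im (deriv F z) * \<phi> z)" for k
      by (rule Ck_on_add[OF U(1) Ck_on_mult[OF U(1)] Ck_on_mult[OF U(1)]])
        (use RF RF' CkU[OF Ti] CkU[OF \<phi>] in blast)+
    show "Re (F z) * partial \<i> \<phi> z + Im (deriv F z) * \<phi> z = 0" if "z \<notin> ?C" for z
      unfolding zero[OF that] by simp
  qed
  have div: "partial 1 A z + partial \<i> B z = Re (F z) * laplacian \<phi> z" if z: "z \<in> U" for z
  proof -
    have d: "f differentiable (at z)" if "f \<in> test_functions U" for f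
      using that by (auto simp: test_functions_def dest!: spec[of _ "Suc 0"])
    note D = has_derivative_partials[OF d[OF \<phi>]] and D1 = has_derivative_partials[OF d[OF T1]]
      and Di = has_derivative_partials[OF d[OF Ti]]
    note DF = has_derivative_Re_Im_holomorphic[OF F U(1) z] and DF' = has_derivative_Re_Im_holomorphic[OF F' U(1) z]
    note E1 = has_derivative_add[OF has_derivative_mult[OF DF(1) D1]
        has_derivative_mult_right[OF has_derivative_mult[OF DF'(1) D], of "-1"]]
    note E2 = has_derivative_add[OF has_derivative_mult[OF DF(1) Di] has_derivative_mult[OF DF'(2) D]]
    show ?thesis
      unfolding A_def B_def partial_extend[OF U(1) z E1] partial_extend[OF U(1) z E2]
      by (simp add: laplacian_def algebra_simps)
  qed
  note T11 = test_function_partial[OF T1, of 1, simplified] and Tii = test_function_partial[OF Ti, of \<i>, simplified]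
  note TA1 = test_function_partial[OF TA, of 1, simplified] and TBi = test_function_partial[OF TB, of \<i>, simplified]
  let ?k = "\<lambda>z. partial 1 A z + partial \<i> B z"
  have int: "integrable lborel ?k"
    by (intro Bochner_Integration.integrable_add test_function_integrable[OF TA1] test_function_integrable[OF TBi])
  have "signed_integral \<mu> \<phi> = (LINT z|lebesgue_on \<Omega>. h z * laplacian \<phi> z)"
    using Laplacian test_functions_mono[OF \<phi> U(2)] by (simp add: distributional_laplacian_def)
  also have "\<dots> = (LINT z|lebesgue. indicator \<Omega> z *\<^sub>R (h z * laplacian \<phi> z))"
    by (rule integral_restrict_space) (use open_sets_lebesgue[OF open_Omega] in auto)
  also have "(\<lambda>z. indicator \<Omega> z *\<^sub>R (h z * laplacian \<phi> z)) = (\<lambda>z. \<sigma> * ?k z)"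
  proof
    fix z
    show "indicator \<Omega> z *\<^sub>R (h z * laplacian \<phi> z) = \<sigma> * ?k z"
    proof (cases "z \<in> U")
      case True
      then show ?thesis using div[OF True] h[OF True] U(2) by (auto simp: algebra_simps)
    next
      case False
      then show ?thesis
        using test_function_zero_outside[OF T11] test_function_zero_outside[OF Tii]
          test_function_zero_outside[OF TA1] test_function_zero_outside[OF TBi] by (simp add: laplacian_def)
    qed
  qed
  also have "(LINT z|lebesgue. \<sigma> * ?k z) = (LINT z|lborel. \<sigma> * ?k z)"
    by (rule integral_completion) (use int in auto)
  also have "\<dots> = \<sigma> * (integral\<^sup>L lborel (partial 1 A) + integral\<^sup>L lborel (partial \<i> B))"
    using test_function_integrable[OF TA1] test_function_integrable[OF TBi] by simp
  also have "\<dots> = 0"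
    using integral_partial_test_function[OF TA, of 1] integral_partial_test_function[OF TB, of \<i>] by simp
  finally show ?thesis .
qed

text \<open>
  Integrals of test functions determine the masses of the boxes whose closure lies in \<open>U\<close>, by
  dominated convergence of \<^const>\<open>cutoff\<close>, and the boxes in \<open>box u v\<close> determine both positive
  parts there. The closed box is compact in \<open>\<Omega>\<close>, so that the two measures are finite on it and
  \<open>\<pi>\<close>-systems can be used.
\<close>

lemma vanishes_on_box:
  assumes U: "open U" "U \<subseteq> \<Omega>" and F: "F holomorphic_on U" and h: "\<And>z. z \<in> U \<Longrightarrow> h z = \<sigma> * Re (F z)"
    and B: "cbox u v \<subseteq> U"
  shows "vanishes_on \<mu> (box u v)"
proof -
  have boxeq: "emeasure P (box a b) = emeasure N (box a b)" if ab: "cbox a b \<subseteq> U" for a b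
  proof (cases "Re a < Re b \<and> Im a < Im b")
    case False
    then have "box a b = {}" by (auto simp: in_box_complex_iff)
    then show ?thesis by simp
  next
    case True
    define \<beta> where "\<beta> n = tensor (cutoff (Re a) (Re b) n) (cutoff (Im a) (Im b) n)" for n
    have sm: "smooth_real (cutoff x y n)" for x y n by (rule smooth_real_cutoff)
    have z: "\<beta> n w = 0" if "w \<notin> box a b" for n w
      using that cutoff_eq_0[of "Re w" "Re a" "Re b" n] cutoff_eq_0[of "Im w" "Im a" "Im b" n]
      by (auto simp: \<beta>_def tensor_def in_box_complex_iff)
    have T: "\<beta> n \<in> test_functions U" for n
    proof -
      have "(\<lambda>z. if z \<in> U then \<beta> n z else 0) \<in> test_functions U"
      proof (rule test_function_extend[OF U(1) order_refl _ compact_cbox ab])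
        show "Ck_on k U (\<beta> n)" for k
          unfolding \<beta>_def by (rule Ck_on_tensor[OF sm sm holomorphic_on_ident U(1)])
        show "\<beta> n w = 0" if "w \<notin> cbox a b" for w
          using z[of w n] that box_subset_cbox[of a b] by blast
      qed
      moreover have "(\<lambda>z. if z \<in> U then \<beta> n z else 0) = \<beta> n"
        using z ab box_subset_cbox[of a b] by (auto simp: fun_eq_iff)
      ultimately show ?thesis by simp
    qed
    have eq: "integral\<^sup>L P (\<beta> n) = integral\<^sup>L N (\<beta> n)" for n
      using signed_integral_zero_of_harmonic[OF U F h T] by (simp add: signed_integral_def)
    have lim: "(\<lambda>n. integral\<^sup>L M (\<beta> n)) \<longlonglongrightarrow> measure M (box a b) \<and> emeasure M (box a b) < \<infinity>"
      if M: "sets M = sets (restrict_space borel \<Omega>)" "emeasure M (cbox a b) < \<infinity>" for M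
    proof -
      have bM: "box a b \<in> sets M" "cbox a b \<in> sets M"
        unfolding M using ab U box_subset_cbox[of a b] open_Omega
        by (auto simp: sets_restrict_space_iff borel_open)
      have fin: "emeasure M (box a b) < \<infinity>"
        using emeasure_mono[OF box_subset_cbox bM(2)] M(2) by (rule le_less_trans)
      have "(\<lambda>n. integral\<^sup>L M (\<beta> n)) \<longlonglongrightarrow> integral\<^sup>L M (indicator (box a b))"
      proof (rule integral_dominated_convergence[where w = "indicator (box a b)"])
        show "indicator (box a b) \<in> borel_measurable M" using bM by simp
        have "\<beta> n \<in> borel_measurable borel" for n
          by (rule borel_measurable_continuous_onI) (rule test_function_continuous[OF T])
        then show "\<beta> n \<in> borel_measurable M" for n
          using measurable_restrict_space1[of "\<beta> n" borel borel \<Omega>] measurable_cong_sets[OF M(1) refl] by blast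
        show "integrable M (indicator (box a b) :: complex \<Rightarrow> real)"
          using bM fin by (intro integrable_real_indicator)
        show "AE x in M. (\<lambda>n. \<beta> n x) \<longlonglongrightarrow> indicator (box a b) x"
        proof (rule AE_I2)
          fix x
          have "(\<lambda>n. \<beta> n x) \<longlonglongrightarrow> indicator {Re a<..<Re b} (Re x) * indicator {Im a<..<Im b} (Im x)"
            unfolding \<beta>_def tensor_def by (intro tendsto_intros cutoff_tendsto)
          moreover have "indicator {Re a<..<Re b} (Re x) * indicator {Im a<..<Im b} (Im x) = (indicator (box a b) x :: real)"
            by (auto simp: in_box_complex_iff indicator_def)
          ultimately show "(\<lambda>n. \<beta> n x) \<longlonglongrightarrow> indicator (box a b) x" by simp
        qed
        show "AE x in M. norm (\<beta> n x) \<le> indicator (box a b) x" for n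
        proof (rule AE_I2)
          fix x
          have "norm (\<beta> n x) \<le> 1"
            using cutoff_bounds[of "Re a" "Re b" n "Re x"] cutoff_bounds[of "Im a" "Im b" n "Im x"]
            by (simp add: \<beta>_def tensor_def abs_mult mult_le_one)
          then show "norm (\<beta> n x) \<le> indicator (box a b) x" using z[of x n] by (auto simp: indicator_def)
        qed
      qed
      then show ?thesis using bM fin by simp
    qed
    have c: "compact (cbox a b)" "cbox a b \<subseteq> \<Omega>" using ab U by auto
    note lP = lim[OF radon_sets(1) radon_compact(1)[OF c]] and lN = lim[OF radon_sets(2) radon_compact(2)[OF c]]
    have "measure P (box a b) = measure N (box a b)"
      using lP lN eq LIMSEQ_unique by (metis (no_types, lifting) ext)
    then show ?thesis using lP lN by (simp add: emeasure_eq_ennreal_measure less_top)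
  qed
  let ?B = "box u v"
  have BO: "?B \<subseteq> \<Omega>" "?B \<in> sets borel" using B U box_subset_cbox[of u v] by auto
  have BB: "?B \<in> sets P" "?B \<in> sets N" using borel_in_radon_sets BO by blast+
  \<comment> \<open>the parts restricted to the open box, regarded as Borel measures on the whole plane\<close>
  define Q where "Q M = distr (restrict_space M ?B) borel (\<lambda>x. x)" for M :: "complex measure"
  have Q: "emeasure (Q M) A = emeasure M (A \<inter> ?B)"
    if M: "sets M = sets (restrict_space borel \<Omega>)" and A: "A \<in> sets borel" for M A
  proof -
    have sp: "space M = \<Omega>" using sets_eq_imp_space_eq[OF M] by (simp add: space_restrict_space)
    have BM: "?B \<in> sets M" unfolding M using BO open_Omega by (auto simp: sets_restrict_space_iff borel_open)
    have "(\<lambda>x. x) \<in> measurable M borel"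
      using measurable_restrict_space1[OF measurable_ident_sets[OF refl], of borel \<Omega>] measurable_cong_sets[OF M refl] by blast
    then have "(\<lambda>x. x) \<in> measurable (restrict_space M ?B) borel" by (rule measurable_restrict_space1)
    then have "emeasure (Q M) A = emeasure (restrict_space M ?B) (A \<inter> ?B)"
      unfolding Q_def using A sp BO by (subst emeasure_distr) (auto simp: space_restrict_space Int_absorb1 Int_absorb2 Int_commute)
    also have "\<dots> = emeasure M (A \<inter> ?B)"
      using BM sp BO by (subst emeasure_restrict_space) (auto simp: Int_absorb1 Int_absorb2)
    finally show ?thesis .
  qed
  have "Q P = Q N"
  proof (rule finite_borel_measure_eqI)
    show "sets (Q P) = sets borel" "sets (Q N) = sets borel" by (simp_all add: Q_def)
    have "emeasure P ?B \<le> emeasure P (cbox u v)"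
      by (rule emeasure_mono[OF box_subset_cbox]) (use borel_in_radon_sets(1)[of "cbox u v"] B U in auto)
    also have "\<dots> < \<infinity>" using B U by (intro radon_compact) auto
    finally show "emeasure (Q P) UNIV < \<infinity>" by (simp add: Q[OF radon_sets(1)])
    fix a b :: complex
    obtain a' b' where ab': "box a b \<inter> ?B = box a' b'" "cbox a' b' \<subseteq> cbox u v \<or> box a' b' = {}"
    proof
      let ?a = "Complex (max (Re a) (Re u)) (max (Im a) (Im u))" and ?b = "Complex (min (Re b) (Re v)) (min (Im b) (Im v))"
      show "box a b \<inter> ?B = box ?a ?b" by (auto simp: in_box_complex_iff)
      show "cbox ?a ?b \<subseteq> cbox u v \<or> box ?a ?b = {}" by (auto simp: in_cbox_complex_iff)
    qed
    have "emeasure P (box a' b') = emeasure N (box a' b')"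
      using ab'(2) boxeq[of a' b'] B by auto
    then show "emeasure (Q P) (box a b) = emeasure (Q N) (box a b)"
      using Q[OF radon_sets(1), of "box a b"] Q[OF radon_sets(2), of "box a b"] ab'(1) by simp
  qed
  show ?thesis unfolding vanishes_on_def
  proof (intro ballI impI)
    fix A assume A: "A \<in> sets P" "A \<subseteq> ?B"
    then have "A \<in> sets borel" using open_Omega by (auto simp: radon_sets sets_restrict_space_iff borel_open)
    then show "emeasure P A = emeasure N A"
      using Q[OF radon_sets(1), of A] Q[OF radon_sets(2), of A] \<open>Q P = Q N\<close> A(2) by (simp add: Int_absorb2)
  qed
qed

lemma not_support_where_harmonic:
  assumes U: "open U" "U \<subseteq> \<Omega>" and F: "F holomorphic_on U" and h: "\<And>z. z \<in> U \<Longrightarrow> h z = \<sigma> * Re (F z)"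
    and z: "z \<in> U"
  obtains B where "open B" "z \<in> B" "B \<subseteq> U" "vanishes_on \<mu> B"
proof -
  obtain u v where uv: "cbox u v \<subseteq> U" "z \<in> box u v"
    by (rule open_contains_cbox[OF U(1) z])
  have "vanishes_on \<mu> (box u v)" using U F h uv(1) by (rule vanishes_on_box)
  moreover have "box u v \<subseteq> U" using uv(1) box_subset_cbox[of u v] by (rule order_trans[rotated])
  ultimately show ?thesis using uv(2) by (intro that[of "box u v"] open_box)
qed

lemma chart_subrect:
  assumes "chart U G l r c d" "l \<le> l'" "r' \<le> r" "c \<le> c'" "d' \<le> d"
  shows "chart {z\<in>U. G z \<in> rect l' r' c' d'} G l' r' c' d'"
proof -
  let ?S = "{z\<in>U. G z \<in> rect l' r' c' d'}"
  note C = chartD[OF assms(1)]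
  have "open (U \<inter> G -` rect l' r' c' d')"
    by (rule continuous_open_preimage[OF holomorphic_on_imp_continuous_on[OF C(4)] C(1)]) auto
  moreover have "U \<inter> G -` rect l' r' c' d' = ?S" by auto
  moreover have "G ` ?S = rect l' r' c' d'"
  proof
    show "rect l' r' c' d' \<subseteq> G ` ?S"
    proof
      fix w assume w: "w \<in> rect l' r' c' d'"
      then have "w \<in> G ` U" unfolding C(6) using assms by (auto simp: in_box_complex_iff)
      then obtain z where "z \<in> U" "w = G z" by blast
      with w show "w \<in> G ` ?S" by blast
    qed
  qed blast
  moreover have "bounded (h ` ?S)" by (rule bounded_subset[OF C(3)]) auto
  moreover have "inj_on G ?S" by (rule inj_on_subset[OF C(5)]) auto
  ultimately show ?thesis using C unfolding chart_def
    by (auto intro: holomorphic_on_subset)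
qed

lemma bump_normalized:
  assumes "l < r" obtains b where "bump l r b" "integral UNIV b = 1" "\<And>x. 0 \<le> b x"
proof -
  define p where "p = (2 * l + r) / 3" define q where "q = (l + 2 * r) / 3"
  have pq: "l < p" "p < q" "q < r" using assms by (auto simp: p_def q_def field_simps)
  let ?I = "integral UNIV (cutoff p q 0)"
  have I: "0 < ?I" using bump_integral_pos[OF pq] .
  show ?thesis
    by (rule that[of "\<lambda>x. inverse ?I * cutoff p q 0 x"])
      (use I bump_cmult[OF bump_cutoff[OF pq]] cutoff_bounds in auto)
qed

text \<open>
  The horizontal derivative of the slope is \<open>\<mu>\<close>, and a measure of finite mass is small on the strips
  \<open>0 < Re G < \<delta>\<close>, which shrink to the empty set. A change of the sign of the slope on the line
  \<open>Re G = u\<close> would cost a mass proportional to the height of the rectangle, whatever \<open>u\<close> is; so there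
  is none once \<open>\<delta>\<close> is small.
\<close>

lemma sector_affine:
  assumes chart: "chart U G 0 r c d" and r: "0 < r" "c < d" and K: "compact K" "U \<subseteq> K" "K \<subseteq> \<Omega>"
  obtains \<delta> \<sigma> k where "0 < \<delta>" "\<delta> \<le> r" "\<sigma> = 1 \<or> \<sigma> = -1"
    "\<And>z. z \<in> U \<Longrightarrow> Re (G z) < \<delta> \<Longrightarrow> h z = \<sigma> * Re (G z) + k"
proof -
  note C = chartD[OF chart]
  obtain b where b: "bump c d b" "integral UNIV b = 1" "\<And>x. 0 \<le> b x" using bump_normalized[OF r(2)] by blast
  obtain B where B: "0 < B" "\<And>x. \<bar>b x\<bar> \<le> B" using bump_bounded[OF b(1)] by blast
  define T where "T n = {z\<in>U. G z \<in> rect 0 (r / real (Suc n)) c d}" for n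
  have rn: "0 < r / real (Suc n)" "r / real (Suc n) \<le> r" for n using r by (auto simp: field_simps)
  have chT: "chart (T n) G 0 (r / real (Suc n)) c d" for n
    unfolding T_def by (rule chart_subrect[OF chart]) (use rn in auto)
  have Tb: "T n \<in> sets borel" "T n \<subseteq> K" for n using chartD(1)[OF chT] K(2) by (auto simp: T_def)
  have Tdec: "decseq T"
  proof (rule decseq_SucI, rule subsetI)
    fix n z assume "z \<in> T (Suc n)"
    moreover have "r / real (Suc (Suc n)) \<le> r / real (Suc n)" using r by (intro divide_left_mono) auto
    ultimately show "z \<in> T n" by (auto simp: T_def in_box_complex_iff)
  qed
  \<comment> \<open>\<open>Re G\<close> is positive on \<open>U\<close>\<close>
  have Tempty: "(\<Inter>n. T n) = {}"
  proof -
    have False if z: "z \<in> (\<Inter>n. T n)" for z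
    proof -
      have pos: "0 < Re (G z)" using z by (auto simp: T_def in_box_complex_iff)
      then obtain n where "r / Re (G z) < real n" using reals_Archimedean2 by blast
      then have "r < Re (G z) * real (Suc n)" using pos by (simp add: field_simps)
      moreover have "Re (G z) < r / real (Suc n)" using z by (auto simp: T_def in_box_complex_iff)
      ultimately show False by (simp add: field_simps)
    qed
    then show ?thesis by blast
  qed
  have lim: "(\<lambda>n. measure M (T n)) \<longlonglongrightarrow> 0"
    if M: "\<And>A. A \<in> sets borel \<Longrightarrow> A \<subseteq> \<Omega> \<Longrightarrow> A \<in> sets M" "emeasure M K < \<infinity>" for M
  proof -
    have TM: "T n \<in> sets M" for n using M(1)[OF Tb(1)] Tb(2) K(3) by blast
    have KM: "K \<in> sets M" by (rule M(1)[OF borel_compact[OF K(1)] K(3)])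
    have "emeasure M (T n) \<noteq> \<infinity>" for n
      using emeasure_mono[OF Tb(2) KM, of n] M(2) by (auto simp: top_unique)
    then have "(\<lambda>n. measure M (T n)) \<longlonglongrightarrow> measure M (\<Inter>n. T n)"
      by (intro Lim_measure_decseq Tdec) (use TM in auto)
    then show ?thesis by (simp add: Tempty)
  qed
  have "(\<lambda>n. B * (measure P (T n) + measure N (T n))) \<longlonglongrightarrow> B * (0 + 0)"
    using borel_in_radon_sets radon_compact[OF K(1,3)] by (intro tendsto_intros lim) auto
  then have "\<forall>\<^sub>F n in sequentially. B * (measure P (T n) + measure N (T n)) < 1"
    by (rule order_tendstoD) simp
  then obtain n where n: "B * (measure P (T n) + measure N (T n)) < 1" by (auto simp: eventually_sequentially)
  obtain \<sigma> k where "\<sigma> = 1 \<or> \<sigma> = -1" "\<And>z. z \<in> T n \<Longrightarrow> h z = \<sigma> * Re (G z) + k"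
  proof (rule chart_affine[OF chT b _ rn(1) r(2)])
    fix a M assume a: "bump 0 (r / real (Suc n)) a" "\<And>x. \<bar>a x\<bar> \<le> M"
    have M: "0 \<le> M" using a(2)[of 0] by linarith
    have "\<bar>signed_integral \<mu> (extend (T n) (\<lambda>z. tensor a b (G z)))\<bar> \<le> (M * B) * (measure P (T n) + measure N (T n))"
    proof (rule signed_integral_abs_le[OF Tb K(1,3)])
      show "0 \<le> M * B" using M B by simp
      show "\<bar>extend (T n) (\<lambda>z. tensor a b (G z)) z\<bar> \<le> M * B" for z
        using a(2)[of "Re (G z)"] B M by (auto simp: extend_def tensor_def abs_mult intro!: mult_mono)
    qed (simp add: extend_def)
    also have "\<dots> \<le> M * 1" using mult_left_mono[OF less_imp_le[OF n] M] by (simp add: mult.assoc)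
    finally show "\<bar>signed_integral \<mu> (extend (T n) (\<lambda>z. tensor a b (G z)))\<bar> \<le> M" by simp
  qed blast
  note s = this
  show ?thesis
  proof (rule that[OF rn s(1)])
    fix z assume z: "z \<in> U" "Re (G z) < r / real (Suc n)"
    moreover have "G z \<in> rect 0 r c d" using z C(6) by blast
    ultimately show "h z = \<sigma> * Re (G z) + k" by (intro s(2)) (auto simp: T_def in_box_complex_iff)
  qed
qed

text \<open>
  If \<open>\<mu>\<close> vanishes then the slope is constant on the whole chart.
\<close>

lemma no_jump_where_vanishes:
  assumes chart: "chart U G (-\<epsilon>) \<epsilon> c d" and \<epsilon>: "0 < \<epsilon>" "c < d" and v: "vanishes_on \<mu> U"
    and right: "\<And>z. z \<in> U \<Longrightarrow> 0 < Re (G z) \<Longrightarrow> h z = \<sigma>1 * Re (G z)"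
    and left: "\<And>z. z \<in> U \<Longrightarrow> Re (G z) < 0 \<Longrightarrow> h z = \<sigma>2 * Re (G z)"
  shows "\<sigma>1 = \<sigma>2"
proof -
  note C = chartD[OF chart]
  obtain b where b: "bump c d b" "integral UNIV b = 1" "\<And>x. 0 \<le> b x" using bump_normalized[OF \<epsilon>(2)] by blast
  obtain \<sigma> k where s: "\<And>z. z \<in> U \<Longrightarrow> h z = \<sigma> * Re (G z) + k"
  proof (rule chart_affine[OF chart b _ _ \<epsilon>(2)])
    fix a M assume a: "bump (-\<epsilon>) \<epsilon> a" "\<And>x. \<bar>a x\<bar> \<le> M"
    have "signed_integral \<mu> (extend U (\<lambda>z. tensor a b (G z))) = 0"
      by (rule signed_integral_vanishes[OF C(1,2) v]) (simp add: extend_def)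
    then show "\<bar>signed_integral \<mu> (extend U (\<lambda>z. tensor a b (G z)))\<bar> \<le> M" using a(2)[of 0] by simp
  qed (use \<epsilon> in auto)
  have "\<exists>z\<in>U. Re (G z) = x" if "-\<epsilon> < x" "x < \<epsilon>" for x
  proof -
    have "Complex x ((c + d) / 2) \<in> G ` U" unfolding C(6) using that \<epsilon> by (auto simp: in_box_complex_iff)
    then obtain z where "z \<in> U" "Complex x ((c + d) / 2) = G z" by blast
    then show ?thesis by (metis complex.sel(1))
  qed
  note ex = this
  obtain z1 where z1: "z1 \<in> U" "Re (G z1) = \<epsilon> / 2" using ex[of "\<epsilon> / 2"] \<epsilon> by auto
  obtain z2 where z2: "z2 \<in> U" "Re (G z2) = \<epsilon> / 4" using ex[of "\<epsilon> / 4"] \<epsilon> by auto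
  obtain z3 where z3: "z3 \<in> U" "Re (G z3) = - \<epsilon> / 2" using ex[of "- \<epsilon> / 2"] \<epsilon> by auto
  obtain z4 where z4: "z4 \<in> U" "Re (G z4) = - \<epsilon> / 4" using ex[of "- \<epsilon> / 4"] \<epsilon> by auto
  note z = z1 z2 z3 z4
  have "\<sigma>1 * (\<epsilon> / 2) = \<sigma> * (\<epsilon> / 2) + k" "\<sigma>1 * (\<epsilon> / 4) = \<sigma> * (\<epsilon> / 4) + k"
    "\<sigma>2 * (- \<epsilon> / 2) = \<sigma> * (- \<epsilon> / 2) + k" "\<sigma>2 * (- \<epsilon> / 4) = \<sigma> * (- \<epsilon> / 4) + k"
    using right[OF z(1)] right[OF z(3)] left[OF z(5)] left[OF z(7)] s[OF z(1)] s[OF z(3)] s[OF z(5)] s[OF z(7)] z \<epsilon>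
    by auto
  then have "\<sigma>1 * \<epsilon> = \<sigma>2 * \<epsilon>" by (simp add: field_simps)
  then show ?thesis using \<epsilon> by simp
qed

lemma vanishes_on_signed_restrict:
  assumes "open V" "V \<subseteq> \<Omega>" "U \<subseteq> V"
  shows "vanishes_on (signed_restrict \<mu> V) U \<longleftrightarrow> vanishes_on \<mu> U"
proof -
  note V = borel_in_radon_sets[OF borel_open[OF assms(1)] assms(2)]
  have VO: "V \<inter> space P = V" "V \<inter> space N = V" using radon_space assms(2) by auto
  have *: "A \<in> sets (restrict_space P V) \<longleftrightarrow> A \<in> sets P \<and> A \<subseteq> V"
    "A \<in> sets (restrict_space N V) \<longleftrightarrow> A \<in> sets N \<and> A \<subseteq> V" for A
    using sets_restrict_space_iff[of V P A] sets_restrict_space_iff[of V N A] V unfolding VO by blast+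
  have "emeasure (restrict_space P V) A = emeasure P A" "emeasure (restrict_space N V) A = emeasure N A"
    if "A \<subseteq> V" for A
    using emeasure_restrict_space[of V P A] emeasure_restrict_space[of V N A] V that unfolding VO by blast+
  note e = this
  have "(A \<in> sets (restrict_space P V) \<longrightarrow> A \<subseteq> U \<longrightarrow>
        emeasure (restrict_space P V) A = emeasure (restrict_space N V) A) \<longleftrightarrow>
      (A \<in> sets P \<longrightarrow> A \<subseteq> U \<longrightarrow> emeasure P A = emeasure N A)" for A
  proof (cases "A \<subseteq> U")
    case True
    then have "A \<subseteq> V" using assms(3) by blast
    then show ?thesis using *[of A] e[of A] by simp
  qed simp
  then show ?thesis unfolding vanishes_on_def signed_restrict_def Ball_def fst_conv snd_conv by (rule iff_allI)
qed

lemma signed_support_restrict: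
  assumes "open V" "V \<subseteq> \<Omega>"
  shows "z \<in> signed_support (signed_restrict \<mu> V) \<longleftrightarrow>
    z \<in> V \<and> (\<forall>U. open U \<longrightarrow> z \<in> U \<longrightarrow> U \<subseteq> V \<longrightarrow> \<not> vanishes_on \<mu> U)"
proof -
  have "space (fst (signed_restrict \<mu> V)) = V"
    using radon_space assms by (auto simp: space_restrict_space signed_restrict_def)
  then have "z \<in> signed_support (signed_restrict \<mu> V) \<longleftrightarrow>
      z \<in> V \<and> \<not> (\<exists>U. open U \<and> U \<subseteq> V \<and> vanishes_on (signed_restrict \<mu> V) U \<and> z \<in> U)"
    unfolding signed_support_def by (simp only: Diff_iff Union_iff mem_Collect_eq) blast
  then show ?thesis using vanishes_on_signed_restrict[OF assms] by blast
qed

end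

section \<open>Normal form at a zero of even order\<close>

text \<open>
  Write \<open>G = (z - z0)\<^sup>m p\<close> with \<open>p\<close> free of zeros. On a disc \<open>p\<close> has a holomorphic \<open>m\<close>-th root, and
  \<open>Z = (z - z0) p\<^sup>1\<^sup>/\<^sup>m\<close> is a conformal coordinate with \<open>Z\<^sup>m = G\<close>; the map \<open>K\<close> is its inverse. If \<open>m\<close>
  were \<open>1\<close>, the derivative of \<open>G\<close> at \<open>z0\<close> would be that of \<open>Z\<close>, which is not \<open>0\<close>.
\<close>

lemma conformal_power_normal_form:
  assumes G: "G holomorphic_on ball z0 R" "0 < R" and G0: "G z0 = 0" "deriv G z0 = 0"
    and nc: "\<exists>w\<in>ball z0 R. G w \<noteq> 0"
  obtains m :: nat and \<rho> and K where "2 \<le> m" "0 < \<rho>" "K holomorphic_on ball 0 \<rho>" "K 0 = z0"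
    "inj_on K (ball 0 \<rho>)" "\<And>w. w \<in> ball 0 \<rho> \<Longrightarrow> deriv K w \<noteq> 0"
    "K ` ball 0 \<rho> \<subseteq> ball z0 R" "\<And>w. w \<in> ball 0 \<rho> \<Longrightarrow> G (K w) = w ^ m"
proof -
  define n where "n = nat (zorder G z0)" define p where "p = zor_poly G z0"
  obtain r where r: "0 < r" "cball z0 r \<subseteq> ball z0 R" "p holomorphic_on cball z0 r"
    "\<And>w. w \<in> cball z0 r \<Longrightarrow> G w = p w * (w - z0) ^ n \<and> p w \<noteq> 0" and n0: "0 < n"
  proof -
    have "z0 \<in> ball z0 R" using G(2) by simp
    from zorder_exist_zero[OF G(1) open_ball connected_ball this nc] that G0(1)
    show thesis unfolding n_def p_def by auto
  qed
  let ?B = "ball z0 r"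
  have BR: "?B \<subseteq> ball z0 R" using r(2) ball_subset_cball[of z0 r] by blast
  have pB: "p holomorphic_on ?B" using r(3) ball_subset_cball holomorphic_on_subset by blast
  have pw: "p w \<noteq> 0" "G w = p w * (w - z0) ^ n" if "w \<in> ?B" for w
    using r(4)[of w] that by auto
  obtain L where L: "L holomorphic_on ?B" "\<And>w. w \<in> ?B \<Longrightarrow> exp (L w) = p w"
    using holomorphic_logarithm_exists[OF convex_ball open_ball pB pw(1), of z0] r(1) by auto
  define Z where "Z w = (w - z0) * exp (L w / of_nat n)" for w
  have Zh: "Z holomorphic_on ?B" unfolding Z_def by (intro holomorphic_intros L(1)) (use n0 in auto)
  have Zpow: "Z w ^ n = G w" if "w \<in> ?B" for w
  proof -
    have "exp (L w / of_nat n) ^ n = exp (L w)" using n0 by (simp add: exp_of_nat_mult[symmetric])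
    then show ?thesis using pw[OF that] L(2)[OF that] by (simp add: Z_def power_mult_distrib mult.commute)
  qed
  have z0B: "z0 \<in> ?B" using r(1) by simp
  have dZ: "deriv Z z0 \<noteq> 0"
  proof -
    have E: "((\<lambda>w. exp (L w / of_nat n)) has_field_derivative exp (L z0 / of_nat n) * (deriv L z0 / of_nat n)) (at z0)"
      using holomorphic_derivI[OF L(1) open_ball z0B] n0 by (auto intro!: derivative_eq_intros)
    have d: "((\<lambda>w. w - z0) has_field_derivative 1) (at z0)" by (auto intro!: derivative_eq_intros)
    have "(Z has_field_derivative exp (L z0 / of_nat n)) (at z0)"
      unfolding Z_def[abs_def]
      using DERIV_mult[OF d E] by simp
    then have "deriv Z z0 = exp (L z0 / of_nat n)" by (rule DERIV_imp_deriv)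
    then show ?thesis by simp
  qed
  have n2: "2 \<le> n"
  proof (rule ccontr)
    assume "\<not> 2 \<le> n"
    then have "n = 1" using n0 by auto
    then have eq: "G w = Z w" if "w \<in> ?B" for w using Zpow[OF that] by simp
    have "(Z has_field_derivative deriv Z z0) (at z0)" by (rule holomorphic_derivI[OF Zh open_ball z0B])
    then have "(G has_field_derivative deriv Z z0) (at z0)"
      by (rule has_field_derivative_transform_within_open[OF _ open_ball z0B]) (simp add: eq)
    then show False using DERIV_imp_deriv G0(2) dZ by force
  qed
  obtain s where s: "0 < s" "ball z0 s \<subseteq> ?B" "open (Z ` ball z0 s)" "inj_on Z (ball z0 s)"
    by (rule has_complex_derivative_locally_invertible[OF Zh z0B open_ball dZ])
  have Zs: "Z holomorphic_on ball z0 s" using Zh s(2) holomorphic_on_subset by blast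
  obtain K where K: "K holomorphic_on Z ` ball z0 s"
    "\<And>z. z \<in> ball z0 s \<Longrightarrow> deriv Z z * deriv K (Z z) = 1" "\<And>z. z \<in> ball z0 s \<Longrightarrow> K (Z z) = z"
    using holomorphic_has_inverse[OF Zs open_ball s(4)] by metis
  have Z0: "Z z0 = 0" by (simp add: Z_def)
  have "0 \<in> Z ` ball z0 s" by (rule image_eqI[of _ _ z0]) (use Z0 s(1) in auto)
  then obtain \<rho> where \<rho>: "0 < \<rho>" "ball 0 \<rho> \<subseteq> Z ` ball z0 s" using s(3) openE by blast
  have KZ: "K w \<in> ball z0 s" "Z (K w) = w" "deriv K w \<noteq> 0" if w: "w \<in> ball 0 \<rho>" for w
  proof -
    obtain z where z: "z \<in> ball z0 s" "w = Z z" using w \<rho>(2) by blast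
    show "K w \<in> ball z0 s" "Z (K w) = w" using z K(3)[OF z(1)] by simp_all
    show "deriv K w \<noteq> 0" using K(2)[OF z(1)] z(2) by auto
  qed
  show ?thesis
  proof (rule that[OF n2 \<rho>(1)])
    show "K holomorphic_on ball 0 \<rho>" using K(1) \<rho>(2) by (rule holomorphic_on_subset)
    show "K 0 = z0" using K(3)[of z0] Z0 s(1) by simp
    show "inj_on K (ball 0 \<rho>)" by (rule inj_on_inverseI[of _ Z]) (rule KZ(2))
    show "K ` ball 0 \<rho> \<subseteq> ball z0 R" using KZ(1) s(2) BR by blast
    show "G (K w) = w ^ n" if "w \<in> ball 0 \<rho>" for w
      using Zpow[of "K w"] KZ(1,2)[OF that] s(2) by auto
  qed (rule KZ(3))
qed

text \<open>
  This is where the order of the zero has to be even: \<open>(z - z0)\<^sup>2\<^sup>k exp L\<close> is the square of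
  \<open>(z - z0)\<^sup>k exp (L/2)\<close>, and \<open>G\<close> is a primitive of the latter.
\<close>

lemma even_zero_square_root_primitive:
  assumes "open \<Omega>" "\<omega> holomorphic_on \<Omega>" "z0 \<in> \<Omega>" "zero_of_even_order \<omega> z0"
  obtains R G where "0 < R" "cball z0 R \<subseteq> \<Omega>" "G holomorphic_on ball z0 R"
    "\<And>z. z \<in> ball z0 R \<Longrightarrow> (deriv G z)\<^sup>2 = \<omega> z" "G z0 = 0" "deriv G z0 = 0" "\<exists>w\<in>ball z0 R. G w \<noteq> 0"
proof -
  obtain R0 where R0: "0 < R0" "ball z0 R0 \<subseteq> \<Omega>" using assms(1,3) openE by blast
  have z: "\<omega> z0 = 0" "isolated_zero \<omega> z0" "even (zorder \<omega> z0)"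
    using assms(4) by (auto simp: zero_of_even_order_def)
  have near: "\<exists>w. w \<in> ball z0 r \<and> \<omega> w \<noteq> 0" if r: "0 < r" for r
  proof -
    have "\<forall>\<^sub>F w in at z0. \<omega> w \<noteq> 0" using z(2) by (auto simp: isolated_zero_def)
    moreover have "\<forall>\<^sub>F w in at z0. w \<in> ball z0 r" using r eventually_at_in_open'[of "ball z0 r" z0] by auto
    ultimately have "\<forall>\<^sub>F w in at z0. w \<in> ball z0 r \<and> \<omega> w \<noteq> 0" by eventually_elim simp
    then show ?thesis by (rule eventually_happens'[OF at_neq_bot])
  qed
  define n where "n = nat (zorder \<omega> z0)" define p where "p = zor_poly \<omega> z0"
  have "\<omega> holomorphic_on ball z0 R0" using assms(2) R0(2) by (rule holomorphic_on_subset)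
  then obtain r where r: "0 < r" "cball z0 r \<subseteq> ball z0 R0" "p holomorphic_on cball z0 r"
    "\<And>w. w \<in> cball z0 r \<Longrightarrow> \<omega> w = p w * (w - z0) ^ n \<and> p w \<noteq> 0" and zp: "0 < zorder \<omega> z0"
  proof -
    have "z0 \<in> ball z0 R0" "\<exists>w\<in>ball z0 R0. \<omega> w \<noteq> 0" using R0(1) near[OF R0(1)] by auto
    from zorder_exist_zero[OF \<open>\<omega> holomorphic_on ball z0 R0\<close> open_ball connected_ball this] that z(1)
    show thesis unfolding n_def p_def by auto
  qed
  have "even n" "0 < n" using z(3) zp by (auto simp: n_def even_nat_iff)
  then obtain k where k: "n = 2 * k" "0 < k" by (auto elim: evenE)
  let ?B = "ball z0 r"
  have pB: "p holomorphic_on ?B" using r(3) ball_subset_cball holomorphic_on_subset by blast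
  have pw: "p w \<noteq> 0" "\<omega> w = p w * (w - z0) ^ n" if "w \<in> ?B" for w
    using r(4)[of w] that by auto
  obtain L where L: "L holomorphic_on ?B" "\<And>w. w \<in> ?B \<Longrightarrow> exp (L w) = p w"
    using holomorphic_logarithm_exists[OF convex_ball open_ball pB pw(1), of z0] r(1) by auto
  define g where "g w = (w - z0) ^ k * exp (L w / 2)" for w
  have gh: "g holomorphic_on ?B" unfolding g_def by (intro holomorphic_intros L(1)) auto
  have g2: "(g w)\<^sup>2 = \<omega> w" if "w \<in> ?B" for w
  proof -
    have "(exp (L w / 2))\<^sup>2 = exp (L w)" by (simp add: exp_double[symmetric])
    then show ?thesis using pw(2)[OF that] L(2)[OF that] k
      by (simp add: g_def power_mult_distrib power_mult[symmetric] mult.commute)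
  qed
  obtain G0 where G0: "\<And>w. w \<in> ?B \<Longrightarrow> (G0 has_field_derivative g w) (at w within ?B)"
    using holomorphic_convex_primitive'[OF convex_ball open_ball gh] by blast
  define G where "G w = G0 w - G0 z0" for w
  have GD: "(G has_field_derivative g w) (at w)" if "w \<in> ?B" for w
    using G0[OF that] that at_within_open[OF that open_ball] unfolding G_def
    by (auto intro!: derivative_eq_intros)
  have Gh: "G holomorphic_on ?B" using GD unfolding holomorphic_on_open[OF open_ball] by blast
  have dG: "deriv G w = g w" if "w \<in> ?B" for w using GD[OF that] by (rule DERIV_imp_deriv)
  show ?thesis
  proof (rule that[OF r(1) _ Gh])
    show "cball z0 r \<subseteq> \<Omega>" using r(2) R0(2) by blast
    show "(deriv G w)\<^sup>2 = \<omega> w" if "w \<in> ?B" for w using dG[OF that] g2[OF that] by simp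
    show "G z0 = 0" by (simp add: G_def)
    show "deriv G z0 = 0" using dG[of z0] r(1) k by (simp add: g_def)
    show "\<exists>w\<in>?B. G w \<noteq> 0"
    proof (rule ccontr)
      assume "\<not> ?thesis"
      then have G00: "G w = 0" if "w \<in> ?B" for w using that by blast
      obtain w where w: "w \<in> ?B" "\<omega> w \<noteq> 0" using near[OF r(1)] by blast
      have "((\<lambda>_. 0) has_field_derivative 0) (at w)" by simp
      then have "(G has_field_derivative 0) (at w)"
        by (rule has_field_derivative_transform_within_open[OF _ open_ball w(1)]) (simp add: G00)
      then have "deriv G w = 0" by (rule DERIV_imp_deriv)
      then show False using dG[OF w(1)] g2[OF w(1)] w(2) by simp
    qed
  qed
qed

text \<open>
  The branch of the inverse of \<open>\<zeta> \<mapsto> (-1)\<^sup>j \<zeta>\<^sup>m\<close> whose values lie around the direction \<open>\<pi>j/m\<close>. With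
  this sign the right half plane corresponds, for every \<open>j\<close>, to the sector of opening \<open>\<pi>/m\<close> centred
  at that direction; the quadrants of the left half plane correspond to the adjacent halves of the
  two neighbouring sectors.
\<close>

definition root_branch :: "nat \<Rightarrow> nat \<Rightarrow> complex \<Rightarrow> complex" where
  "root_branch m j w = cis (pi * real j / real m) * exp (Ln w / of_nat m)"

lemma root_branch_power:
  assumes "0 < m" "w \<noteq> 0" shows "root_branch m j w ^ m = (-1) ^ j * w"
proof -
  have "cis (pi * real j / real m) ^ m = cis (real j * pi)"
    by (subst Complex.DeMoivre) (use assms(1) in \<open>simp add: mult.commute\<close>)
  also have "\<dots> = (cis pi) ^ j" by (simp only: Complex.DeMoivre)
  also have "\<dots> = (-1) ^ j" by simp
  finally have 1: "cis (pi * real j / real m) ^ m = (-1) ^ j" .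
  have "exp (Ln w / of_nat m) ^ m = exp (Ln w)" using assms(1) by (simp add: exp_of_nat_mult[symmetric])
  with assms 1 show ?thesis by (simp add: root_branch_def power_mult_distrib)
qed

lemma norm_root_branch_power:
  assumes "0 < m" "w \<noteq> 0" shows "norm (root_branch m j w) ^ m = norm w"
  using arg_cong[OF root_branch_power[OF assms, of j], of norm] by (simp add: norm_power norm_mult)

lemma root_branch_holomorphic: "S \<inter> \<real>\<^sub>\<le>\<^sub>0 = {} \<Longrightarrow> root_branch m j holomorphic_on S"
  unfolding root_branch_def[abs_def] by (cases "m = 0") (auto intro!: holomorphic_intros)

text \<open>
  In the upper half plane \<open>Ln (- w) = Ln w - \<i>\<pi>\<close>, and the factor lost here is the rotation from the
  sector \<open>j\<close> to the sector \<open>j + 1\<close>.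
\<close>

lemma root_branch_Suc:
  assumes "0 < m" "0 < Im w" shows "root_branch m j w = root_branch m (Suc j) (- w)"
proof -
  have "Ln (- w) = Ln w - \<i> * pi" using assms(2) Ln_minus[of w] by (cases "w = 0") auto
  then have "exp (Ln (- w) / of_nat m) = exp (Ln w / of_nat m) * exp (- (\<i> * (pi / real m)))"
    by (simp add: exp_add[symmetric] diff_divide_distrib)
  moreover have "cis (pi * real (Suc j) / real m) = cis (pi * real j / real m) * exp (\<i> * (pi / real m))"
    by (simp add: cis_conv_exp exp_add[symmetric] algebra_simps add_divide_distrib)
  ultimately show ?thesis
    by (simp add: root_branch_def exp_minus)
qed

text \<open>
  The angle of \<open>\<zeta>\<close> is a multiple \<open>x\<close> of \<open>\<pi>/m\<close>, and \<open>j\<close> is the integer nearest to \<open>x\<close>. A tie is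
  rounded down, so that a point on the common boundary of two sectors is the upper boundary of the
  first one. The indices \<open>0\<close> and \<open>2 * m\<close> denote the same sector.
\<close>

lemma root_branch_cover:
  assumes "0 < m" "\<zeta> \<noteq> 0"
  obtains j w where "j \<le> 2 * m" "\<zeta> = root_branch m j w" "w \<noteq> 0" "0 < Re w \<or> Re w = 0 \<and> 0 < Im w"
proof -
  define \<phi> where "\<phi> = Arg2pi \<zeta>"
  have \<phi>: "0 \<le> \<phi>" "\<phi> < 2 * pi" "\<zeta> = of_real (norm \<zeta>) * exp (\<i> * of_real \<phi>)"
    using Arg2pi[of \<zeta>] by (auto simp: \<phi>_def is_Arg_def)
  define x where "x = \<phi> * real m / pi"
  have x: "0 \<le> x" "x < 2 * real m" using \<phi> assms(1) by (auto simp: x_def field_simps)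
  define j where "j = nat \<lceil>x - 1 / 2\<rceil>"
  have "0 \<le> \<lceil>x - 1 / 2\<rceil>" using x(1) by linarith
  then have jr: "real j = of_int \<lceil>x - 1 / 2\<rceil>" by (simp add: j_def)
  have j: "x - 1 / 2 \<le> real j" "real j < x + 1 / 2" unfolding jr by linarith+
  have j2: "j \<le> 2 * m" using j(2) x(2) by linarith
  define \<alpha> where "\<alpha> = (x - real j) * pi"
  have "x - real j \<le> 1 / 2" "- (1 / 2) < x - real j" using j by auto
  then have "(x - real j) * pi \<le> 1 / 2 * pi" "- (1 / 2) * pi < (x - real j) * pi"
    by (intro mult_right_mono mult_strict_right_mono; simp)+
  then have \<alpha>: "- (pi / 2) < \<alpha>" "\<alpha> \<le> pi / 2" by (auto simp: \<alpha>_def)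
  define w where "w = of_real (norm \<zeta> ^ m) * cis \<alpha>"
  have w0: "w \<noteq> 0" using assms by (simp add: w_def)
  have pos: "0 < norm \<zeta> ^ m" using assms by simp
  have Lw: "Ln w = of_real (real m * ln (norm \<zeta>)) + \<i> * of_real \<alpha>"
  proof -
    have "w = exp (of_real (real m * ln (norm \<zeta>)) + \<i> * of_real \<alpha>)"
      unfolding w_def exp_add cis_conv_exp exp_of_real using assms
      by (simp add: exp_of_nat_mult)
    moreover have "Ln (exp (of_real (real m * ln (norm \<zeta>)) + \<i> * of_real \<alpha>)) = of_real (real m * ln (norm \<zeta>)) + \<i> * of_real \<alpha>"
      by (intro Ln_exp) (use \<alpha> pi_gt_zero in auto)
    ultimately show ?thesis by simp
  qed
  have "root_branch m j w = cis (pi * real j / real m) * (of_real (norm \<zeta>) * cis (\<alpha> / real m))"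
    unfolding root_branch_def Lw using assms
    by (simp add: add_divide_distrib exp_add cis_conv_exp exp_of_real)
  also have "\<dots> = of_real (norm \<zeta>) * cis (pi * real j / real m + \<alpha> / real m)"
    by (simp add: cis_mult mult.left_commute)
  also have "pi * real j / real m + \<alpha> / real m = \<phi>"
    using assms(1) by (simp add: \<alpha>_def x_def field_simps)
  also have "of_real (norm \<zeta>) * cis \<phi> = \<zeta>" using \<phi>(3) by (simp add: cis_conv_exp)
  finally have \<zeta>: "\<zeta> = root_branch m j w" by simp
  have "0 < Re w \<or> Re w = 0 \<and> 0 < Im w"
  proof (cases "\<alpha> = pi / 2")
    case True
    have "cos \<alpha> = 0" "sin \<alpha> = 1" unfolding True by simp_all
    then show ?thesis using pos by (simp add: w_def)
  next
    case False
    then have "0 < cos \<alpha>" using \<alpha> by (intro cos_gt_zero_pi) auto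
    then show ?thesis using pos by (simp add: w_def)
  qed
  with j2 \<zeta> w0 show ?thesis using that by blast
qed

lemma root_branch_imaginary:
  assumes "0 < m" "0 < s"
  shows "root_branch m j (Complex 0 (s ^ m)) =
    cis (pi * real j / real m + pi / (2 * real m)) * of_real s"
proof -
  have "Complex 0 (s ^ m) = exp (of_real (real m * ln s) + \<i> * of_real (pi / 2))"
    unfolding exp_add exp_of_real cis_conv_exp[symmetric] using assms
    by (simp add: exp_of_nat_mult complex_eq_iff)
  moreover have "Ln (exp (of_real (real m * ln s) + \<i> * of_real (pi / 2))) = of_real (real m * ln s) + \<i> * of_real (pi / 2)"
    by (intro Ln_exp) (use pi_gt_zero in auto)
  ultimately have L: "Ln (Complex 0 (s ^ m)) = of_real (real m * ln s) + \<i> * of_real (pi / 2)" by simp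
  have "exp (Ln (Complex 0 (s ^ m)) / of_nat m) = of_real s * cis (pi / (2 * real m))"
    unfolding L using assms by (simp add: add_divide_distrib exp_add cis_conv_exp exp_of_real)
  then show ?thesis by (simp add: root_branch_def cis_mult[symmetric] mult.assoc mult.left_commute)
qed

section \<open>Structure near the zero\<close>

text \<open>
  In the coordinate \<open>\<zeta>\<close> with inverse \<open>K\<close> the primitive \<open>G\<close> of a square root of \<open>\<omega>\<close> is \<open>\<zeta>\<^sup>m\<close>. The
  compact set \<open>C\<close> keeps \<open>h\<close> bounded and the mass of \<open>\<mu>\<close> finite.
\<close>

locale even_zero = stationary_harmonic_function +
  fixes z0 :: complex and m :: nat and \<rho> :: real and G K :: "complex \<Rightarrow> complex" and C :: "complex set"
  assumes m2: "2 \<le> m" and rho: "0 < \<rho>"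
    and K_holomorphic: "K holomorphic_on ball 0 \<rho>" and K_0: "K 0 = z0" and K_inj: "inj_on K (ball 0 \<rho>)"
    and K_deriv: "\<And>w. w \<in> ball 0 \<rho> \<Longrightarrow> deriv K w \<noteq> 0"
    and C: "compact C" "C \<subseteq> \<Omega>" "K ` ball 0 \<rho> \<subseteq> C"
    and G_holomorphic: "G holomorphic_on K ` ball 0 \<rho>"
    and G_square: "\<And>z. z \<in> K ` ball 0 \<rho> \<Longrightarrow> (deriv G z)\<^sup>2 = \<omega> z"
    and G_K: "\<And>w. w \<in> ball 0 \<rho> \<Longrightarrow> G (K w) = w ^ m"
    and h_z0: "h z0 = 0" and G'_z0: "deriv G z0 = 0"
begin

lemma m_pos: "0 < m" using m2 by simp

lemma K_image_open: "open S \<Longrightarrow> S \<subseteq> ball 0 \<rho> \<Longrightarrow> open (K ` S)"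
  using open_mapping_thm3[of K S] holomorphic_on_subset[OF K_holomorphic] inj_on_subset[OF K_inj] by blast

lemma K_in_Omega: "w \<in> ball 0 \<rho> \<Longrightarrow> K w \<in> \<Omega>" using C by blast

definition branch :: "nat \<Rightarrow> complex \<Rightarrow> complex" where "branch j w = K (root_branch m j w)"

lemma root_branch_in_ball:
  assumes "w \<noteq> 0" "norm w < \<rho> ^ m" shows "root_branch m j w \<in> ball 0 \<rho>"
proof -
  have "norm (root_branch m j w) ^ m < \<rho> ^ m" using norm_root_branch_power[OF m_pos assms(1)] assms(2) by simp
  then have "norm (root_branch m j w) < \<rho>" by (rule power_less_imp_less_base) (use rho in simp)
  then show ?thesis by simp
qed

lemma G_branch:
  assumes "w \<noteq> 0" "norm w < \<rho> ^ m" shows "(-1) ^ j * G (branch j w) = w"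
  using G_K[OF root_branch_in_ball[OF assms]] root_branch_power[OF m_pos assms(1), of j]
  by (simp add: branch_def mult.assoc[symmetric] power_mult_distrib[symmetric])

lemma branch_holomorphic:
  assumes "S \<inter> \<real>\<^sub>\<le>\<^sub>0 = {}" "\<And>w. w \<in> S \<Longrightarrow> norm w < \<rho> ^ m"
  shows "branch j holomorphic_on S"
proof -
  have "0 \<notin> S" using assms(1) by auto
  then have "root_branch m j ` S \<subseteq> ball 0 \<rho>" using root_branch_in_ball assms(2) by (metis image_subsetI)
  then have "(K \<circ> root_branch m j) holomorphic_on S"
    by (intro holomorphic_on_compose_gen[OF root_branch_holomorphic[OF assms(1)] K_holomorphic])
  then show ?thesis by (simp add: branch_def[abs_def] o_def)
qed

lemma branch_open:
  assumes "S \<inter> \<real>\<^sub>\<le>\<^sub>0 = {}" "\<And>w. w \<in> S \<Longrightarrow> norm w < \<rho> ^ m" "open S"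
  shows "open (branch j ` S)" "inj_on (branch j) S"
proof -
  have "0 \<notin> S" using assms(1) by auto
  then have "branch j w = branch j w' \<Longrightarrow> w = w'" if "w \<in> S" "w' \<in> S" for w w'
    using G_branch[of w j] G_branch[of w' j] assms(2) that by metis
  then show i: "inj_on (branch j) S" by (rule inj_onI)
  show "open (branch j ` S)" by (rule open_mapping_thm3[OF branch_holomorphic[OF assms(1,2)] assms(3) i])
qed

lemma chart_branch:
  assumes S: "rect l r c d \<inter> \<real>\<^sub>\<le>\<^sub>0 = {}" "\<And>w. w \<in> rect l r c d \<Longrightarrow> norm w < \<rho> ^ m"
  shows "chart (branch j ` rect l r c d) (\<lambda>z. (-1) ^ j * G z) l r c d"
proof -
  let ?W = "rect l r c d" and ?U = "branch j ` rect l r c d" and ?G = "\<lambda>z. (-1) ^ j * G z"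
  have n0: "w \<noteq> 0" if "w \<in> ?W" for w using S(1) that by auto
  have UB: "?U \<subseteq> K ` ball 0 \<rho>" using root_branch_in_ball[OF n0 S(2)] by (auto simp: branch_def)
  have Ginv: "?G (branch j w) = w" if "w \<in> ?W" for w using G_branch[OF n0 S(2)] that by blast
  have UO: "open ?U" by (rule branch_open(1)[OF S open_box])
  have Gh: "G holomorphic_on ?U" using G_holomorphic UB by (rule holomorphic_on_subset)
  show ?thesis unfolding chart_def
  proof (intro conjI ballI)
    show "open ?U" by (rule UO)
    show "?U \<subseteq> \<Omega>" using UB C by blast
    have "compact (h ` C)" using h_continuous C by (intro compact_continuous_image) (auto intro: continuous_on_subset)
    then show "bounded (h ` ?U)" using UB C(3) by (intro bounded_subset[OF compact_imp_bounded]) auto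
    show "?G holomorphic_on ?U" by (intro holomorphic_intros Gh)
    show "inj_on ?G ?U" by (rule inj_on_inverseI[of _ "branch j"]) (use Ginv in auto)
    show "?G ` ?U = ?W" unfolding image_image using Ginv by simp
    fix z assume z: "z \<in> ?U"
    have "deriv ?G z = (-1) ^ j * deriv G z"
      using holomorphic_on_imp_differentiable_at[OF Gh UO z] by (rule deriv_cmult)
    then show "(deriv ?G z)\<^sup>2 = \<omega> z" using G_square[of z] UB z
      by (auto simp: power_mult_distrib power_mult[symmetric])
  qed
qed

lemma branch_tendsto_z0: "((\<lambda>x. branch j (of_real x)) \<longlongrightarrow> z0) (at_right 0)"
proof -
  have "norm (root_branch m j (of_real x)) = root m x" if "0 < x" for x
    using norm_root_branch_power[OF m_pos, of "of_real x" j] that m_pos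
    by (intro real_root_pos_unique[symmetric]) auto
  then have e: "\<forall>\<^sub>F x in at_right 0. root m x = norm (root_branch m j (of_real x))"
    by (auto simp: eventually_at_filter)
  have "((\<lambda>x. root m x) \<longlongrightarrow> root m 0) (at_right 0)"
    by (intro tendsto_real_root tendsto_ident_at)
  then have "((\<lambda>x. norm (root_branch m j (of_real x))) \<longlongrightarrow> 0) (at_right 0)"
    using tendsto_cong[OF e] by simp
  then have "((\<lambda>x. root_branch m j (of_real x)) \<longlongrightarrow> 0) (at_right 0)" by (rule tendsto_norm_zero_cancel)
  moreover have "isCont K 0"
    using holomorphic_on_imp_continuous_on[OF K_holomorphic] rho by (simp add: continuous_on_eq_continuous_at)
  ultimately show ?thesis unfolding branch_def K_0[symmetric] by (rule isCont_tendsto_compose[rotated])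
qed

lemma norm_rect_less:
  assumes "2 * r \<le> \<rho> ^ m" "\<bar>Re w\<bar> < r" "\<bar>Im w\<bar> < r" shows "norm w < \<rho> ^ m"
  using cmod_le[of w] assms by linarith

text \<open>
  In a sector \<open>h\<close> is affine in \<open>Re w\<close> near the line \<open>Re w = 0\<close>. The constant term is \<open>0\<close> by continuity,
  because the points of the positive axis tend to \<open>z0\<close>, where \<open>h\<close> vanishes.
\<close>

lemma sector_slope:
  obtains \<delta> \<sigma> where "0 < \<delta>" "\<delta> \<le> \<rho> ^ m / 2" "\<sigma> = 1 \<or> \<sigma> = -1"
    "\<And>w. 0 < Re w \<Longrightarrow> Re w < \<delta> \<Longrightarrow> \<bar>Im w\<bar> < \<rho> ^ m / 2 \<Longrightarrow> h (branch j w) = \<sigma> * Re w"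
proof -
  define R where "R = \<rho> ^ m / 2"
  have R: "0 < R" "2 * R \<le> \<rho> ^ m" using rho by (auto simp: R_def)
  have sl: "rect 0 R (-R) R \<inter> \<real>\<^sub>\<le>\<^sub>0 = {}" by (auto simp: in_box_complex_iff complex_nonpos_Reals_iff)
  have nw: "norm w < \<rho> ^ m" if "w \<in> rect 0 R (-R) R" for w
    using norm_rect_less[OF R(2), of w] that by (auto simp: in_box_complex_iff)
  have ch: "chart (branch j ` rect 0 R (-R) R) (\<lambda>z. (-1) ^ j * G z) 0 R (-R) R"
    by (rule chart_branch[OF sl nw])
  have sub: "branch j ` rect 0 R (-R) R \<subseteq> C"
  proof (rule image_subsetI)
    fix w assume w: "w \<in> rect 0 R (-R) R"
    then have "w \<noteq> 0" by (auto simp: in_box_complex_iff)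
    then show "branch j w \<in> C" using root_branch_in_ball[OF _ nw[OF w]] C(3) unfolding branch_def by blast
  qed
  obtain \<delta> \<sigma> k where s: "0 < \<delta>" "\<delta> \<le> R" "\<sigma> = 1 \<or> \<sigma> = -1"
    "\<And>z. z \<in> branch j ` rect 0 R (-R) R \<Longrightarrow> Re ((-1) ^ j * G z) < \<delta> \<Longrightarrow> h z = \<sigma> * Re ((-1) ^ j * G z) + k"
  proof (rule sector_affine[OF ch R(1) _ C(1) sub C(2)])
    show "- R < R" using R(1) by simp
  qed (erule that, assumption, assumption, blast)
  have hw: "h (branch j w) = \<sigma> * Re w + k" if w: "0 < Re w" "Re w < \<delta>" "\<bar>Im w\<bar> < R" for w
  proof -
    have W: "w \<in> rect 0 R (-R) R" using w s(2) by (auto simp: in_box_complex_iff)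
    have "w \<noteq> 0" using w(1) by auto
    then have "(-1) ^ j * G (branch j w) = w" by (rule G_branch[OF _ nw[OF W]])
    with s(4)[OF imageI[OF W]] w(2) show ?thesis by simp
  qed
  have "isCont h z0"
    using h_continuous K_in_Omega[of 0] rho open_Omega K_0 by (simp add: continuous_on_eq_continuous_at)
  then have "((\<lambda>x. h (branch j (of_real x))) \<longlongrightarrow> h z0) (at_right 0)"
    using branch_tendsto_z0 by (rule isCont_tendsto_compose)
  moreover have "((\<lambda>x. h (branch j (of_real x))) \<longlongrightarrow> \<sigma> * 0 + k) (at_right 0)"
  proof (rule Lim_transform_eventually)
    show "((\<lambda>x. \<sigma> * x + k) \<longlongrightarrow> \<sigma> * 0 + k) (at_right 0)" by (intro tendsto_intros)
    have "\<forall>\<^sub>F x in at_right (0::real). x \<in> {0<..<\<delta>}" using s(1) by (rule eventually_at_right_real)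
    then show "\<forall>\<^sub>F x in at_right 0. \<sigma> * x + k = h (branch j (of_real x))"
      by eventually_elim (use hw R(1) in auto)
  qed
  ultimately have "k = 0" using h_z0 tendsto_unique[OF trivial_limit_at_right_real] by fastforce
  with s hw show ?thesis using that[of \<delta> \<sigma>] unfolding R_def by simp
qed

text \<open>
  The indices go up to \<open>2 * m + 1\<close> since the sectors \<open>j \<le> 2 * m\<close> are compared with their successors.
\<close>

lemma uniform_radius:
  obtains r \<sigma> where "0 < r" "2 * r \<le> \<rho> ^ m" "\<And>j. \<sigma> j = 1 \<or> \<sigma> j = -1"
    "\<And>j w. j \<le> 2 * m + 1 \<Longrightarrow> w \<in> rect 0 r (-r) r \<Longrightarrow> h (branch j w) = \<sigma> j * Re w"
proof -
  have "\<forall>j. \<exists>\<delta> \<sigma>. 0 < \<delta> \<and> \<delta> \<le> \<rho> ^ m / 2 \<and> (\<sigma> = 1 \<or> \<sigma> = -1) \<and>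
    (\<forall>w. 0 < Re w \<longrightarrow> Re w < \<delta> \<longrightarrow> \<bar>Im w\<bar> < \<rho> ^ m / 2 \<longrightarrow> h (branch j w) = \<sigma> * Re w)"
    using sector_slope by metis
  then obtain \<delta> \<sigma> where s: "\<And>j. 0 < \<delta> j" "\<And>j. \<delta> j \<le> \<rho> ^ m / 2" "\<And>j. \<sigma> j = 1 \<or> \<sigma> j = -1"
    "\<And>j w. 0 < Re w \<Longrightarrow> Re w < \<delta> j \<Longrightarrow> \<bar>Im w\<bar> < \<rho> ^ m / 2 \<Longrightarrow> h (branch j w) = \<sigma> j * Re w"
    by metis
  define r where "r = Min (\<delta> ` {..2 * m + 1})"
  have rj: "r \<le> \<delta> j" if "j \<le> 2 * m + 1" for j unfolding r_def using that by (intro Min_le) auto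
  have "0 < r" unfolding r_def using s(1) by (subst Min_gr_iff) auto
  moreover have "2 * r \<le> \<rho> ^ m" using rj[of 0] s(2)[of 0] by auto
  moreover have "h (branch j w) = \<sigma> j * Re w" if "j \<le> 2 * m + 1" "w \<in> rect 0 r (-r) r" for j w
    using that rj[OF that(1)] s(2)[of j] by (intro s(4)) (auto simp: in_box_complex_iff)
  ultimately show ?thesis using s(3) that by blast
qed

end

text \<open>
  On the sector \<open>j\<close> we have \<open>h = (-1)\<^sup>j \<sigma>\<^sub>j Re G\<close> with \<open>\<sigma>\<^sub>j = \<plusminus>1\<close>.
\<close>

locale even_zero_neighbourhood = even_zero +
  fixes r :: real and \<sigma> :: "nat \<Rightarrow> real"
  assumes r: "0 < r" "2 * r \<le> \<rho> ^ m"
    and \<sigma>: "\<And>j. \<sigma> j = 1 \<or> \<sigma> j = -1"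
    and slope: "\<And>j w. j \<le> 2 * m + 1 \<Longrightarrow> w \<in> rect 0 r (-r) r \<Longrightarrow> h (branch j w) = \<sigma> j * Re w"
begin

abbreviation "R \<equiv> rect (-r) r (-r) r"

lemma R_norm: "w \<in> R \<Longrightarrow> norm w < \<rho> ^ m"
  using norm_rect_less[OF r(2)] by (auto simp: in_box_complex_iff)

text \<open>
  The preimage of a square, and not a disc, so that every sector is mapped by \<open>\<plusminus>G\<close> onto a rectangle.
\<close>

definition V :: "complex set" where "V = K ` {\<zeta> \<in> ball 0 \<rho>. \<zeta> ^ m \<in> R}"

lemma V_open: "open V"
proof -
  have "open (ball 0 \<rho> \<inter> (\<lambda>\<zeta>. \<zeta> ^ m) -` R)"
    by (rule continuous_open_preimage) (auto intro!: continuous_intros)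
  moreover have "ball 0 \<rho> \<inter> (\<lambda>\<zeta>. \<zeta> ^ m) -` R = {\<zeta> \<in> ball 0 \<rho>. \<zeta> ^ m \<in> R}" by auto
  ultimately show ?thesis unfolding V_def by (intro K_image_open) auto
qed

lemma V_subset: "V \<subseteq> K ` ball 0 \<rho>" "V \<subseteq> \<Omega>"
  unfolding V_def using K_in_Omega by auto

lemma G_z0: "G z0 = 0" using G_K[of 0] rho K_0 m_pos by simp

lemma z0_in_V: "z0 \<in> V"
  unfolding V_def by (rule image_eqI[of _ _ 0]) (use rho r m_pos K_0 in \<open>auto simp: in_box_complex_iff zero_power\<close>)

lemma sign_mult_R: "w \<in> R \<Longrightarrow> (-1) ^ j * w \<in> R"
  by (cases "even j") (auto simp: in_box_complex_iff)

lemma branch_in_V: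
  assumes "w \<in> R" "w \<noteq> 0" shows "branch j w \<in> V"
  unfolding V_def branch_def
  using root_branch_in_ball[OF assms(2) R_norm[OF assms(1)]] root_branch_power[OF m_pos assms(2)]
    sign_mult_R[OF assms(1)] by auto

lemma V_cover:
  assumes "z \<in> V" "z \<noteq> z0"
  obtains j w where "j \<le> 2 * m" "z = branch j w" "w \<in> R" "0 < Re w \<or> Re w = 0 \<and> 0 < Im w"
proof -
  obtain \<zeta> where \<zeta>: "\<zeta> \<in> ball 0 \<rho>" "\<zeta> ^ m \<in> R" "z = K \<zeta>" using assms(1) by (auto simp: V_def)
  then have "\<zeta> \<noteq> 0" using assms(2) K_0 by auto
  then obtain j w where jw: "j \<le> 2 * m" "\<zeta> = root_branch m j w" "w \<noteq> 0" "0 < Re w \<or> Re w = 0 \<and> 0 < Im w"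
    using root_branch_cover[OF m_pos] by metis
  have "(-1) ^ j * \<zeta> ^ m = w"
    using root_branch_power[OF m_pos jw(3), of j] jw(2) by (simp add: mult.assoc[symmetric] power_mult_distrib[symmetric])
  then have "w \<in> R" using sign_mult_R[OF \<zeta>(2), of j] by simp
  with jw \<zeta>(3) show ?thesis using that by (auto simp: branch_def)
qed

lemma h_left:
  assumes "j \<le> 2 * m" "w \<in> R" "Re w < 0" "0 < Im w"
  shows "h (branch j w) = - \<sigma> (Suc j) * Re w"
proof -
  have "branch j w = branch (Suc j) (- w)" unfolding branch_def root_branch_Suc[OF m_pos assms(4)] ..
  then show ?thesis using slope[of "Suc j" "- w"] assms by (simp add: in_box_complex_iff)
qed

lemma h_axis:
  assumes "j \<le> 2 * m" "w \<in> R" "Re w = 0" "0 < Im w"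
  shows "h (branch j w) = 0"
proof -
  let ?S = "rect (-r) r 0 r"
  have S: "?S \<inter> \<real>\<^sub>\<le>\<^sub>0 = {}" "\<And>w. w \<in> ?S \<Longrightarrow> norm w < \<rho> ^ m"
    using R_norm by (auto simp: in_box_complex_iff complex_nonpos_Reals_iff)
  have "continuous_on ?S (\<lambda>w. h (branch j w))"
  proof (rule continuous_on_compose2[OF h_continuous])
    show "continuous_on ?S (branch j)" by (rule holomorphic_on_imp_continuous_on[OF branch_holomorphic[OF S]])
    show "branch j ` ?S \<subseteq> \<Omega>" by (rule chartD(2)[OF chart_branch[OF S]])
  qed
  moreover have wS: "w \<in> ?S" using assms by (auto simp: in_box_complex_iff)
  ultimately have "isCont (\<lambda>w. h (branch j w)) w"
    using continuous_on_eq_continuous_at[OF open_box] by blast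
  moreover have "((\<lambda>x. w + of_real x) \<longlongrightarrow> w + of_real 0) (at_right 0)" by (intro tendsto_intros)
  ultimately have "((\<lambda>x. h (branch j (w + of_real x))) \<longlongrightarrow> h (branch j w)) (at_right 0)"
    by (intro isCont_tendsto_compose[of w "\<lambda>w. h (branch j w)"]) auto
  moreover have "((\<lambda>x. h (branch j (w + of_real x))) \<longlongrightarrow> \<sigma> j * 0) (at_right 0)"
  proof (rule Lim_transform_eventually)
    show "((\<lambda>x. \<sigma> j * x) \<longlongrightarrow> \<sigma> j * 0) (at_right 0)" by (intro tendsto_intros)
    have "\<forall>\<^sub>F x in at_right (0::real). x \<in> {0<..<r}" using r(1) by (rule eventually_at_right_real)
    then show "\<forall>\<^sub>F x in at_right 0. \<sigma> j * x = h (branch j (w + of_real x))"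
      by eventually_elim (use slope assms in \<open>auto simp: in_box_complex_iff\<close>)
  qed
  ultimately show ?thesis using tendsto_unique[OF trivial_limit_at_right_real] by fastforce
qed

lemma h_eq_abs:
  assumes "z \<in> V" shows "h z = Re (G z) \<or> h z = - Re (G z)"
proof (cases "z = z0")
  case True then show ?thesis using h_z0 G_z0 by simp
next
  case False
  with assms obtain j w where jw: "j \<le> 2 * m" "z = branch j w" "w \<in> R" "0 < Re w \<or> Re w = 0 \<and> 0 < Im w"
    by (rule V_cover)
  have "w \<noteq> 0" using jw(4) by auto
  then have w: "(-1) ^ j * G z = w" unfolding jw(2) by (rule G_branch[OF _ R_norm[OF jw(3)]])
  then have *: "Re w = (-1) ^ j * Re (G z)" by (cases "even j") auto
  have "h z = \<sigma> j * Re w"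
  proof (cases "0 < Re w")
    case True
    then show ?thesis using slope[of j w] jw by (auto simp: in_box_complex_iff)
  next
    case False
    then show ?thesis using h_axis[of j w] jw by auto
  qed
  then show ?thesis using * \<sigma>[of j] by (cases "even j") auto
qed

text \<open>
  The boundary between the sectors \<open>j\<close> and \<open>j + 1\<close>, parametrised linearly in the coordinate \<open>\<zeta>\<close>; so
  it is smooth and regular up to its end point \<open>z0\<close>.
\<close>

definition ray :: "nat \<Rightarrow> real \<Rightarrow> complex" where
  "ray j t = K (of_real (root m r) * cis (pi * real j / real m + pi / (2 * real m)) * of_real t)"

lemma root_r: "0 < root m r" "root m r ^ m = r"
  using r m_pos by auto

lemma root_r_less: "root m r < \<rho>"
proof -
  have "root m r ^ m < \<rho> ^ m" using root_r(2) r by simp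
  then show ?thesis by (rule power_less_imp_less_base) (use rho in simp)
qed

lemma ray_in_ball:
  assumes "t \<in> {0..<1}"
  shows "of_real (root m r) * cis a * of_real t \<in> ball 0 \<rho>"
proof -
  have "root m r * t \<le> root m r" using assms root_r(1) by (intro mult_left_le) auto
  then have "root m r * t < \<rho>" using root_r_less by linarith
  moreover have "norm (of_real (root m r) * cis a * of_real t) = root m r * t"
    using assms root_r(1) by (simp add: norm_mult)
  ultimately show ?thesis by simp
qed

lemma ray_eq_branch:
  assumes "0 < t" shows "ray j t = branch j (Complex 0 (r * t ^ m))"
proof -
  have "r * t ^ m = (root m r * t) ^ m" using root_r(2) by (simp add: power_mult_distrib)
  then show ?thesis
    using root_branch_imaginary[OF m_pos, of "root m r * t" j] assms root_r(1)
    by (simp add: ray_def branch_def mult_ac)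
qed

lemma ray_point:
  assumes "0 < t" "t < 1" shows "Complex 0 (r * t ^ m) \<in> R" "0 < r * t ^ m"
proof -
  have "t ^ m < 1" using assms m_pos by (simp add: power_less_one_iff)
  then have "r * t ^ m < r" "0 < r * t ^ m" using r(1) assms by auto
  then show "Complex 0 (r * t ^ m) \<in> R" "0 < r * t ^ m" by (auto simp: in_box_complex_iff)
qed

lemma ray_0: "ray j 0 = z0" by (simp add: ray_def K_0)

lemma ray_image:
  assumes "t \<in> {0..<1}" shows "ray j t \<in> V" "Re (G (ray j t)) = 0"
proof -
  have "ray j t \<in> V \<and> Re (G (ray j t)) = 0"
  proof (cases "t = 0")
    case True then show ?thesis using z0_in_V G_z0 by (simp add: ray_0)
  next
    case False
    then have t: "0 < t" "t < 1" using assms by auto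
    let ?w = "Complex 0 (r * t ^ m)"
    have w: "?w \<in> R" "?w \<noteq> 0"
      using ray_point[OF t] by (auto simp only: complex_eq_iff complex.sel zero_complex.sel)
    have "(-1) ^ j * G (branch j ?w) = ?w" by (rule G_branch[OF w(2) R_norm[OF w(1)]])
    then have "Re ((-1) ^ j * G (branch j ?w)) = 0" by simp
    then have "Re (G (branch j ?w)) = 0" by (cases "even j") auto
    then show ?thesis using branch_in_V[OF w] ray_eq_branch[OF t(1)] by simp
  qed
  then show "ray j t \<in> V" "Re (G (ray j t)) = 0" by auto
qed

lemma ray_smooth: "smooth_curve_ending_at z0 (ray j)"
proof -
  define \<alpha> where "\<alpha> = of_real (root m r) * cis (pi * real j / real m + pi / (2 * real m))"
  have \<alpha>0: "\<alpha> \<noteq> 0" using root_r by (simp add: \<alpha>_def)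
  have in_ball: "\<alpha> * of_real t \<in> ball 0 \<rho>" if "t \<in> {0..<1}" for t
    unfolding \<alpha>_def using ray_in_ball[OF that] .
  define D where "D n t = (deriv ^^ n) K (\<alpha> * of_real t) * \<alpha> ^ n" for n t
  have D0: "D 0 = ray j" by (simp add: D_def ray_def \<alpha>_def fun_eq_iff)
  have DD: "(D n has_vector_derivative D (Suc n) t) (at t within {0..<1})" if t: "t \<in> {0..<1}" for n t
  proof -
    have "(deriv ^^ n) K holomorphic_on ball 0 \<rho>" by (rule holomorphic_higher_deriv[OF K_holomorphic open_ball])
    from holomorphic_derivI[OF this open_ball in_ball[OF t]]
    have d: "((deriv ^^ n) K has_field_derivative (deriv ^^ Suc n) K (\<alpha> * of_real t)) (at (\<alpha> * of_real t))" by simp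
    have "((\<lambda>t. \<alpha> * of_real t) has_vector_derivative \<alpha>) (at t within {0..<1})"
      by (auto intro!: derivative_eq_intros simp: has_vector_derivative_def scaleR_conv_of_real)
    from field_vector_diff_chain_within[OF this has_field_derivative_at_within[OF d]]
    have "((\<lambda>t. (deriv ^^ n) K (\<alpha> * of_real t)) has_vector_derivative \<alpha> * (deriv ^^ Suc n) K (\<alpha> * of_real t))
        (at t within {0..<1})"
      by (simp add: o_def)
    from has_vector_derivative_mult_left[OF this, of "\<alpha> ^ n"]
    show ?thesis unfolding D_def[abs_def] by (simp add: mult_ac)
  qed
  have D1: "D 1 t \<noteq> 0" if "t \<in> {0..<1}" for t
    using K_deriv[OF in_ball[OF that]] \<alpha>0 by (simp add: D_def)
  have "inj_on (ray j) {0..<1}"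
  proof (rule inj_onI)
    fix s t assume st: "s \<in> {0..<1}" "t \<in> {0..<1}" "ray j s = ray j t"
    then have "\<alpha> * of_real s = \<alpha> * of_real t"
      using inj_onD[OF K_inj _ in_ball[OF st(1)] in_ball[OF st(2)]] by (simp add: ray_def \<alpha>_def)
    then show "s = t" using \<alpha>0 by simp
  qed
  then show ?thesis unfolding smooth_curve_ending_at_def using ray_0 D0 DD D1 by blast
qed

text \<open>
  The signs \<open>(-1)\<^sup>j \<sigma>\<^sub>j\<close> and \<open>(-1)\<^sup>j\<^sup>+\<^sup>1 \<sigma>\<^sub>j\<^sub>+\<^sub>1\<close> of \<open>h\<close> relative to \<open>Re G\<close> on the two sides of the ray
  are different.
\<close>

definition jump :: "nat \<Rightarrow> bool" where "jump j \<longleftrightarrow> \<sigma> j \<noteq> - \<sigma> (Suc j)"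

text \<open>
  Around a point of the ray a small rectangle in the coordinate of the sector \<open>j\<close> is a chart. If
  \<open>\<mu>\<close> vanished on it, the slopes on its two sides would agree.
\<close>

lemma ray_in_support:
  assumes j: "j \<le> 2 * m" "jump j" and t: "0 < t" "t < 1" and U: "open U" "ray j t \<in> U"
  shows "\<not> vanishes_on \<mu> U"
proof
  assume v: "vanishes_on \<mu> U"
  let ?S = "rect (-r) r 0 r" and ?y = "r * t ^ m"
  have S: "?S \<inter> \<real>\<^sub>\<le>\<^sub>0 = {}" "\<And>w. w \<in> ?S \<Longrightarrow> norm w < \<rho> ^ m"
    using R_norm by (auto simp: in_box_complex_iff complex_nonpos_Reals_iff)
  have w0: "Complex 0 ?y \<in> ?S" using ray_point[OF t] by (auto simp: in_box_complex_iff)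
  have "open (?S \<inter> branch j -` U)"
    by (rule continuous_open_preimage[OF holomorphic_on_imp_continuous_on[OF branch_holomorphic[OF S]] open_box U(1)])
  moreover have "Complex 0 ?y \<in> ?S \<inter> branch j -` U" using w0 U(2) ray_eq_branch[OF t(1)] by simp
  ultimately obtain e where e: "0 < e" "ball (Complex 0 ?y) e \<subseteq> ?S \<inter> branch j -` U" by (rule openE)
  define \<epsilon> where "\<epsilon> = e / 2"
  let ?B = "rect (-\<epsilon>) \<epsilon> (?y - \<epsilon>) (?y + \<epsilon>)"
  have BS: "?B \<subseteq> ?S \<inter> branch j -` U"
  proof
    fix w assume "w \<in> ?B"
    then have b: "-\<epsilon> < Re w" "Re w < \<epsilon>" "?y - \<epsilon> < Im w" "Im w < ?y + \<epsilon>"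
      by (simp_all add: in_box_complex_iff)
    have "\<bar>Re w\<bar> < e / 2" "\<bar>Im w - ?y\<bar> < e / 2" using b unfolding \<epsilon>_def by linarith+
    then have "norm (w - Complex 0 ?y) < e" using cmod_le[of "w - Complex 0 ?y"] by simp
    then show "w \<in> ?S \<inter> branch j -` U" using e(2) by (auto simp: dist_norm norm_minus_commute)
  qed
  have B: "?B \<inter> \<real>\<^sub>\<le>\<^sub>0 = {}" "\<And>w. w \<in> ?B \<Longrightarrow> norm w < \<rho> ^ m" using BS S by blast+
  have inv: "(-1) ^ j * G (branch j w) = w" if "w \<in> ?B" for w
  proof -
    have "w \<notin> \<real>\<^sub>\<le>\<^sub>0" using B(1) that by blast
    then have "w \<noteq> 0" by auto
    then show ?thesis by (rule G_branch[OF _ B(2)[OF that]])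
  qed
  have "\<sigma> j = - \<sigma> (Suc j)"
  proof (rule no_jump_where_vanishes[OF chart_branch[OF B]])
    show "0 < \<epsilon>" "?y - \<epsilon> < ?y + \<epsilon>" using e(1) by (auto simp: \<epsilon>_def)
    show "vanishes_on \<mu> (branch j ` ?B)" by (rule vanishes_on_mono[OF v]) (use BS in auto)
    fix z assume "z \<in> branch j ` ?B"
    then obtain w where w: "w \<in> ?B" "z = branch j w" by blast
    have wS: "w \<in> ?S" using BS w(1) by blast
    { assume "0 < Re ((-1) ^ j * G z)"
      then show "h z = \<sigma> j * Re ((-1) ^ j * G z)"
        using slope[of j w] j(1) wS unfolding w(2) inv[OF w(1)] by (auto simp: in_box_complex_iff) }
    { assume "Re ((-1) ^ j * G z) < 0"
      then show "h z = - \<sigma> (Suc j) * Re ((-1) ^ j * G z)"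
        using h_left[OF j(1), of w] wS unfolding w(2) inv[OF w(1)] by (auto simp: in_box_complex_iff) }
  qed
  with j(2) show False by (simp add: jump_def)
qed

text \<open>
  Away from the rays with a jump, \<open>h\<close> is locally a constant sign times \<open>Re G\<close>, hence harmonic: inside a
  sector, across a ray without jump, and at \<open>z0\<close> if no ray has a jump.
\<close>

lemma not_in_support_off_rays:
  assumes z: "z \<in> V" and off: "\<And>j t. j \<le> 2 * m \<Longrightarrow> jump j \<Longrightarrow> t \<in> {0..<1} \<Longrightarrow> z \<noteq> ray j t"
  obtains B where "open B" "z \<in> B" "B \<subseteq> V" "vanishes_on \<mu> B"
proof -
  note thesisI = that
  have main: thesis if U: "open U" "U \<subseteq> V" "z \<in> U" and hU: "\<And>z. z \<in> U \<Longrightarrow> h z = s * Re (G z)" for U s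
  proof -
    have "U \<subseteq> \<Omega>" "G holomorphic_on U"
      using U(2) V_subset holomorphic_on_subset[OF G_holomorphic] by blast+
    note sub = this
    obtain B where B: "open B" "z \<in> B" "B \<subseteq> U" "vanishes_on \<mu> B"
      by (rule not_support_where_harmonic[OF U(1) sub _ U(3)]) (use hU in blast)+
    show thesis using B(1,2) order_trans[OF B(3) U(2)] B(4) by (rule thesisI)
  qed
  have signRe: "Re w = (-1) ^ j * Re (G (branch j w))" if "w \<in> R" "w \<noteq> 0" for j w
  proof -
    have "Re ((-1) ^ j * G (branch j w)) = Re w" using G_branch[OF that(2) R_norm[OF that(1)]] by simp
    then show ?thesis by (cases "even j") auto
  qed
  have piece: thesis
    if W: "rect l' r' c' d' \<subseteq> R" "rect l' r' c' d' \<inter> \<real>\<^sub>\<le>\<^sub>0 = {}" and w: "w \<in> rect l' r' c' d'" "z = branch j w"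
      and hW: "\<And>w. w \<in> rect l' r' c' d' \<Longrightarrow> h (branch j w) = \<sigma> j * Re w" for l' r' c' d' w j
  proof (rule main[of "branch j ` rect l' r' c' d'" "\<sigma> j * (-1) ^ j"])
    have n0: "w \<noteq> 0" if "w \<in> rect l' r' c' d'" for w using that W(2) by auto
    show "open (branch j ` rect l' r' c' d')"
      by (rule branch_open(1)[OF W(2) R_norm open_box]) (use W(1) in blast)
    show "branch j ` rect l' r' c' d' \<subseteq> V" using W(1) branch_in_V n0 by blast
    show "z \<in> branch j ` rect l' r' c' d'" using w by blast
    fix z assume "z \<in> branch j ` rect l' r' c' d'"
    then obtain w where w: "w \<in> rect l' r' c' d'" "z = branch j w" by blast
    have "h z = \<sigma> j * Re w" using hW[OF w(1)] w(2) by simp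
    also have "Re w = (-1) ^ j * Re (G z)" using signRe[OF _ n0[OF w(1)], of j] W(1) w by blast
    finally show "h z = \<sigma> j * (-1) ^ j * Re (G z)" by simp
  qed
  show thesis
  proof (cases "z = z0")
    case True
    \<comment> \<open>every ray contains \<open>z0\<close>, so none of them has a jump\<close>
    have nj: "\<sigma> j = - \<sigma> (Suc j)" if "j \<le> 2 * m" for j
      using off[of j 0] that True ray_0 by (auto simp: jump_def)
    have \<sigma>j: "\<sigma> j * (-1) ^ j = \<sigma> 0" if "j \<le> 2 * m" for j
      using that
    proof (induction j)
      case (Suc j)
      then show ?case using nj[of j] by simp
    qed simp
    have "h z = \<sigma> 0 * Re (G z)" if zV: "z \<in> V" for z
    proof (cases "z = z0")
      case True then show ?thesis using h_z0 G_z0 by simp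
    next
      case False
      with zV obtain j w where jw: "j \<le> 2 * m" "z = branch j w" "w \<in> R" "0 < Re w \<or> Re w = 0 \<and> 0 < Im w"
        by (rule V_cover)
      have "w \<noteq> 0" using jw(4) by auto
      note Rw = signRe[OF jw(3) this, of j]
      have "h z = \<sigma> j * Re w"
        using slope[of j w] h_axis[of j w] jw by (auto simp: in_box_complex_iff)
      then show ?thesis using Rw \<sigma>j[OF jw(1)] jw(2) by simp
    qed
    then show thesis using main[of V "\<sigma> 0"] V_open z by blast
  next
    case False
    with z obtain j w where jw: "j \<le> 2 * m" "z = branch j w" "w \<in> R" "0 < Re w \<or> Re w = 0 \<and> 0 < Im w"
      by (rule V_cover)
    show thesis
    proof (cases "0 < Re w")
      case True
      show thesis
      proof (rule piece[OF _ _ _ jw(2)])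
        show "w \<in> rect 0 r (-r) r" using jw(3) True by (auto simp: in_box_complex_iff)
        show "h (branch j w) = \<sigma> j * Re w" if "w \<in> rect 0 r (-r) r" for w
          using slope[OF _ that, of j] jw(1) by simp
      qed (use r(1) in \<open>auto simp: in_box_complex_iff complex_nonpos_Reals_iff\<close>)
    next
      case False
      then have w: "Re w = 0" "0 < Im w" using jw(4) by auto
      have Imr: "Im w < r" using jw(3) by (auto simp: in_box_complex_iff)
      \<comment> \<open>the parameter of \<open>z\<close> on the ray \<open>j\<close>\<close>
      define t where "t = root m (Im w / r)"
      have tm: "t ^ m = Im w / r" "0 < t" using w Imr r m_pos by (auto simp: t_def)
      have t1: "t < 1" unfolding t_def using m_pos Imr r(1) by simp
      have "w = Complex 0 (r * t ^ m)" using w tm r by (simp add: complex_eq_iff)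
      then have "z = ray j t" using ray_eq_branch[OF tm(2)] jw(2) by simp
      then have nj: "\<sigma> j = - \<sigma> (Suc j)" using off[OF jw(1), of t] tm(2) t1 by (auto simp: jump_def)
      show thesis
      proof (rule piece[OF _ _ _ jw(2)])
        show "w \<in> rect (-r) r 0 r" using jw(3) w by (auto simp: in_box_complex_iff)
        fix w assume W: "w \<in> rect (-r) r 0 r"
        then have wR: "w \<in> R" "0 < Im w" using r(1) by (auto simp: in_box_complex_iff)
        consider "0 < Re w" | "Re w = 0" | "Re w < 0" by linarith
        then show "h (branch j w) = \<sigma> j * Re w"
        proof cases
          case 1 then show ?thesis using slope[of j w] jw(1) wR(1) by (auto simp: in_box_complex_iff)
        next
          case 2 then show ?thesis using h_axis[OF jw(1) wR(1) 2 wR(2)] by simp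
        next
          case 3 then show ?thesis using h_left[OF jw(1) wR(1) 3 wR(2)] nj by simp
        qed
      qed (use r(1) in \<open>auto simp: in_box_complex_iff complex_nonpos_Reals_iff\<close>)
    qed
  qed
qed

lemma support_eq_rays:
  "signed_support (signed_restrict \<mu> V) = (\<Union>\<gamma> \<in> ray ` {j. j \<le> 2 * m \<and> jump j}. \<gamma> ` {0..<1})"
proof (intro set_eqI iffI)
  fix z assume "z \<in> signed_support (signed_restrict \<mu> V)"
  then have z: "z \<in> V" "\<And>U. open U \<Longrightarrow> z \<in> U \<Longrightarrow> U \<subseteq> V \<Longrightarrow> \<not> vanishes_on \<mu> U"
    using signed_support_restrict[OF V_open V_subset(2)] by auto
  show "z \<in> (\<Union>\<gamma> \<in> ray ` {j. j \<le> 2 * m \<and> jump j}. \<gamma> ` {0..<1})"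
  proof (rule ccontr)
    assume neg: "\<not> ?thesis"
    obtain B where B: "open B" "z \<in> B" "B \<subseteq> V" "vanishes_on \<mu> B"
    proof (rule not_in_support_off_rays[OF z(1)])
      show "z \<noteq> ray j t" if "j \<le> 2 * m" "jump j" "t \<in> {0..<1}" for j t using that neg by blast
    qed blast
    with z(2) show False by blast
  qed
next
  fix z assume "z \<in> (\<Union>\<gamma> \<in> ray ` {j. j \<le> 2 * m \<and> jump j}. \<gamma> ` {0..<1})"
  then obtain j t where j: "j \<le> 2 * m" "jump j" and t: "t \<in> {0..<1}" "z = ray j t" by blast
  have "\<not> vanishes_on \<mu> U" if U: "open U" "z \<in> U" for U
  proof (cases "t = 0")
    case False
    then have "0 < t" "t < 1" using t(1) by auto
    from ray_in_support[OF j this U(1)] show ?thesis using U(2) t(2) by blast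
  next
    case True
    have "continuous_on {0..<1} (ray j)"
    proof -
      obtain D where "D 0 = ray j" "\<And>n t. t \<in> {0..<1} \<Longrightarrow> (D n has_vector_derivative D (Suc n) t) (at t within {0..<1})"
        using ray_smooth unfolding smooth_curve_ending_at_def by blast
      then show ?thesis by (metis continuous_on_vector_derivative)
    qed
    then have "((ray j) \<longlongrightarrow> ray j 0) (at 0 within {0..<1})" by (auto simp: continuous_on)
    moreover have "at 0 within {0..<1} = at_right (0::real)"
      by (rule at_within_nhd[of _ "{-1<..<1}"]) auto
    ultimately have "\<forall>\<^sub>F t in at_right 0. ray j t \<in> U"
      using topological_tendstoD[OF _ U(1)] U(2) t(2) True by auto
    moreover have "\<forall>\<^sub>F t in at_right (0::real). t \<in> {0<..<1}" by (rule eventually_at_right_real) simp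
    ultimately have "\<forall>\<^sub>F t in at_right 0. ray j t \<in> U \<and> t \<in> {0<..<1}" by (rule eventually_conj)
    then obtain t' where "ray j t' \<in> U" "0 < t'" "t' < 1"
      using eventually_happens'[OF trivial_limit_at_right_real] by fastforce
    then show ?thesis using ray_in_support[OF j _ _ U(1)] by blast
  qed
  then show "z \<in> signed_support (signed_restrict \<mu> V)"
    using signed_support_restrict[OF V_open V_subset(2)] ray_image(1)[OF t(1)] t(2) by auto
qed

lemma local_structure:
  "\<exists>V H (\<theta> :: complex \<Rightarrow> real).
    open V \<and> z0 \<in> V \<and> V \<subseteq> \<Omega> \<and>
    harmonic_on H V \<and>
    \<theta> ` V \<subseteq> {1, -1} \<and>
    (\<forall>z\<in>V. h z = \<theta> z * H z) \<and>
    continuous_on V (\<lambda>z. \<theta> z * H z) \<and>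
    (H has_derivative (\<lambda>_. 0)) (at z0) \<and>
    (\<exists>\<Gamma>. finite \<Gamma> \<and>
       (\<forall>\<gamma>\<in>\<Gamma>. smooth_curve_ending_at z0 \<gamma> \<and> \<gamma> ` {0..<1} \<subseteq> {z\<in>V. H z = 0}) \<and>
       signed_support (signed_restrict \<mu> V) = (\<Union>\<gamma>\<in>\<Gamma>. \<gamma> ` {0..<1}))"
proof -
  define H where "H z = Re (G z)" for z
  define \<theta> :: "complex \<Rightarrow> real" where "\<theta> z = (if h z = H z then 1 else -1)" for z
  have GV: "G holomorphic_on V" using G_holomorphic V_subset(1) by (rule holomorphic_on_subset)
  have h\<theta>: "h z = \<theta> z * H z" if "z \<in> V" for z using h_eq_abs[OF that] by (auto simp: \<theta>_def H_def)
  show ?thesis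
  proof (rule exI[of _ V], rule exI[of _ H], rule exI[of _ \<theta>], intro conjI)
    show "harmonic_on H V" unfolding H_def[abs_def] by (rule harmonic_on_Re_holomorphic[OF V_open GV])
    show "\<theta> ` V \<subseteq> {1, -1}" by (auto simp: \<theta>_def)
    show "\<forall>z\<in>V. h z = \<theta> z * H z" using h\<theta> by blast
    have "continuous_on V h" using h_continuous V_subset(2) by (rule continuous_on_subset)
    then show "continuous_on V (\<lambda>z. \<theta> z * H z)" by (rule continuous_on_eq) (rule h\<theta>)
    show "(H has_derivative (\<lambda>_. 0)) (at z0)"
      using has_derivative_Re_Im_holomorphic(1)[OF GV V_open z0_in_V] G'_z0 by (simp add: H_def[abs_def])
    show "\<exists>\<Gamma>. finite \<Gamma> \<and>
       (\<forall>\<gamma>\<in>\<Gamma>. smooth_curve_ending_at z0 \<gamma> \<and> \<gamma> ` {0..<1} \<subseteq> {z\<in>V. H z = 0}) \<and>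
       signed_support (signed_restrict \<mu> V) = (\<Union>\<gamma>\<in>\<Gamma>. \<gamma> ` {0..<1})"
      by (rule exI[of _ "ray ` {j. j \<le> 2 * m \<and> jump j}"])
        (use support_eq_rays ray_smooth ray_image in \<open>auto simp: H_def\<close>)
  qed (use V_open z0_in_V V_subset(2) in auto)
qed

end

theorem theorem1p2:
  fixes \<Omega> :: "complex set" and \<mu> :: signed_measure
    and h :: "complex \<Rightarrow> real" and \<omega> :: "complex \<Rightarrow> complex" and z0 :: complex
  assumes "open \<Omega>" and "bounded \<Omega>"
    and "radon_measure \<Omega> \<mu>" and "in_H_minus_1 \<Omega> \<mu>"
    and "stationary_harmonic \<Omega> h"
    and "continuous_on \<Omega> h" (* h is the continuous representative *)
    and "distributional_laplacian \<Omega> h \<mu>"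
    and "\<omega> holomorphic_on \<Omega>" and "AE z in lebesgue_on \<Omega>. \<omega> z = omega \<Omega> h z"
      (* \<omega> is the holomorphic representative of omega \<Omega> h *)
    and "z0 \<in> signed_support \<mu>"
    and "zero_of_even_order \<omega> z0"
    and "h z0 = 0"
  shows "\<exists>V H (\<theta> :: complex \<Rightarrow> real).
    open V \<and> z0 \<in> V \<and> V \<subseteq> \<Omega> \<and>
    harmonic_on H V \<and>
    \<theta> ` V \<subseteq> {1, -1} \<and>
    (\<forall>z\<in>V. h z = \<theta> z * H z) \<and>
    continuous_on V (\<lambda>z. \<theta> z * H z) \<and>
    (H has_derivative (\<lambda>_. 0)) (at z0) \<and>
    (\<exists>\<Gamma>. finite \<Gamma> \<and>
       (\<forall>\<gamma>\<in>\<Gamma>. smooth_curve_ending_at z0 \<gamma> \<and> \<gamma> ` {0..<1} \<subseteq> {z\<in>V. H z = 0}) \<and>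
       signed_support (signed_restrict \<mu> V) = (\<Union>\<gamma>\<in>\<Gamma>. \<gamma> ` {0..<1}))"
proof -
  interpret stationary_harmonic_function \<Omega> \<mu> h \<omega>
    by unfold_locales (fact assms(1,3,5,6,7,9))+
  have z0: "z0 \<in> \<Omega>" using assms(10) radon_space(1) by (auto simp: signed_support_def)
  obtain R G where R: "0 < R" "cball z0 R \<subseteq> \<Omega>" and G: "G holomorphic_on ball z0 R"
    "\<And>z. z \<in> ball z0 R \<Longrightarrow> (deriv G z)\<^sup>2 = \<omega> z" "G z0 = 0" "deriv G z0 = 0" "\<exists>w\<in>ball z0 R. G w \<noteq> 0"
    using even_zero_square_root_primitive[OF assms(1,8) z0 assms(11)] by metis
  obtain m :: nat and \<rho> and K where K: "2 \<le> m" "0 < \<rho>" "K holomorphic_on ball 0 \<rho>" "K 0 = z0"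
    "inj_on K (ball 0 \<rho>)" "\<And>w. w \<in> ball 0 \<rho> \<Longrightarrow> deriv K w \<noteq> 0"
    "K ` ball 0 \<rho> \<subseteq> ball z0 R" "\<And>w. w \<in> ball 0 \<rho> \<Longrightarrow> G (K w) = w ^ m"
    using conformal_power_normal_form[OF G(1) R(1) G(3-5)] by metis
  interpret even_zero \<Omega> \<mu> h \<omega> z0 m \<rho> G K "cball z0 R"
  proof unfold_locales
    show "K ` ball 0 \<rho> \<subseteq> cball z0 R" using K(7) ball_subset_cball[of z0 R] by (rule order_trans)
    show "G holomorphic_on K ` ball 0 \<rho>" using G(1) K(7) by (rule holomorphic_on_subset)
    show "(deriv G z)\<^sup>2 = \<omega> z" if "z \<in> K ` ball 0 \<rho>" for z using G(2) K(7) that by blast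
  qed (use K R(2) G(4) assms(12) in auto)
  obtain r \<sigma> where "0 < r" "2 * r \<le> \<rho> ^ m" "\<And>j. \<sigma> j = 1 \<or> \<sigma> j = -1"
    "\<And>j w. j \<le> 2 * m + 1 \<Longrightarrow> w \<in> rect 0 r (-r) r \<Longrightarrow> h (branch j w) = \<sigma> j * Re w"
    using uniform_radius by metis
  then interpret even_zero_neighbourhood \<Omega> \<mu> h \<omega> z0 m \<rho> G K "cball z0 R" r \<sigma>
    by unfold_locales
  show ?thesis by (rule local_structure)
qed

end
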